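(* Let $(A,\mathfrak m)$ be a (Noetherian) local ring, $\mathfrak q\subset A$ a proper ideal, $M$ a finitely generated $A$-module and $\underline a=a_1,\ldots,a_t$ a system of parameters of $M$ with $a_i\in\mathfrak q^{c_i}$, $c_i\in\mathbb N$, for $i=1,\ldots,t$. Suppose that $$a_i^\star\notin\mathfrak P\ \text{ for all }\ \mathfrak P\in\operatorname{Ass}G_{M/(a_1,\ldots,a_{i-1})M}(\mathfrak q)\setminus V(G_A(\mathfrak q)_+)\quad\text{for } i=1,\ldots,t.$$ Then $$\check H^t(\underline a,\mathfrak q,M;n)=H^t_{\underline{aT^c}}(R_M(\mathfrak q))_n=0\quad\text{for all } n\gg0.$$
   Context: $R_A(\mathfrak q)=\bigoplus_{n\ge0}\mathfrak q^nT^n\subseteq A[T]$ and $R_M(\mathfrak q)=\bigoplus_{n\ge0}\mathfrak q^nM\,T^n$ are the Rees ring and Rees module; $G_A(\mathfrak q)=\bigoplus_{n\ge0}\mathfrak q^n/\mathfrak q^{n+1}$, and $G_N(\mathfrak q)=\bigoplus_{n\ge0}\mathfrak q^nN/\mathfrak q^{n+1}N$ for an $A$-module $N$, are the form ring and form module (a $G_A(\mathfrak q)$-module); $G_A(\mathfrak q)_+$ is the ideal of elements of positive degree. $a_i^\star=a_i+\mathfrak q^{c_i+1}\in[G_A(\mathfrak q)]_{c_i}$. $\underline{aT^c}=a_1T^{c_1},\ldots,a_tT^{c_t}$ with $a_iT^{c_i}\in[R_A(\mathfrak q)]_{c_i}$; $H^i_{\underline{aT^c}}$ is local cohomology over $R_A(\mathfrak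 q)$ with respect to the ideal they generate, and $(\cdot)_n$ is the $n$-th graded component. For $x\in\mathfrak q^e$ let $M[\mathfrak q^e/x]\subseteq M_x$ be the $A$-submodule of all elements $m_0/1+q_1m_1/x+\cdots+q_sm_s/x^s$ with $s\ge0$, $m_i\in M$, $q_i\in\mathfrak q^{ei}$; $\mathfrak q^nM[\mathfrak q^e/x]=\mathfrak q^n\cdot M[\mathfrak q^e/x]$. $\check C^\bullet(\underline a,\mathfrak q,M;n)$ is the subcomplex of the Čech complex $\check C_{\underline a}\otimes_AM$ with $i$-th term $\bigoplus_{1\le j_1<\cdots<j_i\le t}\mathfrak q^nM[\mathfrak q^{c_{j_1}+\cdots+c_{j_i}}/(a_{j_1}\cdots a_{j_i})]$ for $0\le i\le t$ (for $i=0$: $\mathfrak q^nM$), and $\check H^i(\underline a,\mathfrak q,M;n)$ is its $i$-th cohomology; it is identified with $H^i_{\underline{aT^c}}(R_M(\mathfrak q))_n$. *)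

theory Defs
  imports "HOL-Algebra.UnivPoly" "HOL-Algebra.Ideal_Product" "HOL-Algebra.Ring_Divisibility" "HOL-Library.Extended_Nat"
begin

text \<open>Modules are records of HOL-Algebra; the ring fields \<open>mult\<close> and \<open>one\<close> of a module record
  carry no meaning and are left undefined in the constructions below. Sequences
  \<open>a\<^sub>1, \<dots>, a\<^sub>t\<close> are functions on \<^typ>\<open>nat\<close> of which only the values on \<open>{1..t}\<close> matter.\<close>

section \<open>Commutative algebra\<close>

definition local_ring :: "('a, 'm) ring_scheme \<Rightarrow> 'a set \<Rightarrow> bool" where
  "local_ring A \<mm> \<longleftrightarrow> cring A \<and> maximalideal \<mm> A \<and> (\<forall>I. maximalideal I A \<longrightarrow> I = \<mm>)"

abbreviation ideal_pow :: "('a, 'm) ring_scheme \<Rightarrow> 'a set \<Rightarrow> nat \<Rightarrow> 'a set" where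
  "ideal_pow A I n \<equiv> I [^]\<^bsub>ideals_set A\<^esub> n"

definition module_span ::
  "('a, 'm) ring_scheme \<Rightarrow> ('a, 'b, 'k) module_scheme \<Rightarrow> 'b set \<Rightarrow> 'b set" where
  "module_span A M S = \<Inter>{N. submodule N A M \<and> S \<subseteq> N}"

definition finitely_generated ::
  "('a, 'm) ring_scheme \<Rightarrow> ('a, 'b, 'k) module_scheme \<Rightarrow> bool" where
  "finitely_generated A M \<longleftrightarrow>
     (\<exists>S. finite S \<and> S \<subseteq> carrier M \<and> module_span A M S = carrier M)"

text \<open>The submodule \<open>I N\<close> of \<open>M\<close>, for an ideal \<open>I\<close> and a submodule \<open>N\<close> of \<open>M\<close>.\<close>

definition ideal_smult ::
  "('a, 'm) ring_scheme \<Rightarrow> 'a set \<Rightarrow> ('a, 'b, 'k) module_scheme \<Rightarrow> 'b set \<Rightarrow> 'b set" where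
  "ideal_smult A I M N = module_span A M {r \<odot>\<^bsub>M\<^esub> m | r m. r \<in> I \<and> m \<in> N}"

definition quot_module :: "('a, 'b, 'k) module_scheme \<Rightarrow> 'b set \<Rightarrow> ('a, 'b set) module" where
  "quot_module M N =
     \<lparr> carrier = a_rcosets\<^bsub>M\<^esub> N, monoid.mult = undefined, one = undefined,
       zero = N, add = set_add M,
       smult = (\<lambda>r U. \<Union>m\<in>U. N +>\<^bsub>M\<^esub> (r \<odot>\<^bsub>M\<^esub> m)) \<rparr>"

definition annihilator :: "('a, 'm) ring_scheme \<Rightarrow> ('a, 'b, 'k) module_scheme \<Rightarrow> 'a set" where
  "annihilator A M = {r \<in> carrier A. \<forall>m\<in>carrier M. r \<odot>\<^bsub>M\<^esub> m = \<zero>\<^bsub>M\<^esub>}"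

definition Ass :: "('a, 'm) ring_scheme \<Rightarrow> ('a, 'b, 'k) module_scheme \<Rightarrow> 'a set set" where
  "Ass A M = {P. primeideal P A \<and>
     (\<exists>m\<in>carrier M. P = {r \<in> carrier A. r \<odot>\<^bsub>M\<^esub> m = \<zero>\<^bsub>M\<^esub>})}"

definition V_set :: "('a, 'm) ring_scheme \<Rightarrow> 'a set \<Rightarrow> 'a set set" where
  "V_set A I = {P. primeideal P A \<and> I \<subseteq> P}"

text \<open>Krull dimension of \<open>A / Ann M\<close>. The dimension of the zero module is \<open>0\<close> here.\<close>

definition module_dim :: "('a, 'm) ring_scheme \<Rightarrow> ('a, 'b, 'k) module_scheme \<Rightarrow> enat" where
  "module_dim A M = (SUP n \<in> {n. \<exists>P. (\<forall>i\<le>n. primeideal (P i) A \<and> annihilator A M \<subseteq> P i) \<and>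
                                   (\<forall>i<n. P i \<subset> P (Suc i))}. enat n)"

definition finite_length :: "('a, 'm) ring_scheme \<Rightarrow> ('a, 'b, 'k) module_scheme \<Rightarrow> bool" where
  "finite_length A M \<longleftrightarrow>
     (\<exists>b. \<forall>n N. (\<forall>i\<le>n. submodule (N i) A M) \<and> (\<forall>i<n. N i \<subset> N (Suc i)) \<longrightarrow> n \<le> (b::nat))"

definition system_of_parameters ::
  "('a, 'm) ring_scheme \<Rightarrow> 'a set \<Rightarrow> ('a, 'b, 'k) module_scheme \<Rightarrow> (nat \<Rightarrow> 'a) \<Rightarrow> nat \<Rightarrow> bool" where
  "system_of_parameters A \<mm> M a t \<longleftrightarrow>
     (\<forall>i\<in>{1..t}. a i \<in> \<mm>) \<and> module_dim A M = enat t \<and>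
     finite_length A (quot_module M (ideal_smult A (genideal A (a ` {1..t})) M (carrier M)))"


section \<open>Form ring and form module\<close>

text \<open>Elements of \<open>\<Oplus>\<^sub>n \<qq>\<^sup>n / \<qq>\<^sup>n\<^sup>+\<^sup>1\<close> are finitely supported functions on \<^typ>\<open>nat\<close> whose value
  at \<open>n\<close> is a coset of \<open>\<qq>\<^sup>n\<^sup>+\<^sup>1\<close>. The degree \<open>n\<close> parts of products are formed in \<open>A / \<qq>\<^sup>n\<^sup>+\<^sup>1\<close>
  (respectively \<open>N / \<qq>\<^sup>n\<^sup>+\<^sup>1 N\<close>), by multiplying all pairs of representatives.\<close>

definition form_ring :: "('a, 'm) ring_scheme \<Rightarrow> 'a set \<Rightarrow> (nat \<Rightarrow> 'a set) ring" where
  "form_ring A \<qq> =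
     \<lparr> carrier = {f. (\<forall>n. \<exists>x\<in>ideal_pow A \<qq> n. f n = ideal_pow A \<qq> (Suc n) +>\<^bsub>A\<^esub> x) \<and>
                     finite {n. f n \<noteq> ideal_pow A \<qq> (Suc n)}},
       monoid.mult = (\<lambda>f g n. \<Oplus>\<^bsub>A Quot ideal_pow A \<qq> (Suc n)\<^esub> i\<in>{..n}.
                 rcoset_mult A (ideal_pow A \<qq> (Suc n)) (f i) (g (n - i))),
       one = (\<lambda>n. if n = 0 then ideal_pow A \<qq> (Suc n) +>\<^bsub>A\<^esub> \<one>\<^bsub>A\<^esub> else ideal_pow A \<qq> (Suc n)),
       zero = (\<lambda>n. ideal_pow A \<qq> (Suc n)),
       add = (\<lambda>f g n. f n <+>\<^bsub>A\<^esub> g n) \<rparr>"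

definition form_ring_plus :: "('a, 'm) ring_scheme \<Rightarrow> 'a set \<Rightarrow> (nat \<Rightarrow> 'a set) set" where
  "form_ring_plus A \<qq> = {f \<in> carrier (form_ring A \<qq>). f 0 = ideal_pow A \<qq> (Suc 0)}"

text \<open>\<open>a\<^sup>\<star> = a + \<qq>\<^sup>c\<^sup>+\<^sup>1\<close>, placed in degree \<open>c\<close>.\<close>

definition form_elem :: "('a, 'm) ring_scheme \<Rightarrow> 'a set \<Rightarrow> nat \<Rightarrow> 'a \<Rightarrow> nat \<Rightarrow> 'a set" where
  "form_elem A \<qq> c a =
     (\<lambda>n. if n = c then ideal_pow A \<qq> (Suc n) +>\<^bsub>A\<^esub> a else ideal_pow A \<qq> (Suc n))"

definition ideal_pow_module ::
  "('a, 'm) ring_scheme \<Rightarrow> 'a set \<Rightarrow> ('a, 'b, 'k) module_scheme \<Rightarrow> nat \<Rightarrow> 'b set" where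
  "ideal_pow_module A \<qq> N n = ideal_smult A (ideal_pow A \<qq> n) N (carrier N)"

definition form_module ::
  "('a, 'm) ring_scheme \<Rightarrow> 'a set \<Rightarrow> ('a, 'b, 'k) module_scheme
     \<Rightarrow> (nat \<Rightarrow> 'a set, nat \<Rightarrow> 'b set) module" where
  "form_module A \<qq> N =
     \<lparr> carrier = {f. (\<forall>n. \<exists>x\<in>ideal_pow_module A \<qq> N n.
                           f n = ideal_pow_module A \<qq> N (Suc n) +>\<^bsub>N\<^esub> x) \<and>
                     finite {n. f n \<noteq> ideal_pow_module A \<qq> N (Suc n)}},
       monoid.mult = undefined, one = undefined,
       zero = (\<lambda>n. ideal_pow_module A \<qq> N (Suc n)),
       add = (\<lambda>f g n. f n <+>\<^bsub>N\<^esub> g n),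
       smult = (\<lambda>f g n. \<Oplus>\<^bsub>quot_module N (ideal_pow_module A \<qq> N (Suc n))\<^esub> i\<in>{..n}.
                  (\<Union>r\<in>f i. \<Union>m\<in>g (n - i). ideal_pow_module A \<qq> N (Suc n) +>\<^bsub>N\<^esub> (r \<odot>\<^bsub>N\<^esub> m))) \<rparr>"


section \<open>Rees ring and Rees module\<close>

definition rees_ring :: "('a, 'm) ring_scheme \<Rightarrow> 'a set \<Rightarrow> ('a, nat \<Rightarrow> 'a) up_ring" where
  "rees_ring A \<qq> =
     (UP A)\<lparr>carrier := {p \<in> carrier (UP A). \<forall>n. coeff (UP A) p n \<in> ideal_pow A \<qq> n}\<rparr>"

text \<open>\<open>f\<close> stands for \<open>\<Sum>\<^sub>n f n T\<^sup>n\<close>.\<close>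

definition rees_module ::
  "('a, 'm) ring_scheme \<Rightarrow> 'a set \<Rightarrow> ('a, 'b, 'k) module_scheme \<Rightarrow> (nat \<Rightarrow> 'a, nat \<Rightarrow> 'b) module" where
  "rees_module A \<qq> M =
     \<lparr> carrier = {f. (\<forall>n. f n \<in> ideal_pow_module A \<qq> M n) \<and> finite {n. f n \<noteq> \<zero>\<^bsub>M\<^esub>}},
       monoid.mult = undefined, one = undefined,
       zero = (\<lambda>n. \<zero>\<^bsub>M\<^esub>),
       add = (\<lambda>f g n. f n \<oplus>\<^bsub>M\<^esub> g n),
       smult = (\<lambda>p f n. \<Oplus>\<^bsub>M\<^esub> i\<in>{..n}. coeff (UP A) p i \<odot>\<^bsub>M\<^esub> f (n - i)) \<rparr>"

definition rees_part ::
  "('a, 'm) ring_scheme \<Rightarrow> 'a set \<Rightarrow> ('a, 'b, 'k) module_scheme \<Rightarrow> nat \<Rightarrow> (nat \<Rightarrow> 'b) set" where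
  "rees_part A \<qq> M n = {f \<in> carrier (rees_module A \<qq> M). \<forall>k. k \<noteq> n \<longrightarrow> f k = \<zero>\<^bsub>M\<^esub>}"


section \<open>Localization at an element\<close>

text \<open>The fraction \<open>m / x\<^sup>k\<close>, as the class of all pairs \<open>(m', k')\<close> with
  \<open>x\<^sup>l (x\<^sup>k\<^sup>' m - x\<^sup>k m') = 0\<close> for some \<open>l\<close>.\<close>

definition frac ::
  "('a, 'm) ring_scheme \<Rightarrow> ('a, 'b, 'k) module_scheme \<Rightarrow> 'a \<Rightarrow> 'b \<Rightarrow> nat \<Rightarrow> ('b \<times> nat) set" where
  "frac R M x m k =
     {(m', k'). m' \<in> carrier M \<and>
        (\<exists>l::nat. (x [^]\<^bsub>R\<^esub> (l + k')) \<odot>\<^bsub>M\<^esub> m = (x [^]\<^bsub>R\<^esub> (l + k)) \<odot>\<^bsub>M\<^esub> m')}"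

definition loc_module ::
  "('a, 'm) ring_scheme \<Rightarrow> ('a, 'b, 'k) module_scheme \<Rightarrow> 'a \<Rightarrow> ('a, ('b \<times> nat) set) module" where
  "loc_module R M x =
     \<lparr> carrier = {frac R M x m k | m k. m \<in> carrier M},
       monoid.mult = undefined, one = undefined,
       zero = frac R M x \<zero>\<^bsub>M\<^esub> 0,
       add = (\<lambda>U W. \<Union>(m, k)\<in>U. \<Union>(m', k')\<in>W.
                frac R M x ((x [^]\<^bsub>R\<^esub> k') \<odot>\<^bsub>M\<^esub> m \<oplus>\<^bsub>M\<^esub> (x [^]\<^bsub>R\<^esub> k) \<odot>\<^bsub>M\<^esub> m') (k + k')),
       smult = (\<lambda>r U. \<Union>(m, k)\<in>U. frac R M x (r \<odot>\<^bsub>M\<^esub> m) k) \<rparr>"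

text \<open>The canonical map \<open>M\<^sub>x \<rightarrow> M\<^sub>z\<close>, \<open>m / x\<^sup>k \<mapsto> y\<^sup>k m / z\<^sup>k\<close>, for \<open>z = x y\<close>.\<close>

definition loc_map ::
  "('a, 'm) ring_scheme \<Rightarrow> ('a, 'b, 'k) module_scheme \<Rightarrow> 'a \<Rightarrow> 'a \<Rightarrow> ('b \<times> nat) set \<Rightarrow> ('b \<times> nat) set"
  where
  "loc_map R M y z U = (\<Union>(m, k)\<in>U. frac R M z ((y [^]\<^bsub>R\<^esub> k) \<odot>\<^bsub>M\<^esub> m) k)"

text \<open>\<open>M[\<qq>\<^sup>e/x]\<close>, the set of all \<open>m\<^sub>0/1 + q\<^sub>1 m\<^sub>1/x + \<dots> + q\<^sub>s m\<^sub>s/x\<^sup>s\<close> with \<open>m\<^sub>i \<in> M\<close>, \<open>q\<^sub>i \<in> \<qq>\<^sup>e\<^sup>i\<close>.\<close>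

definition blowup_part ::
  "('a, 'm) ring_scheme \<Rightarrow> 'a set \<Rightarrow> ('a, 'b, 'k) module_scheme \<Rightarrow> nat \<Rightarrow> 'a \<Rightarrow> ('b \<times> nat) set set"
  where
  "blowup_part A \<qq> M e x =
     {frac A M x (m 0) 0 \<oplus>\<^bsub>loc_module A M x\<^esub>
        (\<Oplus>\<^bsub>loc_module A M x\<^esub> i\<in>{1..s}. frac A M x (q i \<odot>\<^bsub>M\<^esub> m i) i)
      | (s::nat) m q. (\<forall>i\<le>s. m i \<in> carrier M) \<and> (\<forall>i\<in>{1..s}. q i \<in> ideal_pow A \<qq> (e * i))}"


section \<open>Cech complexes and their cohomology\<close>

text \<open>Cohomology of a complex of modules \<open>C 0 \<rightarrow> C 1 \<rightarrow> \<dots>\<close> with differentials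
  \<open>d i : C i \<rightarrow> C (i + 1)\<close>.\<close>

definition cocycles ::
  "(nat \<Rightarrow> ('a, 'c) module) \<Rightarrow> (nat \<Rightarrow> 'c \<Rightarrow> 'c) \<Rightarrow> nat \<Rightarrow> 'c set" where
  "cocycles C d i = {z \<in> carrier (C i). d i z = \<zero>\<^bsub>C (Suc i)\<^esub>}"

definition coboundaries ::
  "(nat \<Rightarrow> ('a, 'c) module) \<Rightarrow> (nat \<Rightarrow> 'c \<Rightarrow> 'c) \<Rightarrow> nat \<Rightarrow> 'c set" where
  "coboundaries C d i = (case i of 0 \<Rightarrow> {\<zero>\<^bsub>C 0\<^esub>} | Suc j \<Rightarrow> d j ` carrier (C j))"

definition cohomology ::
  "(nat \<Rightarrow> ('a, 'c) module) \<Rightarrow> (nat \<Rightarrow> 'c \<Rightarrow> 'c) \<Rightarrow> nat \<Rightarrow> ('a, 'c set) module" where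
  "cohomology C d i = quot_module ((C i)\<lparr>carrier := cocycles C d i\<rparr>) (coboundaries C d i)"

text \<open>Indices \<open>1 \<le> j\<^sub>1 < \<dots> < j\<^sub>i \<le> t\<close> are encoded by the set \<open>J = {j\<^sub>1, \<dots>, j\<^sub>i}\<close>, and
  \<open>x\<^sub>J\<close> is the product of the \<open>x\<^sub>j\<close> with \<open>j \<in> J\<close>. For \<open>J = {}\<close> the module \<open>M\<close> appears as its
  localization at \<open>1\<close>.\<close>

type_synonym 'b cochain = "nat set \<Rightarrow> ('b \<times> nat) set"

definition cech_index :: "nat \<Rightarrow> nat \<Rightarrow> nat set set" where
  "cech_index t i = {J. J \<subseteq> {1..t} \<and> card J = i}"

definition cech_elem :: "('a, 'm) ring_scheme \<Rightarrow> (nat \<Rightarrow> 'a) \<Rightarrow> nat set \<Rightarrow> 'a" where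
  "cech_elem R x J = (\<Otimes>\<^bsub>R\<^esub> j\<in>J. x j)"

definition cech_term ::
  "('a, 'm) ring_scheme \<Rightarrow> ('a, 'b, 'k) module_scheme \<Rightarrow> (nat \<Rightarrow> 'a) \<Rightarrow> nat \<Rightarrow> nat
     \<Rightarrow> ('a, 'b cochain) module" where
  "cech_term R M x t i =
     \<lparr> carrier = (\<Pi>\<^sub>E J\<in>cech_index t i. carrier (loc_module R M (cech_elem R x J))),
       monoid.mult = undefined, one = undefined,
       zero = (\<lambda>J\<in>cech_index t i. \<zero>\<^bsub>loc_module R M (cech_elem R x J)\<^esub>),
       add = (\<lambda>f g. \<lambda>J\<in>cech_index t i. f J \<oplus>\<^bsub>loc_module R M (cech_elem R x J)\<^esub> g J),
       smult = (\<lambda>r f. \<lambda>J\<in>cech_index t i. r \<odot>\<^bsub>loc_module R M (cech_elem R x J)\<^esub> f J) \<rparr>"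

definition cech_diff ::
  "('a, 'm) ring_scheme \<Rightarrow> ('a, 'b, 'k) module_scheme \<Rightarrow> (nat \<Rightarrow> 'a) \<Rightarrow> nat \<Rightarrow> nat
     \<Rightarrow> 'b cochain \<Rightarrow> 'b cochain" where
  "cech_diff R M x t i f =
     (\<lambda>J\<in>cech_index t (Suc i). \<Oplus>\<^bsub>loc_module R M (cech_elem R x J)\<^esub> j\<in>J.
        (let u = loc_map R M (x j) (cech_elem R x J) (f (J - {j}))
         in if even (card {k \<in> J. k < j}) then u
            else \<ominus>\<^bsub>loc_module R M (cech_elem R x J)\<^esub> u))"

text \<open>Local cohomology of \<open>M\<close> with support in the ideal \<open>(x\<^sub>1, \<dots>, x\<^sub>t)\<close> of the Noetherian ring \<open>R\<close>
  is taken as the cohomology of the Cech complex of \<open>x\<^sub>1, \<dots>, x\<^sub>t\<close> (up to isomorphism it only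
  depends on the ideal). In the graded situation this complex also provides the grading.\<close>

definition local_cohomology ::
  "('a, 'm) ring_scheme \<Rightarrow> ('a, 'b, 'k) module_scheme \<Rightarrow> (nat \<Rightarrow> 'a) \<Rightarrow> nat \<Rightarrow> nat
     \<Rightarrow> ('a, 'b cochain set) module" where
  "local_cohomology R M x t i = cohomology (cech_term R M x t) (cech_diff R M x t) i"

text \<open>Let \<open>M\<close> be graded with \<open>n\<close>-th component \<open>gr n\<close> and \<open>x\<close> homogeneous of degree \<open>e\<close>. Then
  \<open>m / x\<^sup>k\<close> has degree \<open>n\<close> if \<open>m\<close> has degree \<open>n + k e\<close>.\<close>

definition loc_part ::
  "('a, 'm) ring_scheme \<Rightarrow> ('a, 'b, 'k) module_scheme \<Rightarrow> (nat \<Rightarrow> 'b set) \<Rightarrow> 'a \<Rightarrow> nat \<Rightarrow> nat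
     \<Rightarrow> ('b \<times> nat) set set" where
  "loc_part R M gr x e n = {frac R M x m k | m k. m \<in> gr (n + k * e)}"

text \<open>The \<open>n\<close>-th component (\<open>n \<ge> 0\<close>) of local cohomology, where \<open>x\<^sub>j\<close> is homogeneous of degree
  \<open>c j\<close>: the classes of the homogeneous cocycles of degree \<open>n\<close>.\<close>

definition local_cohomology_part ::
  "('a, 'm) ring_scheme \<Rightarrow> ('a, 'b, 'k) module_scheme \<Rightarrow> (nat \<Rightarrow> 'b set) \<Rightarrow> (nat \<Rightarrow> 'a)
     \<Rightarrow> (nat \<Rightarrow> nat) \<Rightarrow> nat \<Rightarrow> nat \<Rightarrow> nat \<Rightarrow> 'b cochain set set" where
  "local_cohomology_part R M gr x c t i n =
     {coboundaries (cech_term R M x t) (cech_diff R M x t) i +>\<^bsub>cech_term R M x t i\<^esub> z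
      | z. z \<in> cocycles (cech_term R M x t) (cech_diff R M x t) i \<and>
           (\<forall>J\<in>cech_index t i. z J \<in> loc_part R M gr (cech_elem R x J) (\<Sum>j\<in>J. c j) n)}"

text \<open>The subcomplex of the Cech complex of \<open>a\<^sub>1, \<dots>, a\<^sub>t\<close> on \<open>M\<close> with components
  \<open>\<qq>\<^sup>n M[\<qq>\<^sup>e/a\<^sub>J]\<close>, where \<open>e\<close> is the sum of the \<open>c\<^sub>j\<close> with \<open>j \<in> J\<close>. For \<open>J = {}\<close> this is \<open>\<qq>\<^sup>n M\<close>.\<close>

definition cech_sub_term ::
  "('a, 'm) ring_scheme \<Rightarrow> 'a set \<Rightarrow> ('a, 'b, 'k) module_scheme \<Rightarrow> (nat \<Rightarrow> 'a) \<Rightarrow> (nat \<Rightarrow> nat)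
     \<Rightarrow> nat \<Rightarrow> nat \<Rightarrow> nat \<Rightarrow> ('a, 'b cochain) module" where
  "cech_sub_term A \<qq> M a c t n i =
     (cech_term A M a t i)\<lparr>carrier :=
        (\<Pi>\<^sub>E J\<in>cech_index t i.
           ideal_smult A (ideal_pow A \<qq> n) (loc_module A M (cech_elem A a J))
             (blowup_part A \<qq> M (\<Sum>j\<in>J. c j) (cech_elem A a J)))\<rparr>"

definition cech_sub_cohomology ::
  "('a, 'm) ring_scheme \<Rightarrow> 'a set \<Rightarrow> ('a, 'b, 'k) module_scheme \<Rightarrow> (nat \<Rightarrow> 'a) \<Rightarrow> (nat \<Rightarrow> nat)
     \<Rightarrow> nat \<Rightarrow> nat \<Rightarrow> nat \<Rightarrow> ('a, 'b cochain set) module" where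
  "cech_sub_cohomology A \<qq> M a c t n i =
     cohomology (cech_sub_term A \<qq> M a c t n) (cech_diff A M a t) i"

end

theory Submission
  imports Defs "HOL-Algebra.Subrings"
begin

text \<open>
Write \<open>I\<close> for the ideal \<open>\<qq>\<close> and \<open>|c|\<close> for the sum of all \<open>c\<^sub>i\<close>. Everything follows from the identity

  \<open>I\<^sup>n M = \<Sum>\<^sub>i a\<^sub>i I\<^bsup>n - c\<^sub>i\<^esup> M\<close>  for all \<open>n \<ge> n\<^sub>1\<close>.

\<^bold>\<open>From the identity to the vanishing.\<close> Iterating it, with care for the degrees, gives
\<open>I\<^bsup>n + k|c|\<^esup> M = \<Sum>\<^sub>i a\<^sub>i\<^sup>k I\<^bsup>n + k(|c| - c\<^sub>i)\<^esup> M\<close> for all \<open>n \<ge> n\<^sub>1\<close> and all \<open>k\<close> (lemma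
\<open>power_expansion\<close>). In degree \<open>n\<close> the last term of either Cech complex consists of the fractions
\<open>m / (a\<^sub>1 \<cdots> a\<^sub>t)\<^sup>k\<close> with \<open>m \<in> I\<^bsup>n + k|c|\<^esup> M\<close>; for the subcomplex built from \<open>M[I\<^sup>e/x]\<close> this is
lemma \<open>blowup_eq_loc_part\<close>, and for the Rees module it holds by the definition of the grading. So
each such fraction is a sum of fractions in which \<open>a\<^sub>i\<^sup>k\<close> can be cancelled, that is, a sum of
elements coming from the preceding term, and still in degree \<open>n\<close> (lemma
\<open>top_cochain_coboundary\<close>). The locale \<open>cech_setting\<close> treats both complexes at once.

\<^bold>\<open>The identity.\<close> As \<open>M/(a\<^sub>1, \<dots>, a\<^sub>t)M\<close> has finite length, Nakayama's lemma shows that it is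
annihilated by a power of \<open>I\<close>. Hence \<open>I\<^sup>n M\<close> is contained in \<open>(a\<^sub>1, \<dots>, a\<^sub>t)M\<close> for large \<open>n\<close>, and it
remains to compute its intersection with that submodule. By induction on the number of elements,
passing to \<open>M/(a\<^sub>1, \<dots>, a\<^sub>i)M\<close>, this reduces to a single element \<open>a \<in> I\<^sup>c\<close> on a module \<open>N\<close>: one needs
\<open>a N \<inter> I\<^sup>n N = a I\<^bsup>n - c\<^esup> N\<close> for large \<open>n\<close>. By the Artin-Rees lemma this holds if the form of \<open>a\<close>
acts injectively on the form module of \<open>N\<close> in large degrees (lemma \<open>multiple_in_power\<close>).

\<^bold>\<open>Injectivity in large degrees.\<close> The kernel of the form of \<open>a\<close> is generated in finitely many
degrees, again by Artin-Rees. So it vanishes in large degrees if each of its elements is killed by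
a power of the irrelevant ideal (lemma \<open>form_kernel_vanishes\<close>). Otherwise choose a homogeneous
element of the kernel that is not, with maximal annihilator. This annihilator is an associated
prime that contains the form of \<open>a\<close> but not the irrelevant ideal (lemmas
\<open>prime_form_annihilator\<close> and \<open>Ass_condition_kernel_empty\<close>), contrary to the hypothesis.

\<^bold>\<open>Finiteness.\<close> The Artin-Rees lemma and the existence of maximal annihilators come from one graded
form of Hilbert's basis theorem. It is stated for families \<open>K n \<subseteq> I\<^sup>n N\<close> of submodules of a fixed
module, so that no polynomial ring in several variables is needed.
\<close>

section \<open>Submodules and ideals acting on modules\<close>

context module
begin

lemma submodule_carrier: "submodule N R M \<Longrightarrow> x \<in> N \<Longrightarrow> x \<in> carrier M"
  using submoduleE(1) by blast

lemma submodule_zero: "submodule N R M \<Longrightarrow> \<zero>\<^bsub>M\<^esub> \<in> N"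
  using submodule.axioms(1) subgroup.one_closed by fastforce

lemma submodule_add: "submodule N R M \<Longrightarrow> x \<in> N \<Longrightarrow> y \<in> N \<Longrightarrow> x \<oplus>\<^bsub>M\<^esub> y \<in> N"
  using submoduleE(5) by blast

lemma submodule_minus: "submodule N R M \<Longrightarrow> x \<in> N \<Longrightarrow> y \<in> N \<Longrightarrow> x \<ominus>\<^bsub>M\<^esub> y \<in> N"
  by (simp add: a_minus_def submoduleE)

lemma submodule_smult: "submodule N R M \<Longrightarrow> r \<in> carrier R \<Longrightarrow> x \<in> N \<Longrightarrow> r \<odot>\<^bsub>M\<^esub> x \<in> N"
  using submoduleE(4) by blast

lemma submodule_finsum:
  assumes "submodule N R M" "\<And>i. i \<in> I \<Longrightarrow> f i \<in> N"
  shows "(\<Oplus>\<^bsub>M\<^esub>i\<in>I. f i) \<in> N"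
proof (cases "finite I")
  case True
  then show ?thesis
    using assms(2)
  proof (induct I rule: finite_induct)
    case empty
    then show ?case using submodule_zero[OF assms(1)] by simp
  next
    case (insert i I)
    have "f \<in> I \<rightarrow> carrier M" "f i \<in> carrier M"
      using insert.prems submodule_carrier[OF assms(1)] by auto
    then show ?case
      using insert submodule_add[OF assms(1)] by simp
  qed
next
  case False
  then show ?thesis
    using submodule_zero[OF assms(1)] by (simp add: finsum_infinite)
qed

lemma submodule_Int:
  assumes "submodule N R M" "submodule N' R M"
  shows "submodule (N \<inter> N') R M"
  by (rule submoduleI) (use assms submoduleE in \<open>auto simp: submodule_zero\<close>)

lemma zero_submodule: "submodule {\<zero>\<^bsub>M\<^esub>} R M"
  by (rule submoduleI) auto

lemma submodule_span:
  assumes "S \<subseteq> carrier M"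
  shows "submodule (module_span R M S) R M"
proof (rule submoduleI)
  show "module_span R M S \<subseteq> carrier M"
    using assms carrier_is_submodule by (auto simp: module_span_def)
qed (auto simp: module_span_def submodule_zero submoduleE)

lemma span_superset: "S \<subseteq> module_span R M S"
  by (auto simp: module_span_def)

lemma span_least: "submodule N R M \<Longrightarrow> S \<subseteq> N \<Longrightarrow> module_span R M S \<subseteq> N"
  by (auto simp: module_span_def)

lemma ideal_smult_submodule:
  assumes "I \<subseteq> carrier R" "N \<subseteq> carrier M"
  shows "submodule (ideal_smult R I M N) R M"
  unfolding ideal_smult_def by (rule submodule_span) (use assms in auto)

lemma ideal_smult_mem: "r \<in> I \<Longrightarrow> x \<in> N \<Longrightarrow> r \<odot>\<^bsub>M\<^esub> x \<in> ideal_smult R I M N"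
  unfolding ideal_smult_def by (rule subsetD[OF span_superset]) auto

lemma ideal_smult_least:
  assumes "submodule W R M" "\<And>r x. r \<in> I \<Longrightarrow> x \<in> N \<Longrightarrow> r \<odot>\<^bsub>M\<^esub> x \<in> W"
  shows "ideal_smult R I M N \<subseteq> W"
  unfolding ideal_smult_def by (rule span_least) (use assms in auto)

lemma smult_minus: 
  "r \<in> carrier R \<Longrightarrow> x \<in> carrier M \<Longrightarrow> y \<in> carrier M \<Longrightarrow>
    r \<odot>\<^bsub>M\<^esub> (x \<ominus>\<^bsub>M\<^esub> y) = r \<odot>\<^bsub>M\<^esub> x \<ominus>\<^bsub>M\<^esub> r \<odot>\<^bsub>M\<^esub> y"
  by (simp add: a_minus_def smult_r_distr smult_r_minus)

lemma submodule_colon: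
  assumes "submodule W R M" "submodule N R M" "r \<in> carrier R"
  shows "submodule {x \<in> N. r \<odot>\<^bsub>M\<^esub> x \<in> W} R M"
proof (rule submoduleI)
  fix s x assume s: "s \<in> carrier R" and x: "x \<in> {x \<in> N. r \<odot>\<^bsub>M\<^esub> x \<in> W}"
  have "r \<odot>\<^bsub>M\<^esub> (s \<odot>\<^bsub>M\<^esub> x) = s \<odot>\<^bsub>M\<^esub> (r \<odot>\<^bsub>M\<^esub> x)"
    using s x assms submodule_carrier by (simp add: R.m_comm flip: smult_assoc1)
  then show "s \<odot>\<^bsub>M\<^esub> x \<in> {x \<in> N. r \<odot>\<^bsub>M\<^esub> x \<in> W}"
    using s x assms submodule_smult by auto
qed (use assms submoduleE in \<open>auto simp: submodule_zero smult_r_distr smult_r_minus subset_iff\<close>)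

lemma submodule_image_smult:
  assumes "submodule N R M" "r \<in> carrier R"
  shows "submodule ((\<lambda>x. r \<odot>\<^bsub>M\<^esub> x) ` N) R M"
proof (rule submoduleI)
  fix s x assume s: "s \<in> carrier R" and "x \<in> (\<lambda>x. r \<odot>\<^bsub>M\<^esub> x) ` N"
  then obtain y where y: "y \<in> N" "x = r \<odot>\<^bsub>M\<^esub> y" by auto
  have "s \<odot>\<^bsub>M\<^esub> x = r \<odot>\<^bsub>M\<^esub> (s \<odot>\<^bsub>M\<^esub> y)"
    using s y assms submodule_carrier by (simp add: R.m_comm flip: smult_assoc1)
  then show "s \<odot>\<^bsub>M\<^esub> x \<in> (\<lambda>x. r \<odot>\<^bsub>M\<^esub> x) ` N"
    using s y assms submodule_smult by auto
next
  show "\<zero>\<^bsub>M\<^esub> \<in> (\<lambda>x. r \<odot>\<^bsub>M\<^esub> x) ` N"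
    using assms submodule_zero[OF assms(1)] by (metis image_iff smult_r_null)
next
  fix x assume "x \<in> (\<lambda>x. r \<odot>\<^bsub>M\<^esub> x) ` N"
  then show "\<ominus>\<^bsub>M\<^esub> x \<in> (\<lambda>x. r \<odot>\<^bsub>M\<^esub> x) ` N"
    using assms submoduleE[OF assms(1)] by (auto simp: image_iff subset_iff simp flip: smult_r_minus)
next
  fix x y assume "x \<in> (\<lambda>x. r \<odot>\<^bsub>M\<^esub> x) ` N" "y \<in> (\<lambda>x. r \<odot>\<^bsub>M\<^esub> x) ` N"
  then obtain x' y' where "x' \<in> N" "x = r \<odot>\<^bsub>M\<^esub> x'" "y' \<in> N" "y = r \<odot>\<^bsub>M\<^esub> y'" by auto
  then have "x \<oplus>\<^bsub>M\<^esub> y = r \<odot>\<^bsub>M\<^esub> (x' \<oplus>\<^bsub>M\<^esub> y')" "x' \<oplus>\<^bsub>M\<^esub> y' \<in> N"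
    using assms submodule_carrier submodule_add by (auto simp: smult_r_distr)
  then show "x \<oplus>\<^bsub>M\<^esub> y \<in> (\<lambda>x. r \<odot>\<^bsub>M\<^esub> x) ` N" by blast
qed (use assms submoduleE in auto)

lemma submodule_sum:
  assumes N: "submodule N R M" and N': "submodule N' R M"
  shows "submodule {x \<oplus>\<^bsub>M\<^esub> y | x y. x \<in> N \<and> y \<in> N'} R M"
proof (rule submoduleI)
  note sub = submodule_carrier[OF N] submodule_carrier[OF N']
  show "{x \<oplus>\<^bsub>M\<^esub> y | x y. x \<in> N \<and> y \<in> N'} \<subseteq> carrier M"
    using sub by auto
  have "\<zero>\<^bsub>M\<^esub> = \<zero>\<^bsub>M\<^esub> \<oplus>\<^bsub>M\<^esub> \<zero>\<^bsub>M\<^esub>" by simp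
  then show "\<zero>\<^bsub>M\<^esub> \<in> {x \<oplus>\<^bsub>M\<^esub> y | x y. x \<in> N \<and> y \<in> N'}"
    using submodule_zero[OF N] submodule_zero[OF N'] by blast
  fix u assume u: "u \<in> {x \<oplus>\<^bsub>M\<^esub> y | x y. x \<in> N \<and> y \<in> N'}"
  then obtain x y where xy: "x \<in> N" "y \<in> N'" "u = x \<oplus>\<^bsub>M\<^esub> y" by auto
  then have "\<ominus>\<^bsub>M\<^esub> u = \<ominus>\<^bsub>M\<^esub> x \<oplus>\<^bsub>M\<^esub> \<ominus>\<^bsub>M\<^esub> y"
    using sub by (simp add: M.minus_add)
  then show "\<ominus>\<^bsub>M\<^esub> u \<in> {x \<oplus>\<^bsub>M\<^esub> y | x y. x \<in> N \<and> y \<in> N'}"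
    using xy submoduleE(3)[OF N] submoduleE(3)[OF N'] by blast
  {
    fix v assume "v \<in> {x \<oplus>\<^bsub>M\<^esub> y | x y. x \<in> N \<and> y \<in> N'}"
    then obtain x' y' where xy': "x' \<in> N" "y' \<in> N'" "v = x' \<oplus>\<^bsub>M\<^esub> y'" by auto
    have "u \<oplus>\<^bsub>M\<^esub> v = (x \<oplus>\<^bsub>M\<^esub> x') \<oplus>\<^bsub>M\<^esub> (y \<oplus>\<^bsub>M\<^esub> y')"
      using xy xy' sub by (simp add: M.a_ac)
    then show "u \<oplus>\<^bsub>M\<^esub> v \<in> {x \<oplus>\<^bsub>M\<^esub> y | x y. x \<in> N \<and> y \<in> N'}"
      using xy xy' submodule_add[OF N] submodule_add[OF N'] by blast
  }
  fix r assume r: "r \<in> carrier R"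
  then have "r \<odot>\<^bsub>M\<^esub> u = r \<odot>\<^bsub>M\<^esub> x \<oplus>\<^bsub>M\<^esub> r \<odot>\<^bsub>M\<^esub> y"
    using xy sub by (simp add: smult_r_distr)
  then show "r \<odot>\<^bsub>M\<^esub> u \<in> {x \<oplus>\<^bsub>M\<^esub> y | x y. x \<in> N \<and> y \<in> N'}"
    using xy r submodule_smult[OF N] submodule_smult[OF N'] by blast
qed

text \<open>This extends a membership \<open>r x \<in> W\<close> from generators \<open>r\<close> of an ideal to the whole ideal.\<close>

lemma ideal_transporter:
  assumes W: "submodule W R M" and S: "S \<subseteq> carrier M"
  shows "ideal {r \<in> carrier R. \<forall>x\<in>S. r \<odot>\<^bsub>M\<^esub> x \<in> W} R"
proof (rule idealI)
  show "ring R" by (rule R.ring_axioms)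
  show "subgroup {r \<in> carrier R. \<forall>x\<in>S. r \<odot>\<^bsub>M\<^esub> x \<in> W} (add_monoid R)"
    using S submodule_zero[OF W] submoduleE[OF W]
    by (intro R.add.subgroupI) (auto simp: subset_iff smult_l_distr smult_l_minus simp flip: a_inv_def)
  fix r s assume "r \<in> {r \<in> carrier R. \<forall>x\<in>S. r \<odot>\<^bsub>M\<^esub> x \<in> W}" "s \<in> carrier R"
  moreover from this have "s \<otimes> r \<odot>\<^bsub>M\<^esub> x \<in> W" if "x \<in> S" for x
    using that S submodule_smult[OF W] by (auto simp: smult_assoc1 subset_iff)
  ultimately show "s \<otimes> r \<in> {r \<in> carrier R. \<forall>x\<in>S. r \<odot>\<^bsub>M\<^esub> x \<in> W}"
    and "r \<otimes> s \<in> {r \<in> carrier R. \<forall>x\<in>S. r \<odot>\<^bsub>M\<^esub> x \<in> W}"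
    by (auto simp: R.m_comm)
qed

lemma submodule_image_ideal:
  assumes J: "ideal J R" and y: "y \<in> carrier M"
  shows "submodule ((\<lambda>r. r \<odot>\<^bsub>M\<^esub> y) ` J) R M"
proof (rule submoduleI)
  note Jcarr = ideal.Icarr[OF J]
  show "(\<lambda>r. r \<odot>\<^bsub>M\<^esub> y) ` J \<subseteq> carrier M" using y Jcarr by auto
  show "\<zero>\<^bsub>M\<^esub> \<in> (\<lambda>r. r \<odot>\<^bsub>M\<^esub> y) ` J"
    by (rule image_eqI[of _ _ \<zero>]) (use y additive_subgroup.zero_closed[OF ideal.axioms(1)[OF J]] in auto)
  fix u assume "u \<in> (\<lambda>r. r \<odot>\<^bsub>M\<^esub> y) ` J"
  then obtain r where r: "r \<in> J" "u = r \<odot>\<^bsub>M\<^esub> y" by auto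
  show "\<ominus>\<^bsub>M\<^esub> u \<in> (\<lambda>r. r \<odot>\<^bsub>M\<^esub> y) ` J"
    by (rule image_eqI[of _ _ "\<ominus> r"])
      (use y r Jcarr additive_subgroup.a_inv_closed[OF ideal.axioms(1)[OF J]] in \<open>auto simp: smult_l_minus\<close>)
  show "s \<odot>\<^bsub>M\<^esub> u \<in> (\<lambda>r. r \<odot>\<^bsub>M\<^esub> y) ` J" if "s \<in> carrier R" for s
    by (rule image_eqI[of _ _ "s \<otimes> r"]) (use y r that Jcarr ideal.I_l_closed[OF J] in \<open>auto simp: smult_assoc1\<close>)
  fix v assume "v \<in> (\<lambda>r. r \<odot>\<^bsub>M\<^esub> y) ` J"
  then obtain s where s: "s \<in> J" "v = s \<odot>\<^bsub>M\<^esub> y" by auto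
  show "u \<oplus>\<^bsub>M\<^esub> v \<in> (\<lambda>r. r \<odot>\<^bsub>M\<^esub> y) ` J"
    by (rule image_eqI[of _ _ "r \<oplus> s"])
      (use y r s Jcarr additive_subgroup.a_closed[OF ideal.axioms(1)[OF J]] in \<open>auto simp: smult_l_distr\<close>)
qed

end

section \<open>Powers of an ideal\<close>

context cring
begin

lemma one_ideals_set [simp]: "\<one>\<^bsub>ideals_set R\<^esub> = carrier R"
  by (simp add: ideals_set_def)

lemma ideal_pow_0: "ideal_pow R I 0 = carrier R"
  by (simp add: ideals_set_def nat_pow_def)

lemma ideal_pow_Suc: "ideal_pow R I (Suc n) = ideal_prod R (ideal_pow R I n) I"
  by (simp add: ideals_set_def nat_pow_def)

context
  fixes I assumes I: "ideal I R"
begin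

lemma ideal_pow_ideal: "ideal (ideal_pow R I n) R"
  by (induct n) (simp_all only: ideal_pow_0 ideal_pow_Suc oneideal ideal_prod_is_ideal I)

lemma ideal_pow_carrier: "x \<in> ideal_pow R I n \<Longrightarrow> x \<in> carrier R"
  using ideal_pow_ideal ideal.Icarr by metis

lemma ideal_pow_1: "ideal_pow R I (Suc 0) = I"
  using ideal_prod_one[OF I] ideal_prod_commute[OF I oneideal]
  by (simp only: ideal_pow_Suc ideal_pow_0)

lemma ideal_pow_add: "ideal_pow R I (m + n) = ideal_prod R (ideal_pow R I m) (ideal_pow R I n)"
proof (induct n)
  case 0
  then show ?case using ideal_prod_one[OF ideal_pow_ideal] by (simp only: add_0_right ideal_pow_0)
next
  case (Suc n)
  then show ?case
    using ideal_prod_assoc[OF ideal_pow_ideal ideal_pow_ideal I]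
    by (simp only: add_Suc_right ideal_pow_Suc)
qed

lemma ideal_pow_mult:
  "x \<in> ideal_pow R I m \<Longrightarrow> y \<in> ideal_pow R I n \<Longrightarrow> x \<otimes> y \<in> ideal_pow R I (m + n)"
  unfolding ideal_pow_add by (rule ideal_prod.prod)

lemma ideal_pow_antimono:
  assumes "m \<le> n" shows "ideal_pow R I n \<subseteq> ideal_pow R I m"
proof -
  obtain k where "n = m + k" using assms le_Suc_ex by blast
  then show ?thesis
    using ideal_prod_inter[OF ideal_pow_ideal ideal_pow_ideal, of m k] ideal_pow_add by auto
qed

lemma ideal_pow_nat_pow: "x \<in> ideal_pow R I m \<Longrightarrow> x [^] k \<in> ideal_pow R I (k * m)"
proof (induct k)
  case 0
  then show ?case by (simp add: ideal_pow_0)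
next
  case (Suc k)
  then show ?case using ideal_pow_mult[of "x [^] k" "k * m" x m] by (simp add: add.commute)
qed

lemma ideal_pow_finprod:
  assumes "finite J" "\<And>j. j \<in> J \<Longrightarrow> x j \<in> ideal_pow R I (e j)"
  shows "(\<Otimes>j\<in>J. x j) \<in> ideal_pow R I (\<Sum>j\<in>J. e j)"
  using assms
proof (induct J rule: finite_induct)
  case empty
  then show ?case by (simp add: ideal_pow_0)
next
  case (insert j J)
  have "x \<in> J \<rightarrow> carrier R" "x j \<in> carrier R"
    using insert.prems ideal_pow_carrier by blast+
  then show ?case
    using insert ideal_pow_mult[of "x j" "e j" "finprod R x J" "sum e J"] by simp
qed

end

end

lemma ideal_prod_subset:
  assumes "ideal K R" "\<And>x y. x \<in> I \<Longrightarrow> y \<in> J \<Longrightarrow> x \<otimes>\<^bsub>R\<^esub> y \<in> K"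
  shows "ideal_prod R I J \<subseteq> K"
proof
  fix z assume "z \<in> ideal_prod R I J"
  then show "z \<in> K"
    by induct (use assms additive_subgroup.a_closed ideal.axioms(1) in fast)+
qed

context module
begin

lemma ideal_pow_module_submodule:
  assumes "ideal I R"
  shows "submodule (ideal_pow_module R I M n) R M"
  unfolding ideal_pow_module_def
  by (rule ideal_smult_submodule) (use R.ideal_pow_carrier[OF assms] in auto)

lemma ideal_smult_pow_mult:
  assumes I: "ideal I R" and N: "N \<subseteq> carrier M"
    and r: "r \<in> ideal_pow R I k" and x: "x \<in> ideal_smult R (ideal_pow R I n) M N"
  shows "r \<odot>\<^bsub>M\<^esub> x \<in> ideal_smult R (ideal_pow R I (k + n)) M N"
proof -
  note carr = R.ideal_pow_carrier[OF I]
  have sub: "submodule (ideal_smult R (ideal_pow R I m) M N) R M" for m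
    by (rule ideal_smult_submodule) (use carr N in auto)
  have "ideal_smult R (ideal_pow R I n) M N
      \<subseteq> {x \<in> carrier M. r \<odot>\<^bsub>M\<^esub> x \<in> ideal_smult R (ideal_pow R I (k + n)) M N}"
  proof (rule ideal_smult_least)
    show "submodule {x \<in> carrier M. r \<odot>\<^bsub>M\<^esub> x \<in> ideal_smult R (ideal_pow R I (k + n)) M N} R M"
      by (rule submodule_colon[OF sub carrier_is_submodule carr[OF r]])
    fix s y assume s: "s \<in> ideal_pow R I n" and y: "y \<in> N"
    have "r \<odot>\<^bsub>M\<^esub> (s \<odot>\<^bsub>M\<^esub> y) = r \<otimes> s \<odot>\<^bsub>M\<^esub> y"
      using carr r s y N by (simp add: smult_assoc1 subset_iff)
    also have "\<dots> \<in> ideal_smult R (ideal_pow R I (k + n)) M N"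
      by (intro ideal_smult_mem R.ideal_pow_mult[OF I] r s y)
    finally show "s \<odot>\<^bsub>M\<^esub> y \<in> {x \<in> carrier M. r \<odot>\<^bsub>M\<^esub> x \<in> ideal_smult R (ideal_pow R I (k + n)) M N}"
      using carr s y N by auto
  qed
  then show ?thesis using x by auto
qed

lemma ideal_pow_module_mult:
  assumes "ideal I R" "r \<in> ideal_pow R I k" "x \<in> ideal_pow_module R I M n"
  shows "r \<odot>\<^bsub>M\<^esub> x \<in> ideal_pow_module R I M (k + n)"
  using assms ideal_smult_pow_mult unfolding ideal_pow_module_def by blast

lemma ideal_pow_module_carrier:
  "ideal I R \<Longrightarrow> x \<in> ideal_pow_module R I M n \<Longrightarrow> x \<in> carrier M"
  using ideal_pow_module_submodule submodule_carrier by blast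

lemma ideal_pow_module_0:
  assumes "ideal I R"
  shows "ideal_pow_module R I M 0 = carrier M"
proof
  show "ideal_pow_module R I M 0 \<subseteq> carrier M"
    using ideal_pow_module_carrier[OF assms] by blast
  show "carrier M \<subseteq> ideal_pow_module R I M 0"
  proof
    fix x assume x: "x \<in> carrier M"
    then have "\<one> \<odot>\<^bsub>M\<^esub> x \<in> ideal_pow_module R I M 0"
      unfolding ideal_pow_module_def R.ideal_pow_0 by (intro ideal_smult_mem) auto
    then show "x \<in> ideal_pow_module R I M 0" using x by simp
  qed
qed

lemma ideal_pow_module_antimono:
  assumes I: "ideal I R" and "m \<le> n"
  shows "ideal_pow_module R I M n \<subseteq> ideal_pow_module R I M m"
  unfolding ideal_pow_module_def
  by (rule ideal_smult_least)
    (use R.ideal_pow_antimono[OF assms] R.ideal_pow_carrier[OF I]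
      in \<open>auto intro: ideal_smult_mem ideal_smult_submodule\<close>)

lemma ideal_pow_module_mult':
  assumes I: "ideal I R" and "r \<in> ideal_pow R I k" "x \<in> ideal_pow_module R I M n" "m \<le> k + n"
  shows "r \<odot>\<^bsub>M\<^esub> x \<in> ideal_pow_module R I M m"
  using ideal_pow_module_mult[OF assms(1-3)] ideal_pow_module_antimono[OF I assms(4)] by blast

text \<open>Iterated along a family \<open>K\<close> with \<open>I (K k) \<subseteq> K (k + 1)\<close>, this gives
  \<open>I\<^sup>n (K k) \<subseteq> K (n + k)\<close>.\<close>

lemma ideal_smult_pow_Suc:
  assumes I: "ideal I R" and N: "N \<subseteq> carrier M" and N': "N' \<subseteq> carrier M"
    and step: "\<And>r x. r \<in> I \<Longrightarrow> x \<in> N \<Longrightarrow> r \<odot>\<^bsub>M\<^esub> x \<in> N'"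
  shows "ideal_smult R (ideal_pow R I (Suc n)) M N \<subseteq> ideal_smult R (ideal_pow R I n) M N'"
proof (rule ideal_smult_least)
  note carr = R.ideal_pow_carrier[OF I]
  show sub: "submodule (ideal_smult R (ideal_pow R I n) M N') R M"
    by (rule ideal_smult_submodule) (use carr N' in auto)
  fix r x assume r: "r \<in> ideal_pow R I (Suc n)" and x: "x \<in> N"
  let ?T = "{r \<in> carrier R. \<forall>x\<in>N. r \<odot>\<^bsub>M\<^esub> x \<in> ideal_smult R (ideal_pow R I n) M N'}"
  have "ideal_pow R I (Suc n) \<subseteq> ?T"
    unfolding R.ideal_pow_Suc
  proof (rule ideal_prod_subset)
    show "ideal ?T R" by (rule ideal_transporter[OF sub N])
    fix s t assume st: "s \<in> ideal_pow R I n" "t \<in> I"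
    then have "s \<in> carrier R" "t \<in> carrier R" using carr ideal.Icarr[OF I] by auto
    then show "s \<otimes> t \<in> ?T"
      using st N step by (auto simp: smult_assoc1 subset_iff intro: ideal_smult_mem)
  qed
  then show "r \<odot>\<^bsub>M\<^esub> x \<in> ideal_smult R (ideal_pow R I n) M N'" using r x by auto
qed

end

section \<open>Quotient modules\<close>

lemma quot_module_sel:
  "carrier (quot_module M U) = a_rcosets\<^bsub>M\<^esub> U"
  "zero (quot_module M U) = U"
  "add (quot_module M U) = set_add M"
  "smult (quot_module M U) = (\<lambda>r C. \<Union>x\<in>C. U +>\<^bsub>M\<^esub> (r \<odot>\<^bsub>M\<^esub> x))"
  by (simp_all add: quot_module_def)

context module
begin

lemma submodule_abelian_subgroup:
  assumes "submodule U R M" shows "abelian_subgroup U M"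
  using M.abelian_group_axioms submodule.axioms(1)[OF assms]
  by (intro abelian_subgroupI3 additive_subgroup.intro)

lemma coset_iff:
  assumes "submodule U R M" "x \<in> carrier M"
  shows "y \<in> U +>\<^bsub>M\<^esub> x \<longleftrightarrow> y \<in> carrier M \<and> y \<ominus>\<^bsub>M\<^esub> x \<in> U"
proof
  assume "y \<in> U +>\<^bsub>M\<^esub> x"
  then obtain u where u: "u \<in> U" "y = u \<oplus>\<^bsub>M\<^esub> x" by (auto simp: a_r_coset_def')
  then have "u \<in> carrier M" using assms submodule_carrier by blast
  then show "y \<in> carrier M \<and> y \<ominus>\<^bsub>M\<^esub> x \<in> U"
    using u assms by (simp add: a_minus_def M.a_assoc M.r_neg)
next
  assume y: "y \<in> carrier M \<and> y \<ominus>\<^bsub>M\<^esub> x \<in> U"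
  then have "y = (y \<ominus>\<^bsub>M\<^esub> x) \<oplus>\<^bsub>M\<^esub> x"
    using assms by (simp add: a_minus_def M.a_assoc M.l_neg)
  then show "y \<in> U +>\<^bsub>M\<^esub> x" using y by (auto simp: a_r_coset_def')
qed

lemma coset_self: "submodule U R M \<Longrightarrow> x \<in> carrier M \<Longrightarrow> x \<in> U +>\<^bsub>M\<^esub> x"
  by (simp add: coset_iff submodule_zero a_minus_def M.r_neg)

lemma coset_eq_iff:
  assumes U: "submodule U R M" and x: "x \<in> carrier M" and y: "y \<in> carrier M"
  shows "U +>\<^bsub>M\<^esub> x = U +>\<^bsub>M\<^esub> y \<longleftrightarrow> x \<ominus>\<^bsub>M\<^esub> y \<in> U"
proof
  assume "U +>\<^bsub>M\<^esub> x = U +>\<^bsub>M\<^esub> y"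
  then show "x \<ominus>\<^bsub>M\<^esub> y \<in> U"
    using coset_self[OF U x] coset_iff[OF U y] by auto
next
  assume "x \<ominus>\<^bsub>M\<^esub> y \<in> U"
  then have "x \<in> U +>\<^bsub>M\<^esub> y" using coset_iff[OF U y] x by auto
  then show "U +>\<^bsub>M\<^esub> x = U +>\<^bsub>M\<^esub> y"
    using abelian_subgroup.a_repr_independence'[OF submodule_abelian_subgroup[OF U]] y by metis
qed

lemma minus_zero_right: "x \<in> carrier M \<Longrightarrow> x \<ominus>\<^bsub>M\<^esub> \<zero>\<^bsub>M\<^esub> = x"
  using M.minus_equality[of "\<zero>\<^bsub>M\<^esub>" "\<zero>\<^bsub>M\<^esub>"] by (simp add: a_minus_def)

lemma coset_eq_submodule_iff:
  assumes U: "submodule U R M" and x: "x \<in> carrier M"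
  shows "U +>\<^bsub>M\<^esub> x = U \<longleftrightarrow> x \<in> U"
proof -
  have "U +>\<^bsub>M\<^esub> \<zero>\<^bsub>M\<^esub> = U" using M.a_coset_add_zero submoduleE(1)[OF U] by blast
  then show ?thesis using coset_eq_iff[OF U x M.zero_closed] x by (simp add: minus_zero_right)
qed

lemma coset_add:
  assumes U: "submodule U R M" and x: "x \<in> carrier M" and y: "y \<in> carrier M"
  shows "(U +>\<^bsub>M\<^esub> x) <+>\<^bsub>M\<^esub> (U +>\<^bsub>M\<^esub> y) = U +>\<^bsub>M\<^esub> (x \<oplus>\<^bsub>M\<^esub> y)"
  using abelian_subgroup.a_rcos_sum[OF submodule_abelian_subgroup[OF U] x y] .

lemma add_minus_add_cancel:
  assumes "u \<in> carrier M" "y \<in> carrier M" "y' \<in> carrier M"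
  shows "(u \<oplus>\<^bsub>M\<^esub> y) \<ominus>\<^bsub>M\<^esub> (u \<oplus>\<^bsub>M\<^esub> y') = y \<ominus>\<^bsub>M\<^esub> y'"
proof -
  have "(u \<oplus>\<^bsub>M\<^esub> y) \<ominus>\<^bsub>M\<^esub> (u \<oplus>\<^bsub>M\<^esub> y') = (y \<oplus>\<^bsub>M\<^esub> u) \<oplus>\<^bsub>M\<^esub> (\<ominus>\<^bsub>M\<^esub> u \<oplus>\<^bsub>M\<^esub> \<ominus>\<^bsub>M\<^esub> y')"
    using assms M.a_comm[of u y] by (simp add: a_minus_def M.minus_add)
  also have "\<dots> = y \<ominus>\<^bsub>M\<^esub> y'"
    using assms by (simp add: a_minus_def M.a_assoc M.r_neg2)
  finally show ?thesis .
qed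

lemma minus_add_cancel: "x \<in> carrier M \<Longrightarrow> z \<in> carrier M \<Longrightarrow> (x \<ominus>\<^bsub>M\<^esub> z) \<oplus>\<^bsub>M\<^esub> z = x"
  by (simp add: a_minus_def M.a_assoc M.l_neg)

text \<open>The scalar multiplication of a quotient module is a union over representatives; it is
  evaluated at one of them.\<close>

lemma union_cosets_eq:
  assumes U: "submodule U R M" and ij: "i \<in> I" and m: "\<And>i. i \<in> I \<Longrightarrow> h i \<in> carrier M"
    and eq: "\<And>i'. i' \<in> I \<Longrightarrow> h i' \<ominus>\<^bsub>M\<^esub> h i \<in> U"
  shows "(\<Union>i\<in>I. U +>\<^bsub>M\<^esub> h i) = U +>\<^bsub>M\<^esub> h i"
  using assms coset_eq_iff[OF U] by blast

lemma coset_smult: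
  assumes U: "submodule U R M" and r: "r \<in> carrier R" and x: "x \<in> carrier M"
  shows "r \<odot>\<^bsub>quot_module M U\<^esub> (U +>\<^bsub>M\<^esub> x) = U +>\<^bsub>M\<^esub> (r \<odot>\<^bsub>M\<^esub> x)"
  unfolding quot_module_sel
proof (rule union_cosets_eq[OF U])
  fix y assume "y \<in> U +>\<^bsub>M\<^esub> x"
  then have y: "y \<in> carrier M" "y \<ominus>\<^bsub>M\<^esub> x \<in> U" using coset_iff[OF U x] by auto
  then show "r \<odot>\<^bsub>M\<^esub> y \<ominus>\<^bsub>M\<^esub> r \<odot>\<^bsub>M\<^esub> x \<in> U"
    using r x submodule_smult[OF U r y(2)] by (simp add: smult_minus)
  show "r \<odot>\<^bsub>M\<^esub> y \<in> carrier M" using y r by simp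
qed (use coset_self[OF U x] r in auto)

lemma quot_carrier:
  "carrier (quot_module M U) = (\<lambda>x. U +>\<^bsub>M\<^esub> x) ` carrier M"
  by (auto simp: quot_module_sel A_RCOSETS_def')

lemma coset_in_quot [intro]: "x \<in> carrier M \<Longrightarrow> U +>\<^bsub>M\<^esub> x \<in> carrier (quot_module M U)"
  by (simp add: quot_carrier)

lemma quot_carrierE:
  assumes "X \<in> carrier (quot_module M U)"
  obtains x where "x \<in> carrier M" "X = U +>\<^bsub>M\<^esub> x"
  using assms by (auto simp: quot_carrier)

lemma quot_coset_add:
  assumes "submodule U R M" "x \<in> carrier M" "y \<in> carrier M"
  shows "(U +>\<^bsub>M\<^esub> x) \<oplus>\<^bsub>quot_module M U\<^esub> (U +>\<^bsub>M\<^esub> y) = U +>\<^bsub>M\<^esub> (x \<oplus>\<^bsub>M\<^esub> y)"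
  using coset_add[OF assms] by (simp add: quot_module_sel)

lemma quot_zero:
  assumes "submodule U R M"
  shows "\<zero>\<^bsub>quot_module M U\<^esub> = U +>\<^bsub>M\<^esub> \<zero>\<^bsub>M\<^esub>"
  using coset_eq_submodule_iff[OF assms M.zero_closed] submodule_zero[OF assms]
  by (simp add: quot_module_sel)

lemma quot_is_module:
  assumes U: "submodule U R M"
  shows "module R (quot_module M U)"
proof (rule moduleI)
  show "cring R" by (rule R.cring_axioms)
  note Uadd = quot_coset_add[OF U] and Usmult = coset_smult[OF U]
  show "abelian_group (quot_module M U)"
  proof (rule abelian_groupI)
    fix X Y Z assume "X \<in> carrier (quot_module M U)" "Y \<in> carrier (quot_module M U)"
      "Z \<in> carrier (quot_module M U)"
    then obtain x y z where xyz: "x \<in> carrier M" "y \<in> carrier M" "z \<in> carrier M"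
      and XYZ: "X = U +>\<^bsub>M\<^esub> x" "Y = U +>\<^bsub>M\<^esub> y" "Z = U +>\<^bsub>M\<^esub> z"
      by (meson quot_carrierE)
    show "X \<oplus>\<^bsub>quot_module M U\<^esub> Y \<in> carrier (quot_module M U)"
      unfolding XYZ Uadd[OF xyz(1,2)] by (rule coset_in_quot) (simp add: xyz)
    show "X \<oplus>\<^bsub>quot_module M U\<^esub> Y \<oplus>\<^bsub>quot_module M U\<^esub> Z = X \<oplus>\<^bsub>quot_module M U\<^esub> (Y \<oplus>\<^bsub>quot_module M U\<^esub> Z)"
      unfolding XYZ by (simp add: Uadd xyz M.a_assoc)
    show "X \<oplus>\<^bsub>quot_module M U\<^esub> Y = Y \<oplus>\<^bsub>quot_module M U\<^esub> X"
      unfolding XYZ by (simp add: Uadd xyz M.a_comm)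
    show "\<zero>\<^bsub>quot_module M U\<^esub> \<oplus>\<^bsub>quot_module M U\<^esub> X = X"
      unfolding XYZ quot_zero[OF U] by (simp add: Uadd xyz)
    have "(U +>\<^bsub>M\<^esub> (\<ominus>\<^bsub>M\<^esub> x)) \<oplus>\<^bsub>quot_module M U\<^esub> X = \<zero>\<^bsub>quot_module M U\<^esub>"
      unfolding XYZ quot_zero[OF U] by (simp add: Uadd xyz M.l_neg)
    then show "\<exists>Y\<in>carrier (quot_module M U). Y \<oplus>\<^bsub>quot_module M U\<^esub> X = \<zero>\<^bsub>quot_module M U\<^esub>"
      using xyz by (meson coset_in_quot M.a_inv_closed)
  next
    show "\<zero>\<^bsub>quot_module M U\<^esub> \<in> carrier (quot_module M U)"
      unfolding quot_zero[OF U] by (rule coset_in_quot) simp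
  qed
qed (elim quot_carrierE;
    simp add: quot_coset_add[OF U] coset_smult[OF U] smult_l_distr smult_r_distr smult_assoc1 coset_in_quot)+

lemma quot_uminus:
  assumes U: "submodule U R M" and y: "y \<in> carrier M"
  shows "\<ominus>\<^bsub>quot_module M U\<^esub> (U +>\<^bsub>M\<^esub> y) = U +>\<^bsub>M\<^esub> (\<ominus>\<^bsub>M\<^esub> y)"
proof -
  interpret Q: module R "quot_module M U" by (rule quot_is_module[OF U])
  have "(U +>\<^bsub>M\<^esub> (\<ominus>\<^bsub>M\<^esub> y)) \<oplus>\<^bsub>quot_module M U\<^esub> (U +>\<^bsub>M\<^esub> y) = \<zero>\<^bsub>quot_module M U\<^esub>"
    using y by (simp add: quot_coset_add[OF U] M.l_neg quot_zero[OF U])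
  then show ?thesis using y by (intro Q.minus_equality) auto
qed

lemma quot_image_submodule:
  assumes U: "submodule U R M" and N: "submodule N R M"
  shows "submodule ((\<lambda>x. U +>\<^bsub>M\<^esub> x) ` N) R (quot_module M U)"
proof -
  interpret Q: module R "quot_module M U" by (rule quot_is_module[OF U])
  note carr = submodule_carrier[OF N]
  show ?thesis
  proof (rule Q.submoduleI)
    fix X assume "X \<in> (\<lambda>x. U +>\<^bsub>M\<^esub> x) ` N"
    then obtain x where x: "x \<in> N" "X = U +>\<^bsub>M\<^esub> x" by auto
    then show "\<ominus>\<^bsub>quot_module M U\<^esub> X \<in> (\<lambda>x. U +>\<^bsub>M\<^esub> x) ` N"
      using carr submoduleE(3)[OF N] by (simp add: quot_uminus[OF U])
  next
    fix X Y assume "X \<in> (\<lambda>x. U +>\<^bsub>M\<^esub> x) ` N" "Y \<in> (\<lambda>x. U +>\<^bsub>M\<^esub> x) ` N"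
    then show "X \<oplus>\<^bsub>quot_module M U\<^esub> Y \<in> (\<lambda>x. U +>\<^bsub>M\<^esub> x) ` N"
      using carr submodule_add[OF N] quot_coset_add[OF U] by auto
  next
    fix r X assume "r \<in> carrier R" "X \<in> (\<lambda>x. U +>\<^bsub>M\<^esub> x) ` N"
    then show "r \<odot>\<^bsub>quot_module M U\<^esub> X \<in> (\<lambda>x. U +>\<^bsub>M\<^esub> x) ` N"
      using carr submodule_smult[OF N] coset_smult[OF U] by auto
  qed (use carr submodule_zero[OF N] quot_zero[OF U] in auto)
qed

lemma quot_vimage_submodule:
  assumes U: "submodule U R M" and W: "submodule W R (quot_module M U)"
  shows "submodule {x \<in> carrier M. U +>\<^bsub>M\<^esub> x \<in> W} R M"
proof -
  interpret Q: module R "quot_module M U" by (rule quot_is_module[OF U])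
  show ?thesis
  proof (rule submoduleI)
    fix x assume x: "x \<in> {x \<in> carrier M. U +>\<^bsub>M\<^esub> x \<in> W}"
    then show "\<ominus>\<^bsub>M\<^esub> x \<in> {x \<in> carrier M. U +>\<^bsub>M\<^esub> x \<in> W}"
      using Q.submoduleE(3)[OF W] by (simp add: quot_uminus[OF U, symmetric])
  next
    fix x y assume "x \<in> {x \<in> carrier M. U +>\<^bsub>M\<^esub> x \<in> W}" "y \<in> {x \<in> carrier M. U +>\<^bsub>M\<^esub> x \<in> W}"
    then show "x \<oplus>\<^bsub>M\<^esub> y \<in> {x \<in> carrier M. U +>\<^bsub>M\<^esub> x \<in> W}"
      using Q.submodule_add[OF W] quot_coset_add[OF U] by fastforce
  next
    fix r x assume "r \<in> carrier R" "x \<in> {x \<in> carrier M. U +>\<^bsub>M\<^esub> x \<in> W}"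
    then show "r \<odot>\<^bsub>M\<^esub> x \<in> {x \<in> carrier M. U +>\<^bsub>M\<^esub> x \<in> W}"
      using Q.submodule_smult[OF W] coset_smult[OF U] by fastforce
  qed (use Q.submodule_zero[OF W] quot_zero[OF U] in auto)
qed

lemma quot_ideal_smult:
  assumes U: "submodule U R M" and I: "I \<subseteq> carrier R"
  shows "ideal_smult R I (quot_module M U) (carrier (quot_module M U))
       = (\<lambda>x. U +>\<^bsub>M\<^esub> x) ` ideal_smult R I M (carrier M)"
proof
  interpret Q: module R "quot_module M U" by (rule quot_is_module[OF U])
  have sub: "submodule (ideal_smult R I M (carrier M)) R M"
    and subQ: "submodule (ideal_smult R I (quot_module M U) (carrier (quot_module M U))) R (quot_module M U)"
    using I by (auto intro!: ideal_smult_submodule Q.ideal_smult_submodule)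
  show "ideal_smult R I (quot_module M U) (carrier (quot_module M U))
      \<subseteq> (\<lambda>x. U +>\<^bsub>M\<^esub> x) ` ideal_smult R I M (carrier M)"
  proof (rule Q.ideal_smult_least[OF quot_image_submodule[OF U sub]])
    fix r X assume r: "r \<in> I" and "X \<in> carrier (quot_module M U)"
    then obtain x where x: "x \<in> carrier M" "X = U +>\<^bsub>M\<^esub> x" by (elim quot_carrierE)
    then have "r \<odot>\<^bsub>quot_module M U\<^esub> X = U +>\<^bsub>M\<^esub> (r \<odot>\<^bsub>M\<^esub> x)"
      using r I coset_smult[OF U] by blast
    then show "r \<odot>\<^bsub>quot_module M U\<^esub> X \<in> (\<lambda>x. U +>\<^bsub>M\<^esub> x) ` ideal_smult R I M (carrier M)"
      using ideal_smult_mem[OF r x(1)] by (rule image_eqI)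
  qed
  have "ideal_smult R I M (carrier M) \<subseteq>
      {x \<in> carrier M. U +>\<^bsub>M\<^esub> x \<in> ideal_smult R I (quot_module M U) (carrier (quot_module M U))}"
  proof (rule ideal_smult_least[OF quot_vimage_submodule[OF U subQ]])
    fix r x assume r: "r \<in> I" and x: "x \<in> carrier M"
    then have "r \<odot>\<^bsub>M\<^esub> x \<in> carrier M" using I by blast
    moreover have "U +>\<^bsub>M\<^esub> (r \<odot>\<^bsub>M\<^esub> x)
        \<in> ideal_smult R I (quot_module M U) (carrier (quot_module M U))"
      using Q.ideal_smult_mem[OF r coset_in_quot[OF x, of U]] coset_smult[OF U _ x] r I by auto
    ultimately show "r \<odot>\<^bsub>M\<^esub> x \<in> {x \<in> carrier M. U +>\<^bsub>M\<^esub> x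
        \<in> ideal_smult R I (quot_module M U) (carrier (quot_module M U))}" by simp
  qed
  then show "(\<lambda>x. U +>\<^bsub>M\<^esub> x) ` ideal_smult R I M (carrier M)
      \<subseteq> ideal_smult R I (quot_module M U) (carrier (quot_module M U))"
    by auto
qed

lemma quot_ideal_pow_module:
  assumes "submodule U R M" "ideal I R"
  shows "ideal_pow_module R I (quot_module M U) n = (\<lambda>x. U +>\<^bsub>M\<^esub> x) ` ideal_pow_module R I M n"
  unfolding ideal_pow_module_def
  by (rule quot_ideal_smult) (use assms R.ideal_pow_carrier in auto)

end

section \<open>Noetherian modules\<close>

definition noetherian_module :: "('a, 'm) ring_scheme \<Rightarrow> ('a, 'b, 'k) module_scheme \<Rightarrow> bool" where
  "noetherian_module R M \<longleftrightarrow>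
     (\<forall>W. (\<forall>k. submodule (W k) R M) \<and> (\<forall>k. W k \<subseteq> W (Suc k)) \<longrightarrow> (\<exists>k0. \<forall>k\<ge>k0. W k = W (k0::nat)))"

lemma noetherian_moduleD:
  assumes "noetherian_module R M" "\<And>k. submodule (W k) R M" "\<And>k. W k \<subseteq> W (Suc k)"
  shows "\<exists>k0::nat. \<forall>k\<ge>k0. W k = W k0"
  using assms unfolding noetherian_module_def by blast

text \<open>This replaces the usual argument that finitely many generators have a common exponent.\<close>

lemma noetherian_module_union:
  assumes "noetherian_module R M" "\<And>k. submodule (W k) R M" "\<And>k. W k \<subseteq> W (Suc k)"
    and "\<And>x. x \<in> X \<Longrightarrow> \<exists>k. x \<in> W k"
  shows "\<exists>k0. \<forall>k\<ge>k0. X \<subseteq> W k"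
proof -
  obtain k0 where k0: "\<And>k. k \<ge> k0 \<Longrightarrow> W k = W k0" using noetherian_moduleD[where W = W, OF assms(1-3)] by blast
  have mono: "W i \<subseteq> W j" if "i \<le> j" for i j using that assms(3) by (rule lift_Suc_mono_le[rotated])
  have "x \<in> W k" if x: "x \<in> X" and k: "k \<ge> k0" for x k
  proof -
    obtain i where "x \<in> W i" using assms(4)[OF x] by blast
    then have "x \<in> W (max i k0)" using mono by (meson max.cobounded1 subsetD)
    then show ?thesis using k0[of "max i k0"] k0[OF k] by simp
  qed
  then show ?thesis by blast
qed

lemma (in noetherian_ring) ideal_sequence_stable:
  assumes "\<And>k. ideal (I k) R" "\<And>k. I k \<subseteq> I (Suc k)"
  shows "\<exists>k0. \<forall>k\<ge>k0. I k = I (k0::nat)"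
proof -
  have mono: "I i \<subseteq> I j" if "i \<le> j" for i j using that assms(2) by (rule lift_Suc_mono_le[rotated])
  have "\<Union>(range I) \<in> range I"
  proof (rule ideal_chain_is_trivial)
    have "I i \<subseteq> I j \<or> I j \<subseteq> I i" for i j
      using mono[of i j] mono[of j i] nat_le_linear[of i j] by blast
    then show "subset.chain {I. ideal I R} (range I)"
      using assms(1) by (auto simp: subset_chain_def)
  qed auto
  then obtain k0 where k0: "\<Union>(range I) = I k0" by auto
  then have "I k = I k0" if "k \<ge> k0" for k using that mono[OF that] by blast
  then show ?thesis by blast
qed

lemma (in module) quot_noetherian:
  assumes U: "submodule U R M" and M: "noetherian_module R M"
  shows "noetherian_module R (quot_module M U)"
  unfolding noetherian_module_def
proof (intro allI impI)
  interpret Q: module R "quot_module M U" by (rule quot_is_module[OF U])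
  fix W assume W: "(\<forall>k. submodule (W k) R (quot_module M U)) \<and> (\<forall>k. W k \<subseteq> W (Suc k))"
  define V where "V k = {x \<in> carrier M. U +>\<^bsub>M\<^esub> x \<in> W k}" for k
  have V: "submodule (V k) R M" "V k \<subseteq> V (Suc k)" for k
    using W quot_vimage_submodule[OF U] unfolding V_def by auto
  obtain k0 where k0: "\<And>k. k \<ge> k0 \<Longrightarrow> V k = V k0"
    using noetherian_moduleD[where W = V, OF M V] by blast
  have "W k = (\<lambda>x. U +>\<^bsub>M\<^esub> x) ` V k" for k
  proof -
    have "W k \<subseteq> carrier (quot_module M U)" using W Q.submoduleE(1) by blast
    then show ?thesis unfolding V_def quot_carrier by auto
  qed
  then show "\<exists>k0. \<forall>k\<ge>k0. W k = W k0" using k0 by metis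
qed

text \<open>Induction on the number of generators. If \<open>N\<close> is generated by the first ones and \<open>s\<close> is the
  next one, then a chain of submodules \<open>W\<close> is constant from the point on where the chains
  \<open>W \<inter> N\<close> and \<open>{r. r s \<in> W + N}\<close> are, the latter being a chain of ideals.\<close>

lemma (in module) finitely_generated_noetherian:
  assumes R: "noetherian_ring R" and fg: "finitely_generated R M"
  shows "noetherian_module R M"
proof -
  have stable: "\<exists>k0. \<forall>k\<ge>k0. W k = W (k0::nat)"
    if "finite S" "S \<subseteq> carrier M" "\<And>k. submodule (W k) R M" "\<And>k. W k \<subseteq> W (Suc k)"
      "\<And>k. W k \<subseteq> module_span R M S" for S W
    using that
  proof (induct S arbitrary: W rule: finite_induct)
    case empty
    have "module_span R M {} \<subseteq> {\<zero>\<^bsub>M\<^esub>}" by (rule span_least[OF zero_submodule]) simp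
    then have "W k = {\<zero>\<^bsub>M\<^esub>}" for k using empty(4)[of k] submodule_zero[OF empty(2)[of k]] by auto
    then show ?case by auto
  next
    case (insert s S)
    let ?N = "module_span R M S"
    have s: "s \<in> carrier M" and N: "submodule ?N R M"
      using insert.prems submodule_span by auto
    note carr = submodule_carrier[OF N] submodule_carrier[OF insert.prems(2)]
    have span: "\<exists>r\<in>carrier R. \<exists>y\<in>?N. x = r \<odot>\<^bsub>M\<^esub> s \<oplus>\<^bsub>M\<^esub> y" if "x \<in> W k" for x k
    proof -
      have "submodule ((\<lambda>r. r \<odot>\<^bsub>M\<^esub> s) ` carrier R) R M"
        by (rule submodule_image_ideal[OF R.oneideal s])
      from submodule_sum[OF this N]
      have sub: "submodule {x \<oplus>\<^bsub>M\<^esub> y |x y. x \<in> (\<lambda>r. r \<odot>\<^bsub>M\<^esub> s) ` carrier R \<and> y \<in> ?N} R M" (is "submodule ?T R M") .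
      have "s = \<one> \<odot>\<^bsub>M\<^esub> s \<oplus>\<^bsub>M\<^esub> \<zero>\<^bsub>M\<^esub>" using s by simp
      then have "s \<in> ?T" using submodule_zero[OF N] by blast
      moreover have "u \<in> ?T" if "u \<in> S" for u
      proof -
        have "u \<in> ?N" using that span_superset by blast
        moreover have "u = \<zero> \<odot>\<^bsub>M\<^esub> s \<oplus>\<^bsub>M\<^esub> u" using s carr calculation by simp
        ultimately show ?thesis by blast
      qed
      ultimately have "module_span R M (insert s S) \<subseteq> ?T" by (intro span_least[OF sub]) auto
      then show ?thesis using insert.prems(4)[of k] that by blast
    qed
    define L where "L k = {r \<in> carrier R. \<exists>y\<in>?N. r \<odot>\<^bsub>M\<^esub> s \<oplus>\<^bsub>M\<^esub> y \<in> W k}" for k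
    have "ideal (L k) R" for k
    proof -
      let ?T = "{x \<oplus>\<^bsub>M\<^esub> y |x y. x \<in> W k \<and> y \<in> ?N}"
      have "L k = {r \<in> carrier R. \<forall>x\<in>{s}. r \<odot>\<^bsub>M\<^esub> x \<in> ?T}"
      proof (intro Set.set_eqI iffI)
        fix r assume "r \<in> L k"
        then obtain y where y: "r \<in> carrier R" "y \<in> ?N" "r \<odot>\<^bsub>M\<^esub> s \<oplus>\<^bsub>M\<^esub> y \<in> W k" by (auto simp: L_def)
        have "r \<odot>\<^bsub>M\<^esub> s = (r \<odot>\<^bsub>M\<^esub> s \<oplus>\<^bsub>M\<^esub> y) \<oplus>\<^bsub>M\<^esub> \<ominus>\<^bsub>M\<^esub> y"
          using y carr s by (simp add: M.a_assoc M.r_neg)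
        then show "r \<in> {r \<in> carrier R. \<forall>x\<in>{s}. r \<odot>\<^bsub>M\<^esub> x \<in> ?T}"
          using y submoduleE(3)[OF N] by blast
      next
        fix r assume "r \<in> {r \<in> carrier R. \<forall>x\<in>{s}. r \<odot>\<^bsub>M\<^esub> x \<in> ?T}"
        then obtain x y where y: "r \<in> carrier R" "y \<in> ?N" "x \<in> W k" "r \<odot>\<^bsub>M\<^esub> s = x \<oplus>\<^bsub>M\<^esub> y" by auto
        have "r \<odot>\<^bsub>M\<^esub> s \<oplus>\<^bsub>M\<^esub> \<ominus>\<^bsub>M\<^esub> y = x"
          using y carr s by (simp add: M.a_assoc M.r_neg)
        then show "r \<in> L k" unfolding L_def using y submoduleE(3)[OF N] by blast
      qed
      then show ?thesis
        using ideal_transporter[OF submodule_sum[OF insert.prems(2) N], of "{s}"] s by simp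
    qed
    moreover have "L k \<subseteq> L (Suc k)" for k using insert.prems(3) by (auto simp: L_def)
    ultimately obtain k1 where k1: "\<And>k. k \<ge> k1 \<Longrightarrow> L k = L k1"
      using noetherian_ring.ideal_sequence_stable[OF R, of L] by blast
    have "\<exists>k0. \<forall>k\<ge>k0. W k \<inter> ?N = W k0 \<inter> ?N"
      by (rule insert.hyps(3)) (use insert.prems N submodule_Int in auto)
    then obtain k2 where k2: "\<And>k. k \<ge> k2 \<Longrightarrow> W k \<inter> ?N = W k2 \<inter> ?N" by blast
    have mono: "W i \<subseteq> W j" if "i \<le> j" for i j using that insert.prems(3) by (rule lift_Suc_mono_le[rotated])
    have "W k = W (max k1 k2)" if k: "k \<ge> max k1 k2" for k
    proof
      show "W (max k1 k2) \<subseteq> W k" by (rule mono[OF k])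
      show "W k \<subseteq> W (max k1 k2)"
      proof
        fix x assume x: "x \<in> W k"
        then obtain r y where ry: "r \<in> carrier R" "y \<in> ?N" "x = r \<odot>\<^bsub>M\<^esub> s \<oplus>\<^bsub>M\<^esub> y" using span by blast
        then have "r \<in> L k" using x by (auto simp: L_def)
        then have "r \<in> L (max k1 k2)" using k1[of k] k1[of "max k1 k2"] k by simp
        then obtain y' where y': "y' \<in> ?N" "r \<odot>\<^bsub>M\<^esub> s \<oplus>\<^bsub>M\<^esub> y' \<in> W (max k1 k2)" by (auto simp: L_def)
        let ?z = "r \<odot>\<^bsub>M\<^esub> s \<oplus>\<^bsub>M\<^esub> y'"
        have zk: "?z \<in> W k" using y' mono[OF k] by blast
        have "x \<ominus>\<^bsub>M\<^esub> ?z = y \<ominus>\<^bsub>M\<^esub> y'"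
          using ry y' s carr add_minus_add_cancel by simp
        then have "x \<ominus>\<^bsub>M\<^esub> ?z \<in> W k \<inter> ?N"
          using submodule_minus[OF insert.prems(2) x zk] submodule_minus[OF N ry(2) y'(1)] by simp
        then have "x \<ominus>\<^bsub>M\<^esub> ?z \<in> W (max k1 k2)" using k2[of k] k2[of "max k1 k2"] k by auto
        then have "x \<ominus>\<^bsub>M\<^esub> ?z \<oplus>\<^bsub>M\<^esub> ?z \<in> W (max k1 k2)" by (rule submodule_add[OF insert.prems(2) _ y'(2)])
        moreover have "x \<ominus>\<^bsub>M\<^esub> ?z \<oplus>\<^bsub>M\<^esub> ?z = x"
          using carr(2)[OF x] carr(2)[OF zk] by (rule minus_add_cancel)
        ultimately show "x \<in> W (max k1 k2)" by simp
      qed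
    qed
    then show ?case by blast
  qed
  obtain S where S: "finite S" "S \<subseteq> carrier M" "module_span R M S = carrier M"
    using fg unfolding finitely_generated_def by blast
  show ?thesis
    unfolding noetherian_module_def
  proof (intro allI impI)
    fix W assume W: "(\<forall>k. submodule (W k) R M) \<and> (\<forall>k. W k \<subseteq> W (Suc k))"
    show "\<exists>k0. \<forall>k\<ge>k0. W k = W k0"
      by (rule stable[OF S(1,2)]) (use W S(3) submoduleE(1) in auto)
  qed
qed

text \<open>Through this module, statements about submodules apply to ideals.\<close>

definition regular_module :: "('a, 'm) ring_scheme \<Rightarrow> ('a, 'a) module" where
  "regular_module R = \<lparr> carrier = carrier R, monoid.mult = monoid.mult R, one = one R, zero = zero R,
     add = add R, smult = monoid.mult R \<rparr>"

lemma regular_module_sel [simp]: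
  "carrier (regular_module R) = carrier R" "zero (regular_module R) = zero R"
  "add (regular_module R) = add R" "smult (regular_module R) = monoid.mult R"
  by (simp_all add: regular_module_def)

lemma (in cring) regular_module: "module R (regular_module R)"
  by (rule moduleI)
    (auto simp: cring_axioms l_distr r_distr m_assoc a_ac intro!: abelian_groupI intro: l_neg a_inv_closed)

lemma (in cring) regular_submodule_iff: "submodule I R (regular_module R) \<longleftrightarrow> ideal I R"
proof
  interpret reg: module R "regular_module R" by (rule regular_module)
  have minus: "\<ominus>\<^bsub>regular_module R\<^esub> x = \<ominus> x" for x
    by (simp add: a_inv_def m_inv_def)
  {
    assume I: "submodule I R (regular_module R)"
    have mult: "r \<otimes> x \<in> I" if "r \<in> carrier R" "x \<in> I" for r x
      using submodule.smult_closed[OF I] that by simp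
    have sub: "I \<subseteq> carrier R" using reg.submoduleE(1)[OF I] by simp
    show "ideal I R"
    proof (rule idealI[OF ring_axioms])
      show "subgroup I (add_monoid R)"
        by (rule add.subgroupI)
          (use reg.submoduleE[OF I] sub minus in \<open>auto simp flip: a_inv_def\<close>)
      show "r \<otimes> x \<in> I" "x \<otimes> r \<in> I" if "x \<in> I" "r \<in> carrier R" for x r
        using mult[OF that(2,1)] m_comm[of x r] that sub by auto
    qed
  }
  assume I: "ideal I R"
  then interpret ideal I R .
  show "submodule I R (regular_module R)"
    by (rule reg.submoduleI) (use minus I_l_closed a_subset in auto)
qed

lemma regular_module_noetherian:
  assumes "noetherian_ring R" "cring R"
  shows "noetherian_module R (regular_module R)"
  unfolding noetherian_module_def cring.regular_submodule_iff[OF assms(2)]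
  using noetherian_ring.ideal_sequence_stable[OF assms(1)] by blast

section \<open>Graded families of submodules\<close>

text \<open>A family \<open>F\<close> stands for the graded subgroup \<open>\<Oplus>\<^sub>n F n T\<^sup>n\<close> of \<open>M[T]\<close>. Being stable under \<open>X\<close>
  means that this is a module over the subring generated by \<open>R\<close> and all \<open>x T\<close> with \<open>x \<in> X\<close>.\<close>

definition stable_family ::
  "('a, 'm) ring_scheme \<Rightarrow> ('a, 'b, 'k) module_scheme \<Rightarrow> 'a set \<Rightarrow> (nat \<Rightarrow> 'b set) \<Rightarrow> bool" where
  "stable_family R M X F \<longleftrightarrow> (\<forall>n. submodule (F n) R M) \<and> (\<forall>x\<in>X. \<forall>n. \<forall>u\<in>F n. x \<odot>\<^bsub>M\<^esub> u \<in> F (Suc n))"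

text \<open>The ascending chain condition for graded submodules of \<open>\<Oplus>\<^sub>n F n T\<^sup>n\<close> over that subring.
  Families are compared degree by degree.\<close>

definition noetherian_family ::
  "('a, 'm) ring_scheme \<Rightarrow> ('a, 'b, 'k) module_scheme \<Rightarrow> 'a set \<Rightarrow> (nat \<Rightarrow> 'b set) \<Rightarrow> bool" where
  "noetherian_family R M X F \<longleftrightarrow>
     (\<forall>K. (\<forall>k. stable_family R M X (K k)) \<and> (\<forall>k. K k \<le> K (Suc k)) \<and> (\<forall>k. K k \<le> F)
        \<longrightarrow> (\<exists>k0::nat. \<forall>k\<ge>k0. K k = K k0))"

text \<open>The sum of all \<open>x\<^sup>j F (n - j)\<close> with \<open>j < i\<close> and \<open>j \<le> n\<close>. For \<open>i = n + 1\<close> it is the degree \<open>n\<close>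
  part of the module that \<open>F\<close> generates once \<open>x T\<close> is added to the ring.\<close>

primrec adjoin_upto ::
  "('a, 'm) ring_scheme \<Rightarrow> ('a, 'b, 'k) module_scheme \<Rightarrow> 'a \<Rightarrow> (nat \<Rightarrow> 'b set) \<Rightarrow> nat \<Rightarrow> nat \<Rightarrow> 'b set" where
  "adjoin_upto R M x F 0 n = {\<zero>\<^bsub>M\<^esub>}"
| "adjoin_upto R M x F (Suc i) n =
     (if i \<le> n then {g \<oplus>\<^bsub>M\<^esub> (x [^]\<^bsub>R\<^esub> i) \<odot>\<^bsub>M\<^esub> u | g u. g \<in> adjoin_upto R M x F i n \<and> u \<in> F (n - i)}
      else adjoin_upto R M x F i n)"

lemma stable_familyD:
  assumes "stable_family R M X F"
  shows "submodule (F n) R M" "x \<in> X \<Longrightarrow> u \<in> F n \<Longrightarrow> x \<odot>\<^bsub>M\<^esub> u \<in> F (Suc n)"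
  using assms by (auto simp: stable_family_def)

context module
begin

context
  fixes x F X
  assumes x: "x \<in> carrier R" and X: "X \<subseteq> carrier R" and F: "stable_family R M X F"
begin

lemma adjoin_upto_submodule: "submodule (adjoin_upto R M x F i n) R M"
proof (induct i)
  case 0
  then show ?case by (simp add: zero_submodule)
next
  case (Suc i)
  have "submodule {g \<oplus>\<^bsub>M\<^esub> v | g v. g \<in> adjoin_upto R M x F i n \<and> v \<in> (\<lambda>u. x [^] i \<odot>\<^bsub>M\<^esub> u) ` F (n - i)} R M"
    by (intro submodule_sum Suc submodule_image_smult stable_familyD[OF F] R.nat_pow_closed x)
  moreover have "{g \<oplus>\<^bsub>M\<^esub> v | g v. g \<in> adjoin_upto R M x F i n \<and> v \<in> (\<lambda>u. x [^] i \<odot>\<^bsub>M\<^esub> u) ` F (n - i)}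
      = {g \<oplus>\<^bsub>M\<^esub> x [^] i \<odot>\<^bsub>M\<^esub> u | g u. g \<in> adjoin_upto R M x F i n \<and> u \<in> F (n - i)}"
    by blast
  ultimately show ?case using Suc by simp
qed

lemma family_carrier: "u \<in> F n \<Longrightarrow> u \<in> carrier M"
  using stable_familyD(1)[OF F] submodule_carrier by blast

lemma adjoin_upto_carrier: "g \<in> adjoin_upto R M x F i n \<Longrightarrow> g \<in> carrier M"
  using adjoin_upto_submodule submodule_carrier by blast

lemma adjoin_upto_stable:
  assumes "y \<in> X" "g \<in> adjoin_upto R M x F i n"
  shows "y \<odot>\<^bsub>M\<^esub> g \<in> adjoin_upto R M x F i (Suc n)"
  using assms(2)
proof (induct i arbitrary: g)
  case 0
  then show ?case using assms(1) X by auto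
next
  case (Suc i)
  show ?case
  proof (cases "i \<le> n")
    case True
    then obtain h u where h: "h \<in> adjoin_upto R M x F i n" "u \<in> F (n - i)"
      "g = h \<oplus>\<^bsub>M\<^esub> x [^] i \<odot>\<^bsub>M\<^esub> u" using Suc.prems by auto
    have y: "y \<in> carrier R" using assms(1) X by auto
    have "y \<odot>\<^bsub>M\<^esub> (x [^] i \<odot>\<^bsub>M\<^esub> u) = x [^] i \<odot>\<^bsub>M\<^esub> (y \<odot>\<^bsub>M\<^esub> u)"
      using y x h family_carrier by (simp add: R.m_comm flip: smult_assoc1)
    then have "y \<odot>\<^bsub>M\<^esub> g = y \<odot>\<^bsub>M\<^esub> h \<oplus>\<^bsub>M\<^esub> x [^] i \<odot>\<^bsub>M\<^esub> (y \<odot>\<^bsub>M\<^esub> u)"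
      using h y x family_carrier adjoin_upto_carrier by (simp add: smult_r_distr)
    moreover have "y \<odot>\<^bsub>M\<^esub> u \<in> F (Suc n - i)"
      using stable_familyD(2)[OF F assms(1) h(2)] True by (simp add: Suc_diff_le)
    ultimately show ?thesis using True Suc.hyps[OF h(1)] by auto
  next
    case False
    then have g: "y \<odot>\<^bsub>M\<^esub> g \<in> adjoin_upto R M x F i (Suc n)" using Suc by auto
    have "y \<odot>\<^bsub>M\<^esub> g = y \<odot>\<^bsub>M\<^esub> g \<oplus>\<^bsub>M\<^esub> x [^] i \<odot>\<^bsub>M\<^esub> \<zero>\<^bsub>M\<^esub>"
      using g x adjoin_upto_carrier by simp
    then show ?thesis using g submodule_zero[OF stable_familyD(1)[OF F]] by auto
  qed
qed

lemma adjoin_upto_shift: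
  assumes "g \<in> adjoin_upto R M x F i n"
  shows "x \<odot>\<^bsub>M\<^esub> g \<in> adjoin_upto R M x F (Suc i) (Suc n)"
  using assms
proof (induct i arbitrary: g)
  case 0
  have "\<zero>\<^bsub>M\<^esub> = \<zero>\<^bsub>M\<^esub> \<oplus>\<^bsub>M\<^esub> x [^] (0::nat) \<odot>\<^bsub>M\<^esub> \<zero>\<^bsub>M\<^esub>" by simp
  then show ?case using 0 x submodule_zero[OF stable_familyD(1)[OF F]] by force
next
  case (Suc i)
  show ?case
  proof (cases "i \<le> n")
    case True
    then obtain h u where h: "h \<in> adjoin_upto R M x F i n" "u \<in> F (n - i)"
      "g = h \<oplus>\<^bsub>M\<^esub> x [^] i \<odot>\<^bsub>M\<^esub> u" using Suc.prems by auto
    have "x \<odot>\<^bsub>M\<^esub> (x [^] i \<odot>\<^bsub>M\<^esub> u) = x [^] Suc i \<odot>\<^bsub>M\<^esub> u"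
      using x h family_carrier by (simp add: R.m_comm flip: smult_assoc1)
    then have "x \<odot>\<^bsub>M\<^esub> g = x \<odot>\<^bsub>M\<^esub> h \<oplus>\<^bsub>M\<^esub> x [^] Suc i \<odot>\<^bsub>M\<^esub> u"
      using h x family_carrier adjoin_upto_carrier by (simp add: smult_r_distr del: nat_pow_Suc)
    then show ?thesis using True Suc.hyps[OF h(1)] h(2)
      by (subst adjoin_upto.simps(2)) (auto simp del: nat_pow_Suc adjoin_upto.simps)
  next
    case False
    then show ?thesis using Suc by simp
  qed
qed

lemma adjoin_upto_mono: "g \<in> adjoin_upto R M x F i n \<Longrightarrow> g \<in> adjoin_upto R M x F (Suc i) n"
proof -
  assume g: "g \<in> adjoin_upto R M x F i n"
  then have "g = g \<oplus>\<^bsub>M\<^esub> x [^] i \<odot>\<^bsub>M\<^esub> \<zero>\<^bsub>M\<^esub>" using adjoin_upto_carrier x by simp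
  then show ?thesis using g submodule_zero[OF stable_familyD(1)[OF F]] by auto
qed

text \<open>Hilbert's basis theorem for one variable, in graded form. A stable family inside
  \<open>\<Sum>\<^sub>i x\<^sup>i F (n - i)\<close> is controlled by its families of leading coefficients: those \<open>u\<close> for which
  \<open>x\<^sup>i u\<close> plus terms with smaller powers of \<open>x\<close> lies in the family. These increase with \<open>i\<close> as
  well as along a chain of families, so a diagonal argument makes all of them constant at once.\<close>

lemma noetherian_family_adjoin:
  assumes noeth: "noetherian_family R M X F"
  shows "noetherian_family R M (insert x X) (\<lambda>n. adjoin_upto R M x F (Suc n) n)"
  unfolding noetherian_family_def
proof (intro allI impI)
  let ?G = "adjoin_upto R M x F"
  fix K
  assume "(\<forall>k. stable_family R M (insert x X) (K k)) \<and> (\<forall>k. K k \<le> K (Suc k)) \<and>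
    (\<forall>k. K k \<le> (\<lambda>n. ?G (Suc n) n))"
  then have K: "stable_family R M (insert x X) (K k)" and Kmono: "K k \<le> K (Suc k)"
    and KG: "K k n \<subseteq> ?G (Suc n) n" for k n
    by (auto simp: le_fun_def)
  note Ksub = stable_familyD(1)[OF K]
  note carr = family_carrier adjoin_upto_carrier submodule_carrier[OF Ksub]
  have Kmono': "K k n \<subseteq> K l n" if "k \<le> l" for k l n
    using lift_Suc_mono_le[of K, OF Kmono that] by (auto simp: le_fun_def)
  define L where "L i k n = {u \<in> F n. \<exists>g\<in>?G i (n + i). x [^] i \<odot>\<^bsub>M\<^esub> u \<oplus>\<^bsub>M\<^esub> g \<in> K k (n + i)}" for i k n
  have xi: "x [^] i \<in> carrier R" for i :: nat using x by simp
  have L_stable: "stable_family R M X (L i k)" for i k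
    unfolding stable_family_def
  proof (intro conjI allI ballI)
    fix n
    let ?T = "{w \<oplus>\<^bsub>M\<^esub> g |w g. w \<in> K k (n + i) \<and> g \<in> ?G i (n + i)}"
    have "L i k n = {u \<in> F n. x [^] i \<odot>\<^bsub>M\<^esub> u \<in> ?T}"
    proof (intro Set.set_eqI iffI)
      fix u assume "u \<in> L i k n"
      then obtain g where g: "u \<in> F n" "g \<in> ?G i (n + i)" "x [^] i \<odot>\<^bsub>M\<^esub> u \<oplus>\<^bsub>M\<^esub> g \<in> K k (n + i)"
        by (auto simp: L_def)
      then have "x [^] i \<odot>\<^bsub>M\<^esub> u = (x [^] i \<odot>\<^bsub>M\<^esub> u \<oplus>\<^bsub>M\<^esub> g) \<oplus>\<^bsub>M\<^esub> \<ominus>\<^bsub>M\<^esub> g"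
        using carr xi by (simp add: M.a_assoc M.r_neg)
      then show "u \<in> {u \<in> F n. x [^] i \<odot>\<^bsub>M\<^esub> u \<in> ?T}"
        using g submoduleE(3)[OF adjoin_upto_submodule] by blast
    next
      fix u assume "u \<in> {u \<in> F n. x [^] i \<odot>\<^bsub>M\<^esub> u \<in> ?T}"
      then obtain w g where g: "u \<in> F n" "g \<in> ?G i (n + i)" "w \<in> K k (n + i)"
        "x [^] i \<odot>\<^bsub>M\<^esub> u = w \<oplus>\<^bsub>M\<^esub> g" by auto
      then have "x [^] i \<odot>\<^bsub>M\<^esub> u \<oplus>\<^bsub>M\<^esub> \<ominus>\<^bsub>M\<^esub> g = w"
        using carr by (simp add: M.a_assoc M.r_neg)
      then show "u \<in> L i k n"
        unfolding L_def using g submoduleE(3)[OF adjoin_upto_submodule] by blast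
    qed
    then show "submodule (L i k n) R M"
      using submodule_colon[OF submodule_sum[OF Ksub adjoin_upto_submodule] stable_familyD(1)[OF F] xi]
      by simp
  next
    fix y n u assume y: "y \<in> X" and "u \<in> L i k n"
    then obtain g where g: "u \<in> F n" "g \<in> ?G i (n + i)" "x [^] i \<odot>\<^bsub>M\<^esub> u \<oplus>\<^bsub>M\<^esub> g \<in> K k (n + i)"
      by (auto simp: L_def)
    have yR: "y \<in> carrier R" using y X by auto
    have "y \<odot>\<^bsub>M\<^esub> (x [^] i \<odot>\<^bsub>M\<^esub> u) = x [^] i \<odot>\<^bsub>M\<^esub> (y \<odot>\<^bsub>M\<^esub> u)"
      using yR xi g carr by (simp add: R.m_comm flip: smult_assoc1)
    then have "y \<odot>\<^bsub>M\<^esub> (x [^] i \<odot>\<^bsub>M\<^esub> u \<oplus>\<^bsub>M\<^esub> g) = x [^] i \<odot>\<^bsub>M\<^esub> (y \<odot>\<^bsub>M\<^esub> u) \<oplus>\<^bsub>M\<^esub> y \<odot>\<^bsub>M\<^esub> g"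
      using g yR xi carr by (simp add: smult_r_distr)
    then have "x [^] i \<odot>\<^bsub>M\<^esub> (y \<odot>\<^bsub>M\<^esub> u) \<oplus>\<^bsub>M\<^esub> y \<odot>\<^bsub>M\<^esub> g \<in> K k (Suc n + i)"
      using stable_familyD(2)[OF K _ g(3), of y] y by simp
    then show "y \<odot>\<^bsub>M\<^esub> u \<in> L i k (Suc n)"
      unfolding L_def using stable_familyD(2)[OF F y g(1)] adjoin_upto_stable[OF y g(2)] by auto
  qed
  have L_k: "L i k \<le> L i (Suc k)" for i k
    by (rule le_funI) (use Kmono'[of k "Suc k"] in \<open>auto simp: L_def\<close>)
  have L_i: "L i k \<le> L (Suc i) k" for i k
  proof (rule le_funI, rule subsetI)
    fix n u assume "u \<in> L i k n"
    then obtain g where g: "u \<in> F n" "g \<in> ?G i (n + i)" "x [^] i \<odot>\<^bsub>M\<^esub> u \<oplus>\<^bsub>M\<^esub> g \<in> K k (n + i)"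
      by (auto simp: L_def)
    have "x \<odot>\<^bsub>M\<^esub> (x [^] i \<odot>\<^bsub>M\<^esub> u) = x [^] Suc i \<odot>\<^bsub>M\<^esub> u"
      using x g carr by (simp add: R.m_comm flip: smult_assoc1)
    then have "x \<odot>\<^bsub>M\<^esub> (x [^] i \<odot>\<^bsub>M\<^esub> u \<oplus>\<^bsub>M\<^esub> g) = x [^] Suc i \<odot>\<^bsub>M\<^esub> u \<oplus>\<^bsub>M\<^esub> x \<odot>\<^bsub>M\<^esub> g"
      using g x xi carr by (simp add: smult_r_distr del: nat_pow_Suc)
    then have "x [^] Suc i \<odot>\<^bsub>M\<^esub> u \<oplus>\<^bsub>M\<^esub> x \<odot>\<^bsub>M\<^esub> g \<in> K k (n + Suc i)"
      using stable_familyD(2)[OF K _ g(3), of x] by simp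
    then show "u \<in> L (Suc i) k n"
      unfolding L_def using g(1) adjoin_upto_shift[OF g(2)] 
      by (auto simp del: nat_pow_Suc adjoin_upto.simps)
  qed
  have L_F: "L i k \<le> F" for i k by (auto simp: L_def le_fun_def)
  have L_i': "L i k \<le> L j k" if "i \<le> j" for i j k
    using lift_Suc_mono_le[of "\<lambda>i. L i k", OF L_i that] .
  have L_k': "L i k \<le> L i l" if "k \<le> l" for i k l
    using lift_Suc_mono_le[of "L i", OF L_k that] .
  have chain: "\<exists>k0. \<forall>k\<ge>k0. D k = D k0"
    if "\<And>k. \<exists>i l. D k = L i l" "\<And>k. D k \<le> D (Suc k)" for D :: "nat \<Rightarrow> nat \<Rightarrow> 'c set"
  proof -
    have "stable_family R M X (D k)" "D k \<le> F" for k
      using that(1)[of k] L_stable L_F by auto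
    then show ?thesis
      using noeth that(2) unfolding noetherian_family_def by blast
  qed
  \<comment> \<open>The diagonal bounds all \<open>L i k\<close> with \<open>i, k \<ge> k0\<close>; only finitely many rows \<open>i < k0\<close> remain.\<close>
  have "\<exists>k0. \<forall>k\<ge>k0. L k k = L k0 k0"
    by (rule chain) (use order.trans[OF L_i L_k] in blast)+
  then obtain k0 where k0: "\<And>k. k \<ge> k0 \<Longrightarrow> L k k = L k0 k0" by blast
  have "\<exists>k1. \<forall>k\<ge>k1. L i k = L i k1" for i
    by (rule chain) (use L_k in blast)+
  then obtain \<kappa> where \<kappa>: "\<And>i k. k \<ge> \<kappa> i \<Longrightarrow> L i k = L i (\<kappa> i)" by metis
  define k1 where "k1 = Max (insert k0 (\<kappa> ` {..<k0}))"
  have k1: "k0 \<le> k1" "\<And>i. i < k0 \<Longrightarrow> \<kappa> i \<le> k1" by (auto simp: k1_def)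
  have L_const: "L i k = L i k1" if k: "k \<ge> k1" for i k
  proof (cases "i < k0")
    case True
    then show ?thesis using \<kappa>[of i k] \<kappa>[of i k1] k1(2)[of i] k by simp
  next
    case False
    have "L i l = L k0 k0" if l: "l \<ge> k0" for l
    proof (rule antisym)
      have "L i l \<le> L (max i l) (max i l)"
        by (rule order.trans[OF L_i' L_k']) auto
      then show "L i l \<le> L k0 k0" using k0[of "max i l"] l by simp
      show "L k0 k0 \<le> L i l"
        by (rule order.trans[OF L_i' L_k']) (use False l in auto)
    qed
    then show ?thesis using k k1(1) by simp
  qed
  have "w \<in> K k1 n" if "k \<ge> k1" "w \<in> K k n" "w \<in> ?G i n" for k n w i
    using that(2,3)
  proof (induct i arbitrary: w)
    case 0
    then show ?case using submodule_zero[OF Ksub] by simp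
  next
    case (Suc i)
    show ?case
    proof (cases "i \<le> n")
      case True
      then obtain g u where g: "g \<in> ?G i n" "u \<in> F (n - i)" "w = g \<oplus>\<^bsub>M\<^esub> x [^] i \<odot>\<^bsub>M\<^esub> u"
        using Suc.prems by auto
      then have w: "w = x [^] i \<odot>\<^bsub>M\<^esub> u \<oplus>\<^bsub>M\<^esub> g" using carr xi M.a_comm by simp
      then have "u \<in> L i k (n - i)" unfolding L_def using Suc.prems g True by auto
      \<comment> \<open>Subtracting an element of \<open>K k1\<close> with the same leading coefficient lowers the power of \<open>x\<close>.\<close>
      then have "u \<in> L i k1 (n - i)" using L_const[OF that(1)] by simp
      then obtain g' where g': "g' \<in> ?G i n" "x [^] i \<odot>\<^bsub>M\<^esub> u \<oplus>\<^bsub>M\<^esub> g' \<in> K k1 n"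
        using True by (auto simp: L_def)
      let ?z = "x [^] i \<odot>\<^bsub>M\<^esub> u \<oplus>\<^bsub>M\<^esub> g'"
      have zk: "?z \<in> K k n" using g'(2) Kmono'[OF that(1)] by blast
      have "w \<ominus>\<^bsub>M\<^esub> ?z = g \<ominus>\<^bsub>M\<^esub> g'"
        using w g(1,2) g'(1) carr xi add_minus_add_cancel by simp
      then have "w \<ominus>\<^bsub>M\<^esub> ?z \<in> K k n" "w \<ominus>\<^bsub>M\<^esub> ?z \<in> ?G i n"
        using submodule_minus[OF Ksub Suc.prems(1) zk]
          submodule_minus[OF adjoin_upto_submodule g(1) g'(1)] by auto
      then have "w \<ominus>\<^bsub>M\<^esub> ?z \<in> K k1 n" by (rule Suc.hyps)
      then have "w \<ominus>\<^bsub>M\<^esub> ?z \<oplus>\<^bsub>M\<^esub> ?z \<in> K k1 n" by (rule submodule_add[OF Ksub _ g'(2)])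
      moreover have "w \<ominus>\<^bsub>M\<^esub> ?z \<oplus>\<^bsub>M\<^esub> ?z = w"
        using carr(3)[OF Suc.prems(1)] carr(3)[OF zk] by (rule minus_add_cancel)
      ultimately show ?thesis by simp
    next
      case False
      then show ?thesis using Suc by simp
    qed
  qed
  then have "K k n \<subseteq> K k1 n" if "k \<ge> k1" for k n using that KG by blast
  then have "K k = K k1" if "k \<ge> k1" for k
    using that Kmono' by (intro ext) blast
  then show "\<exists>k0. \<forall>k\<ge>k0. K k = K k0" by blast
qed

end

text \<open>Start with \<open>M\<close> placed in degree zero and adjoin the elements of \<open>X\<close> one after the other.\<close>

lemma noetherian_family_exists:
  assumes "noetherian_module R M" "finite X" "X \<subseteq> carrier R"
  shows "\<exists>F. noetherian_family R M X F \<and> stable_family R M X F \<and> F 0 = carrier M"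
  using assms(2,3)
proof (induct X rule: finite_induct)
  case empty
  let ?F = "\<lambda>n::nat. if n = 0 then carrier M else {\<zero>\<^bsub>M\<^esub>}"
  have "noetherian_family R M {} ?F"
    unfolding noetherian_family_def
  proof (intro allI impI)
    fix K assume K: "(\<forall>k. stable_family R M {} (K k)) \<and> (\<forall>k. K k \<le> K (Suc k)) \<and> (\<forall>k. K k \<le> ?F)"
    have W: "submodule (K k 0) R M" "K k 0 \<subseteq> K (Suc k) 0" for k
      using K by (auto simp: stable_family_def le_fun_def)
    obtain k0 where k0: "\<And>k. k \<ge> k0 \<Longrightarrow> K k 0 = K k0 0"
      using noetherian_moduleD[where W = "\<lambda>k. K k 0", OF assms(1) W] by blast
    have "K k n = {\<zero>\<^bsub>M\<^esub>}" if "n \<noteq> 0" for k n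
    proof -
      have "K k n \<subseteq> ?F n" using K by (auto simp: le_fun_def)
      moreover have "\<zero>\<^bsub>M\<^esub> \<in> K k n" using K submodule_zero by (auto simp: stable_family_def)
      ultimately show ?thesis using that by auto
    qed
    then have "K k = K k0" if "k \<ge> k0" for k
    proof -
      have "K k n = K k0 n" for n using k0[OF that] \<open>\<And>n k. n \<noteq> 0 \<Longrightarrow> K k n = {\<zero>\<^bsub>M\<^esub>}\<close> by (cases "n = 0") auto
      then show ?thesis by auto
    qed
    then show "\<exists>k0. \<forall>k\<ge>k0. K k = K k0" by blast
  qed
  moreover have "stable_family R M {} ?F"
    using zero_submodule carrier_is_submodule by (auto simp: stable_family_def)
  ultimately show ?case by (intro exI[of _ ?F]) auto
next
  case (insert x X)
  then obtain F where F: "noetherian_family R M X F" "stable_family R M X F" "F 0 = carrier M"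
    by auto
  have x: "x \<in> carrier R" and X: "X \<subseteq> carrier R" using insert by auto
  let ?F = "\<lambda>n. adjoin_upto R M x F (Suc n) n"
  have "y \<odot>\<^bsub>M\<^esub> u \<in> ?F (Suc n)" if "y \<in> insert x X" "u \<in> ?F n" for y u n
    using that adjoin_upto_shift[OF x X F(2)] 
      adjoin_upto_mono[OF x X F(2) adjoin_upto_stable[OF x X F(2)]]
    by (auto simp del: adjoin_upto.simps)
  then have "stable_family R M (insert x X) ?F"
    using adjoin_upto_submodule[OF x X F(2)] by (auto simp: stable_family_def simp del: adjoin_upto.simps)
  moreover have "?F 0 = carrier M"
  proof
    show "?F 0 \<subseteq> carrier M" using adjoin_upto_carrier[OF x X F(2)] by blast
    have "u = \<zero>\<^bsub>M\<^esub> \<oplus>\<^bsub>M\<^esub> x [^] (0::nat) \<odot>\<^bsub>M\<^esub> u" if "u \<in> carrier M" for u using that by simp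
    then show "carrier M \<subseteq> ?F 0" using F(3) by fastforce
  qed
  ultimately show ?case using noetherian_family_adjoin[OF x X F(2,1)] by blast
qed

text \<open>The family of all \<open>I\<^sup>n M\<close> lies inside the family generated from \<open>M\<close> in degree zero by
  finitely many generators of \<open>I\<close>.\<close>

lemma ideal_powers_noetherian:
  assumes R: "noetherian_ring R" and M: "noetherian_module R M" and I: "ideal I R"
  shows "noetherian_family R M I (ideal_pow_module R I M)"
proof -
  obtain X where X: "finite X" "X \<subseteq> carrier R" "I = genideal R X"
    using noetherian_ring.finetely_gen[OF R I] by blast
  obtain F where F: "noetherian_family R M X F" "stable_family R M X F" "F 0 = carrier M"
    using noetherian_family_exists[OF M X(1,2)] by blast
  note Fsub = stable_familyD(1)[OF F(2)]
  have Fcarr: "F n \<subseteq> carrier M" for n using submoduleE(1)[OF Fsub] .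
  have FI: "r \<odot>\<^bsub>M\<^esub> u \<in> F (Suc n)" if "r \<in> I" "u \<in> F n" for r u n
  proof -
    have "genideal R X \<subseteq> {r \<in> carrier R. \<forall>u\<in>F n. r \<odot>\<^bsub>M\<^esub> u \<in> F (Suc n)}"
      by (rule R.genideal_minimal[OF ideal_transporter[OF Fsub Fcarr]])
        (use X(2) stable_familyD(2)[OF F(2)] in auto)
    then show ?thesis using that X(3) by blast
  qed
  have "ideal_pow_module R I M n \<subseteq> F n" for n
  proof -
    have "ideal_smult R (ideal_pow R I m) M (F k) \<subseteq> F (m + k)" for m k
    proof (induct m arbitrary: k)
      case 0
      show ?case
        unfolding R.ideal_pow_0 by (rule ideal_smult_least) (use Fsub submodule_smult[OF Fsub] in auto)
    next
      case (Suc m)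
      have "ideal_smult R (ideal_pow R I (Suc m)) M (F k) \<subseteq> ideal_smult R (ideal_pow R I m) M (F (Suc k))"
        by (rule ideal_smult_pow_Suc[OF I Fcarr Fcarr FI])
      also have "\<dots> \<subseteq> F (m + Suc k)" by (rule Suc)
      finally show ?case by simp
    qed
    from this[of n 0] show ?thesis using F(3) by (simp add: ideal_pow_module_def)
  qed
  then have le: "ideal_pow_module R I M \<le> F" by (auto simp: le_fun_def)
  have "X \<subseteq> I" using X R.genideal_self by blast
  then have "stable_family R M X K" if "stable_family R M I K" for K
    using that by (auto simp: stable_family_def)
  then show ?thesis
    using F(1) le unfolding noetherian_family_def by (meson order.trans)
qed

text \<open>The Artin-Rees lemma in its general form. The chain condition is applied to the subfamilies
  generated by the components of \<open>K\<close> up to degree \<open>k\<close>, for \<open>k = 0, 1, 2, \<dots>\<close>.\<close>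

lemma artin_rees:
  assumes R: "noetherian_ring R" and M: "noetherian_module R M" and I: "ideal I R"
    and K: "stable_family R M I K" and KI: "K \<le> ideal_pow_module R I M"
  shows "\<exists>k. \<forall>m. K (k + m) \<subseteq> ideal_smult R (ideal_pow R I m) M (K k)"
proof -
  note carr = R.ideal_pow_carrier[OF I]
  note Ksub = stable_familyD(1)[OF K]
  note Kcarr = submoduleE(1)[OF Ksub]
  define W where "W k n = (if n \<le> k then K n else ideal_smult R (ideal_pow R I (n - k)) M (K k))" for k n
  have smult_sub: "submodule (ideal_smult R (ideal_pow R I m) M (K k)) R M" for m k
    by (rule ideal_smult_submodule) (use carr Kcarr in auto)
  have in_K: "ideal_smult R (ideal_pow R I m) M (K k) \<subseteq> K (m + k)" for m k
  proof (induct m arbitrary: k)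
    case 0
    show ?case
      unfolding R.ideal_pow_0 by (rule ideal_smult_least) (use Ksub submodule_smult[OF Ksub] in auto)
  next
    case (Suc m)
    have "ideal_smult R (ideal_pow R I (Suc m)) M (K k) \<subseteq> ideal_smult R (ideal_pow R I m) M (K (Suc k))"
      by (rule ideal_smult_pow_Suc[OF I Kcarr Kcarr stable_familyD(2)[OF K]])
    also have "\<dots> \<subseteq> K (m + Suc k)" by (rule Suc)
    finally show ?case by simp
  qed
  have W_K: "W k n \<subseteq> K n" for k n
    using in_K[of "n - k" k] by (auto simp: W_def)
  have "stable_family R M I (W k)" for k
    unfolding stable_family_def
  proof (intro conjI allI ballI)
    show "submodule (W k n) R M" for n using Ksub smult_sub by (simp add: W_def)
    fix r n u assume r: "r \<in> I" and u: "u \<in> W k n"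
    have r1: "r \<in> ideal_pow R I (Suc 0)" using r R.ideal_pow_1[OF I] by simp
    consider "Suc n \<le> k" | "n = k" | "n > k" by linarith
    then show "r \<odot>\<^bsub>M\<^esub> u \<in> W k (Suc n)"
    proof cases
      case 1
      then show ?thesis using u stable_familyD(2)[OF K r] by (simp add: W_def)
    next
      case 2
      then show ?thesis using u r1 ideal_smult_mem[of r "ideal_pow R I (Suc 0)"] 
        by (simp add: W_def del: nat_pow_Suc)
    next
      case 3
      then have "u \<in> ideal_smult R (ideal_pow R I (n - k)) M (K k)" using u by (simp add: W_def)
      from ideal_smult_pow_mult[OF I Kcarr r1 this] show ?thesis
        using 3 by (simp add: W_def Suc_diff_le del: nat_pow_Suc)
    qed
  qed
  moreover have "W k \<le> W (Suc k)" for k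
  proof (rule le_funI)
    fix n
    consider "n \<le> k" | "n = Suc k" | "n > Suc k" by linarith
    then show "W k n \<subseteq> W (Suc k) n"
    proof cases
      case 1
      then show ?thesis by (simp add: W_def)
    next
      case 2
      then show ?thesis using W_K[of k n] by (simp add: W_def)
    next
      case 3
      then have "n - k = Suc (n - Suc k)" by simp
      moreover have "ideal_smult R (ideal_pow R I (Suc (n - Suc k))) M (K k)
          \<subseteq> ideal_smult R (ideal_pow R I (n - Suc k)) M (K (Suc k))"
        by (rule ideal_smult_pow_Suc[OF I Kcarr Kcarr stable_familyD(2)[OF K]])
      ultimately show ?thesis
        using 3 by (simp add: W_def del: nat_pow_Suc)
    qed
  qed
  moreover have "W k \<le> ideal_pow_module R I M" for k
    using W_K KI by (force simp: le_fun_def)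
  ultimately obtain k0 where k0: "\<And>k. k \<ge> k0 \<Longrightarrow> W k = W k0"
    using ideal_powers_noetherian[OF R M I] unfolding noetherian_family_def by blast
  have "K (k0 + m) \<subseteq> ideal_smult R (ideal_pow R I m) M (K k0)" for m
  proof (cases "m = 0")
    case True
    then show ?thesis using ideal_smult_mem[of \<one> "carrier R" _ "K k0"] Kcarr 
      by (fastforce simp: R.ideal_pow_0)
  next
    case False
    have "K (k0 + m) = W (k0 + m) (k0 + m)" by (simp add: W_def)
    also have "\<dots> = W k0 (k0 + m)" using k0[of "k0 + m"] by simp
    finally show ?thesis using False by (simp add: W_def)
  qed
  then show ?thesis by blast
qed

end

section \<open>Homogeneous annihilators in the form module\<close>

text \<open>Let \<open>y\<^sup>\<star>\<close> be the class of \<open>y \<in> I\<^sup>d M\<close> in degree \<open>d\<close> of the form module. These are the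
  representatives of the elements of degree \<open>k\<close> in the form ring that annihilate \<open>y\<^sup>\<star>\<close>.\<close>

definition form_annihilator ::
  "('a, 'm) ring_scheme \<Rightarrow> 'a set \<Rightarrow> ('a, 'b, 'k) module_scheme \<Rightarrow> 'b \<Rightarrow> nat \<Rightarrow> nat \<Rightarrow> 'a set" where
  "form_annihilator R I M y d k =
     {r \<in> ideal_pow R I k. r \<odot>\<^bsub>M\<^esub> y \<in> ideal_pow_module R I M (Suc (k + d))}"

text \<open>Representatives of the homogeneous elements, of degree \<open>d\<close>, of the form module that are
  annihilated by the form of \<open>a\<close> in degree \<open>c\<close> but by no power of the irrelevant ideal.\<close>

definition non_nilpotent_kernel ::
  "('a, 'm) ring_scheme \<Rightarrow> 'a set \<Rightarrow> ('a, 'b, 'k) module_scheme \<Rightarrow> 'a \<Rightarrow> nat \<Rightarrow> ('b \<times> nat) set" where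
  "non_nilpotent_kernel R I M a c = {(y, d). y \<in> ideal_pow_module R I M d \<and>
     a \<odot>\<^bsub>M\<^esub> y \<in> ideal_pow_module R I M (Suc (c + d)) \<and>
     (\<forall>k. \<exists>p\<in>ideal_pow R I k. p \<odot>\<^bsub>M\<^esub> y \<notin> ideal_pow_module R I M (Suc (k + d)))}"

context module
begin

context
  fixes I assumes I: "ideal I R"
begin

lemma power_kills_Suc:
  assumes y: "y \<in> carrier M" and kills: "\<And>p. p \<in> ideal_pow R I k \<Longrightarrow> p \<odot>\<^bsub>M\<^esub> y \<in> ideal_pow_module R I M (Suc (k + d))"
    and p: "p \<in> ideal_pow R I (Suc k)"
  shows "p \<odot>\<^bsub>M\<^esub> y \<in> ideal_pow_module R I M (Suc (Suc k + d))"
proof -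
  let ?T = "{r \<in> carrier R. \<forall>x\<in>{y}. r \<odot>\<^bsub>M\<^esub> x \<in> ideal_pow_module R I M (Suc (Suc k + d))}"
  have "ideal_pow R I (Suc k) \<subseteq> ?T"
    unfolding R.ideal_pow_Suc
  proof (rule ideal_prod_subset)
    show "ideal ?T R" by (rule ideal_transporter[OF ideal_pow_module_submodule[OF I]]) (use y in simp)
    fix s t assume st: "s \<in> ideal_pow R I k" "t \<in> I"
    then have carr: "s \<in> carrier R" "t \<in> carrier R" and t: "t \<in> ideal_pow R I (Suc 0)"
      using R.ideal_pow_carrier[OF I] ideal.Icarr[OF I] R.ideal_pow_1[OF I] by auto
    have "s \<otimes> t \<odot>\<^bsub>M\<^esub> y = t \<odot>\<^bsub>M\<^esub> (s \<odot>\<^bsub>M\<^esub> y)"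
      using carr y by (simp add: R.m_comm flip: smult_assoc1)
    also have "\<dots> \<in> ideal_pow_module R I M (Suc (Suc k + d))"
      by (rule ideal_pow_module_mult'[OF I t kills[OF st(1)]]) simp
    finally show "s \<otimes> t \<in> ?T" using carr by simp
  qed
  then show ?thesis using p by auto
qed

lemma form_annihilator_stable:
  assumes y: "y \<in> carrier M"
  shows "stable_family R (regular_module R) I (form_annihilator R I M y d)"
  unfolding stable_family_def R.regular_submodule_iff
proof (intro conjI allI ballI)
  fix n
  have eq: "form_annihilator R I M y d n = ideal_pow R I n \<inter>
      {r \<in> carrier R. \<forall>x\<in>{y}. r \<odot>\<^bsub>M\<^esub> x \<in> ideal_pow_module R I M (Suc (n + d))}"
    using R.ideal_pow_carrier[OF I] by (auto simp: form_annihilator_def)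
  show "ideal (form_annihilator R I M y d n) R"
    unfolding eq
    by (rule R.i_intersect[OF R.ideal_pow_ideal[OF I] ideal_transporter[OF ideal_pow_module_submodule[OF I]]])
      (use y in simp)
  fix t r assume t: "t \<in> I" and r: "r \<in> form_annihilator R I M y d n"
  have t1: "t \<in> ideal_pow R I (Suc 0)" using t R.ideal_pow_1[OF I] by simp
  have carr: "t \<in> carrier R" "r \<in> carrier R"
    using r R.ideal_pow_carrier[OF I] ideal.Icarr[OF I t] by (auto simp: form_annihilator_def)
  have "t \<otimes> r \<odot>\<^bsub>M\<^esub> y \<in> ideal_pow_module R I M (Suc 0 + Suc (n + d))"
    using ideal_pow_module_mult[OF I t1] r carr y by (simp add: smult_assoc1 form_annihilator_def)
  moreover have "t \<otimes> r \<in> ideal_pow R I (Suc 0 + n)"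
    using r R.ideal_pow_mult[OF I t1] by (simp add: form_annihilator_def)
  ultimately show "t \<odot>\<^bsub>regular_module R\<^esub> r \<in> form_annihilator R I M y d (Suc n)"
    by (simp add: form_annihilator_def del: nat_pow_Suc)
qed

lemma form_annihilator_le:
  assumes y: "y \<in> carrier M"
  shows "form_annihilator R I M y d \<le> ideal_pow_module R I (regular_module R)"
proof (rule le_funI, rule subsetI)
  interpret reg: module R "regular_module R" by (rule R.regular_module)
  fix n r assume "r \<in> form_annihilator R I M y d n"
  then have r: "r \<in> ideal_pow R I n" by (simp add: form_annihilator_def)
  then have "r \<odot>\<^bsub>regular_module R\<^esub> \<one> \<in> ideal_pow_module R I (regular_module R) n"
    unfolding ideal_pow_module_def by (rule reg.ideal_smult_mem) simp
  then show "r \<in> ideal_pow_module R I (regular_module R) n"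
    using R.ideal_pow_carrier[OF I r] by simp
qed

text \<open>Among the homogeneous elements that are killed by \<open>a\<close> but by no power of the irrelevant
  ideal, one with maximal annihilator exists, and maximality makes that annihilator prime.
  If \<open>r s\<close> kills \<open>y\<close> but neither factor does, then \<open>r y\<close> is killed by some power \<open>I\<^sup>n\<close>,
  since its annihilator contains \<open>s\<close>. For \<open>f \<in> I\<^sup>n\<close> the annihilator of \<open>f y\<close> contains \<open>r\<close>, so that
  \<open>f y\<close> is killed by a power as well. As \<open>R\<close> is Noetherian, one power \<open>I\<^sup>m\<close> serves for all \<open>f\<close>,
  and \<open>I\<^sup>m\<^sup>+\<^sup>n\<close> kills \<open>y\<close>, a contradiction. Here \<open>y\<close> is identified with its class in the form
  module.\<close>

lemma prime_form_annihilator: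
  assumes R: "noetherian_ring R" and a: "a \<in> ideal_pow R I c"
    and ne: "non_nilpotent_kernel R I M a c \<noteq> {}"
  obtains y d where "(y, d) \<in> non_nilpotent_kernel R I M a c"
    and "\<And>i j r s. r \<in> ideal_pow R I i \<Longrightarrow> s \<in> ideal_pow R I j \<Longrightarrow>
      r \<otimes> s \<in> form_annihilator R I M y d (i + j) \<Longrightarrow>
      r \<in> form_annihilator R I M y d i \<or> s \<in> form_annihilator R I M y d j"
proof -
  let ?C = "non_nilpotent_kernel R I M a c"
  let ?P = "ideal_pow_module R I M"
  let ?ann = "form_annihilator R I M"
  note carr = R.ideal_pow_carrier[OF I] and Pcarr = ideal_pow_module_carrier[OF I]
  have reg_noeth: "noetherian_module R (regular_module R)"
    by (rule regular_module_noetherian[OF R R.cring_axioms])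
  interpret reg: module R "regular_module R" by (rule R.regular_module)
  let ?S = "{(z', z). z \<in> ?C \<and> z' \<in> ?C \<and> case_prod ?ann z < case_prod ?ann z'}"
  have "wf ?S"
    unfolding wf_iff_no_infinite_down_chain
  proof
    assume "\<exists>f. \<forall>i. (f (Suc i), f i) \<in> ?S"
    then obtain f where f: "\<And>i. f i \<in> ?C" "\<And>i. case_prod ?ann (f i) < case_prod ?ann (f (Suc i))"
      by auto
    have y: "fst (f i) \<in> carrier M" for i
      using f(1)[of i] Pcarr by (auto simp: non_nilpotent_kernel_def)
    define K where "K i = case_prod ?ann (f i)" for i
    have "stable_family R (regular_module R) I (K i)" for i
      using form_annihilator_stable[OF y[of i]] by (simp add: K_def case_prod_beta)
    moreover have "K i \<le> ideal_pow_module R I (regular_module R)" for i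
      using form_annihilator_le[OF y[of i]] by (simp add: K_def case_prod_beta)
    moreover have less: "K i < K (Suc i)" for i using f(2) by (simp add: K_def)
    ultimately have "\<exists>k0. \<forall>k\<ge>k0. K k = K k0"
      using reg.ideal_powers_noetherian[OF R reg_noeth I] unfolding noetherian_family_def
      by (meson less_imp_le)
    then obtain k0 where "\<And>k. k \<ge> k0 \<Longrightarrow> K k = K k0" by blast
    from this[of "Suc k0"] less[of k0] show False by simp
  qed
  then obtain z where z: "z \<in> ?C" "\<And>z'. (z', z) \<in> ?S \<Longrightarrow> z' \<notin> ?C"
    using ne wf_eq_minimal[of ?S] by (metis (no_types, lifting) all_not_in_conv)
  obtain y d where yd: "z = (y, d)" by (cases z)
  have y: "y \<in> ?P d" "a \<odot>\<^bsub>M\<^esub> y \<in> ?P (Suc (c + d))" "y \<in> carrier M"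
    and nn: "\<And>k. \<exists>p\<in>ideal_pow R I k. p \<odot>\<^bsub>M\<^esub> y \<notin> ?P (Suc (k + d))"
    using z(1) Pcarr by (auto simp: yd non_nilpotent_kernel_def)
  have swap: "r \<odot>\<^bsub>M\<^esub> (s \<odot>\<^bsub>M\<^esub> y) = s \<odot>\<^bsub>M\<^esub> (r \<odot>\<^bsub>M\<^esub> y)" if "r \<in> carrier R" "s \<in> carrier R" for r s
    using that y(3) by (simp add: R.m_comm flip: smult_assoc1)
  have nilpotent: "\<exists>k. \<forall>p\<in>ideal_pow R I k. p \<odot>\<^bsub>M\<^esub> (r \<odot>\<^bsub>M\<^esub> y) \<in> ?P (Suc (k + (i + d)))"
    if r: "r \<in> ideal_pow R I i" and t: "t \<in> ?ann (r \<odot>\<^bsub>M\<^esub> y) (i + d) j" "t \<notin> ?ann y d j" for r i t j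
  proof (rule ccontr)
    assume "\<not> ?thesis"
    moreover have "r \<odot>\<^bsub>M\<^esub> y \<in> ?P (i + d)" by (rule ideal_pow_module_mult[OF I r y(1)])
    moreover have "a \<odot>\<^bsub>M\<^esub> (r \<odot>\<^bsub>M\<^esub> y) \<in> ?P (Suc (c + (i + d)))"
      unfolding swap[OF carr[OF a] carr[OF r]]
      by (rule ideal_pow_module_mult'[OF I r y(2)]) simp
    ultimately have C: "(r \<odot>\<^bsub>M\<^esub> y, i + d) \<in> ?C" by (auto simp: non_nilpotent_kernel_def)
    have "p \<in> ?ann (r \<odot>\<^bsub>M\<^esub> y) (i + d) k" if "p \<in> ?ann y d k" for p k
    proof -
      have p: "p \<in> ideal_pow R I k" "p \<odot>\<^bsub>M\<^esub> y \<in> ?P (Suc (k + d))"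
        using that by (auto simp: form_annihilator_def)
      have "p \<odot>\<^bsub>M\<^esub> (r \<odot>\<^bsub>M\<^esub> y) \<in> ?P (Suc (k + (i + d)))"
        unfolding swap[OF carr[OF p(1)] carr[OF r]]
        by (rule ideal_pow_module_mult'[OF I r p(2)]) simp
      then show ?thesis using p by (simp add: form_annihilator_def)
    qed
    then have "?ann y d \<le> ?ann (r \<odot>\<^bsub>M\<^esub> y) (i + d)" by (auto simp: le_fun_def)
    moreover have "?ann y d \<noteq> ?ann (r \<odot>\<^bsub>M\<^esub> y) (i + d)" using t by metis
    ultimately have "?ann y d < ?ann (r \<odot>\<^bsub>M\<^esub> y) (i + d)" by (simp add: order.strict_iff_order)
    then have "((r \<odot>\<^bsub>M\<^esub> y, i + d), z) \<in> ?S" using C z(1) yd by simp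
    then show False using z(2) C by blast
  qed
  have "r \<in> ?ann y d i \<or> s \<in> ?ann y d j"
    if r: "r \<in> ideal_pow R I i" and s: "s \<in> ideal_pow R I j" and rs: "r \<otimes> s \<in> ?ann y d (i + j)" for i j r s
  proof (rule ccontr)
    assume neg: "\<not> ?thesis"
    have "s \<odot>\<^bsub>M\<^esub> (r \<odot>\<^bsub>M\<^esub> y) = r \<otimes> s \<odot>\<^bsub>M\<^esub> y"
      using carr[OF r] carr[OF s] y(3) by (simp add: smult_assoc1 swap)
    then have "s \<in> ?ann (r \<odot>\<^bsub>M\<^esub> y) (i + d) j"
      using rs s by (simp add: form_annihilator_def ac_simps)
    then obtain n where n: "\<And>p. p \<in> ideal_pow R I n \<Longrightarrow> p \<odot>\<^bsub>M\<^esub> (r \<odot>\<^bsub>M\<^esub> y) \<in> ?P (Suc (n + (i + d)))"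
      using nilpotent[OF r] neg by blast
    define Z where "Z m = {f \<in> ideal_pow R I n. \<forall>p\<in>ideal_pow R I m. p \<odot>\<^bsub>M\<^esub> (f \<odot>\<^bsub>M\<^esub> y) \<in> ?P (Suc (m + (n + d)))}" for m
    have Z_eq: "Z m = ideal_pow R I n \<inter> {f \<in> carrier R. \<forall>x\<in>(\<lambda>p. p \<odot>\<^bsub>M\<^esub> y) ` ideal_pow R I m. f \<odot>\<^bsub>M\<^esub> x \<in> ?P (Suc (m + (n + d)))}" for m
      using carr swap by (auto simp: Z_def)
    have "ideal (Z m) R" for m
      unfolding Z_eq
      by (rule R.i_intersect[OF R.ideal_pow_ideal[OF I] ideal_transporter[OF ideal_pow_module_submodule[OF I]]])
        (use carr y(3) in auto)
    then have Z: "submodule (Z m) R (regular_module R)" for m by (simp add: R.regular_submodule_iff)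
    have Z_Suc: "Z m \<subseteq> Z (Suc m)" for m
      using power_kills_Suc[of _ m "n + d"] carr y(3) by (auto simp: Z_def simp del: nat_pow_Suc)
    have "\<exists>k0. \<forall>k\<ge>k0. ideal_pow R I n \<subseteq> Z k"
    proof (rule noetherian_module_union[where W = Z, OF reg_noeth Z Z_Suc])
      fix f assume f: "f \<in> ideal_pow R I n"
      have "r \<odot>\<^bsub>M\<^esub> (f \<odot>\<^bsub>M\<^esub> y) = f \<odot>\<^bsub>M\<^esub> (r \<odot>\<^bsub>M\<^esub> y)" using swap carr r f by blast
      then have "r \<in> ?ann (f \<odot>\<^bsub>M\<^esub> y) (n + d) i"
        using n[OF f] r by (simp add: form_annihilator_def ac_simps)
      then show "\<exists>m. f \<in> Z m" using nilpotent[OF f] neg f unfolding Z_def by blast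
    qed
    then obtain m where m: "ideal_pow R I n \<subseteq> Z m" by blast
    let ?T = "{r \<in> carrier R. \<forall>x\<in>{y}. r \<odot>\<^bsub>M\<^esub> x \<in> ?P (Suc (m + n + d))}"
    have "ideal_pow R I (m + n) \<subseteq> ?T"
      unfolding R.ideal_pow_add[OF I]
    proof (rule ideal_prod_subset)
      show "ideal ?T R" by (rule ideal_transporter[OF ideal_pow_module_submodule[OF I]]) (use y in simp)
      fix p f assume "p \<in> ideal_pow R I m" "f \<in> ideal_pow R I n"
      then show "p \<otimes> f \<in> ?T"
        using m carr y(3) by (auto simp: Z_def smult_assoc1 ac_simps)
    qed
    then show False using nn[of "m + n"] by blast
  qed
  then show thesis using that z(1) yd by blast
qed

text \<open>The kernel of multiplication by \<open>a\<close> is generated in finitely many degrees, by the Artin-Rees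
  lemma. If each of its elements is killed by a power of the irrelevant ideal, it therefore
  vanishes in large degrees.\<close>

lemma form_kernel_vanishes:
  assumes R: "noetherian_ring R" and M: "noetherian_module R M" and a: "a \<in> ideal_pow R I c"
    and empty: "non_nilpotent_kernel R I M a c = {}"
  shows "\<exists>n0. \<forall>n\<ge>n0. \<forall>x\<in>ideal_pow_module R I M n.
     a \<odot>\<^bsub>M\<^esub> x \<in> ideal_pow_module R I M (Suc (c + n)) \<longrightarrow> x \<in> ideal_pow_module R I M (Suc n)"
proof -
  let ?P = "ideal_pow_module R I M"
  note carr = R.ideal_pow_carrier[OF I] and Pcarr = ideal_pow_module_carrier[OF I]
  note Psub = ideal_pow_module_submodule[OF I]
  define K where "K n = {x \<in> ?P n. a \<odot>\<^bsub>M\<^esub> x \<in> ?P (Suc (c + n))}" for n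
  have Ksub: "submodule (K n) R M" for n
    unfolding K_def by (rule submodule_colon[OF Psub Psub carr[OF a]])
  have "stable_family R M I K"
    unfolding stable_family_def
  proof (intro conjI allI ballI Ksub)
    fix t n x assume t: "t \<in> I" and x: "x \<in> K n"
    have t1: "t \<in> ideal_pow R I (Suc 0)" using t R.ideal_pow_1[OF I] by simp
    have "a \<odot>\<^bsub>M\<^esub> (t \<odot>\<^bsub>M\<^esub> x) = t \<odot>\<^bsub>M\<^esub> (a \<odot>\<^bsub>M\<^esub> x)"
      using carr[OF a] carr[OF t1] submodule_carrier[OF Ksub x] by (simp add: R.m_comm flip: smult_assoc1)
    then show "t \<odot>\<^bsub>M\<^esub> x \<in> K (Suc n)"
      using ideal_pow_module_mult[OF I t1, of _ n] ideal_pow_module_mult[OF I t1, of _ "Suc (c + n)"] x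
      by (simp add: K_def)
  qed
  moreover have "K \<le> ?P" by (auto simp: K_def le_fun_def)
  ultimately obtain k where k: "\<And>m. K (k + m) \<subseteq> ideal_smult R (ideal_pow R I m) M (K k)"
    using artin_rees[OF R M I] by blast
  define Z where "Z m = {x \<in> K k. \<forall>p\<in>ideal_pow R I m. p \<odot>\<^bsub>M\<^esub> x \<in> ?P (Suc (m + k))}" for m
  have Z: "submodule (Z m) R M" for m
  proof (rule submoduleI)
    have sub: "submodule {x \<in> K k. p \<odot>\<^bsub>M\<^esub> x \<in> ?P (Suc (m + k))} R M" if "p \<in> ideal_pow R I m" for p
      by (rule submodule_colon[OF Psub Ksub carr[OF that]])
    show "Z m \<subseteq> carrier M" using submoduleE(1)[OF Ksub] by (auto simp: Z_def)
    show "\<zero>\<^bsub>M\<^esub> \<in> Z m" using submodule_zero[OF Ksub] submodule_zero[OF Psub] carr by (auto simp: Z_def)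
    show "\<ominus>\<^bsub>M\<^esub> x \<in> Z m" if "x \<in> Z m" for x
      using that submoduleE(3)[OF sub] submoduleE(3)[OF Ksub] by (auto simp: Z_def)
    show "x \<oplus>\<^bsub>M\<^esub> y \<in> Z m" if "x \<in> Z m" "y \<in> Z m" for x y
      using that submoduleE(5)[OF sub] submoduleE(5)[OF Ksub] by (auto simp: Z_def)
    show "r \<odot>\<^bsub>M\<^esub> x \<in> Z m" if "r \<in> carrier R" "x \<in> Z m" for r x
      using that submoduleE(4)[OF sub] submoduleE(4)[OF Ksub] by (auto simp: Z_def)
  qed
  have Z_Suc: "Z m \<subseteq> Z (Suc m)" for m
    using power_kills_Suc[of _ m k] submodule_carrier[OF Ksub] by (auto simp: Z_def simp del: nat_pow_Suc)
  have "\<exists>m0. \<forall>m\<ge>m0. K k \<subseteq> Z m"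
  proof (rule noetherian_module_union[where W = Z, OF M Z Z_Suc])
    fix x assume x: "x \<in> K k"
    then have "(x, k) \<notin> non_nilpotent_kernel R I M a c" using empty by blast
    then show "\<exists>m. x \<in> Z m"
      using x by (auto simp: non_nilpotent_kernel_def Z_def K_def)
  qed
  then obtain m0 where m0: "\<And>m. m \<ge> m0 \<Longrightarrow> K k \<subseteq> Z m" by blast
  have "K n \<subseteq> ?P (Suc n)" if n: "n \<ge> k + m0" for n
  proof -
    have "K n \<subseteq> ideal_smult R (ideal_pow R I (n - k)) M (K k)" using k[of "n - k"] n by simp
    also have "\<dots> \<subseteq> ?P (Suc n)"
    proof (rule ideal_smult_least[OF Psub])
      fix p x assume px: "p \<in> ideal_pow R I (n - k)" "x \<in> K k"
      have "m0 \<le> n - k" using n by linarith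
      then have "x \<in> Z (n - k)" using m0 px by blast
      then show "p \<odot>\<^bsub>M\<^esub> x \<in> ?P (Suc n)" using px n by (auto simp: Z_def)
    qed
    finally show ?thesis .
  qed
  then show ?thesis by (intro exI[of _ "k + m0"]) (auto simp: K_def)
qed

end

end

section \<open>The form ring as a quotient of the Rees ring\<close>

(* Otherwise the simplifier splits the power of index n + 1 of an ideal into a product. *)
declare nat_pow_Suc [simp del]

lemma a_r_coset_regular:
 "a_r_coset (regular_module R) = a_r_coset R"
  by (intro ext) (simp add: a_r_coset_def')

context cring
begin

lemma ideal_coset_iff:
  assumes "ideal J R" "x \<in> carrier R"
  shows "y \<in> J +> x \<longleftrightarrow> y \<in> carrier R \<and> y \<ominus> x \<in> J"
proof -
  interpret reg: module R "regular_module R" by (rule regular_module)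
  have "a_minus (regular_module R) y x = y \<ominus> x" by (simp add: a_minus_def a_inv_def m_inv_def)
  then show ?thesis
    using reg.coset_iff[of J x y] assms by (simp add: regular_submodule_iff a_r_coset_regular)
qed

lemma ideal_coset_eq_iff:
  assumes "ideal J R" "x \<in> carrier R" "y \<in> carrier R"
  shows "J +> x = J +> y \<longleftrightarrow> x \<ominus> y \<in> J"
proof -
  interpret reg: module R "regular_module R" by (rule regular_module)
  have "a_minus (regular_module R) x y = x \<ominus> y" by (simp add: a_minus_def a_inv_def m_inv_def)
  then show ?thesis
    using reg.coset_eq_iff[of J x y] assms by (simp add: regular_submodule_iff a_r_coset_regular)
qed

lemma ideal_coset_zero: "ideal J R \<Longrightarrow> J +> \<zero> = J"
  using a_coset_add_zero additive_subgroup.a_subset ideal.axioms(1) by blast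

lemma ideal_finsum:
  assumes J: "ideal J R" and "\<And>i. i \<in> A \<Longrightarrow> f i \<in> J"
  shows "(\<Oplus>i\<in>A. f i) \<in> J"
proof (cases "finite A")
  case True
  then show ?thesis
    using assms(2)
  proof (induct A rule: finite_induct)
    case empty
    then show ?case using additive_subgroup.zero_closed[OF ideal.axioms(1)[OF J]] by simp
  next
    case (insert i A)
    then have "f \<in> A \<rightarrow> carrier R" "f i \<in> carrier R" using ideal.Icarr[OF J] by auto
    then show ?case using insert additive_subgroup.a_closed[OF ideal.axioms(1)[OF J]] by simp
  qed
next
  case False
  then show ?thesis
    using additive_subgroup.zero_closed[OF ideal.axioms(1)[OF J]] by (simp add: finsum_infinite)
qed

context
  fixes I assumes I: "ideal I R"
begin

lemma rees_ring_cring: "cring (rees_ring R I)"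
proof -
  interpret P: UP_cring R "UP R" by unfold_locales
  interpret P: cring "UP R" by (rule P.UP_cring)
  note carr = ideal_pow_carrier[OF I]
  have pow: "ideal (ideal_pow R I n) R" for n by (rule ideal_pow_ideal[OF I])
  note add = additive_subgroup.a_closed[OF ideal.axioms(1)[OF pow]]
    and zero = additive_subgroup.zero_closed[OF ideal.axioms(1)[OF pow]]
    and neg = additive_subgroup.a_inv_closed[OF ideal.axioms(1)[OF pow]]
  let ?H = "{p \<in> carrier (UP R). \<forall>n. coeff (UP R) p n \<in> ideal_pow R I n}"
  have "subring ?H (UP R)"
  proof (rule P.subringI)
    fix p assume p: "p \<in> ?H"
    then show "\<ominus>\<^bsub>UP R\<^esub> p \<in> ?H" using neg by simp
    fix q assume q: "q \<in> ?H"
    show "p \<oplus>\<^bsub>UP R\<^esub> q \<in> ?H" using p q add by simp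
    have "coeff (UP R) p i \<otimes> coeff (UP R) q (n - i) \<in> ideal_pow R I n" if "i \<le> n" for i n
      using ideal_pow_mult[OF I, of "coeff (UP R) p i" i "coeff (UP R) q (n - i)" "n - i"] p q that
      by simp
    then have "(\<Oplus>i\<in>{..n}. coeff (UP R) p i \<otimes> coeff (UP R) q (n - i)) \<in> ideal_pow R I n" for n
      by (intro ideal_finsum[OF pow]) simp
    then show "p \<otimes>\<^bsub>UP R\<^esub> q \<in> ?H" using p q by simp

  qed (use zero in \<open>auto simp: ideal_pow_0\<close>)
  then show ?thesis
    unfolding rees_ring_def by (subst P.subcring_iff[symmetric]) (auto intro: P.subcringI')
qed

lemma rees_ring_sel:
  "p \<in> carrier (rees_ring R I) \<longleftrightarrow> p \<in> carrier (UP R) \<and> (\<forall>n. coeff (UP R) p n \<in> ideal_pow R I n)"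
  "monoid.mult (rees_ring R I) = monoid.mult (UP R)" "one (rees_ring R I) = one (UP R)"
  "add (rees_ring R I) = add (UP R)" "zero (rees_ring R I) = zero (UP R)"
  by (auto simp: rees_ring_def)

lemma monom_in_rees: "a \<in> ideal_pow R I c \<Longrightarrow> monom (UP R) a c \<in> carrier (rees_ring R I)"
proof -
  interpret P: UP_cring R "UP R" by unfold_locales
  assume "a \<in> ideal_pow R I c"
  then show ?thesis
    using ideal_pow_carrier[OF I] additive_subgroup.zero_closed[OF ideal.axioms(1)[OF ideal_pow_ideal[OF I]]]
    by (auto simp: rees_ring_sel)
qed

text \<open>The surjection of the Rees ring onto the form ring. Since it respects the operations, the
  ring laws of the form ring need not be checked on cosets.\<close>

definition initial_forms :: "(nat \<Rightarrow> 'a) \<Rightarrow> nat \<Rightarrow> 'a set" where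
  "initial_forms p = (\<lambda>n. ideal_pow R I (Suc n) +> coeff (UP R) p n)"

lemma product_congruent:
  assumes x: "x \<in> ideal_pow R I i" and y: "y \<in> ideal_pow R I j"
    and x': "x' \<in> ideal_pow R I (Suc i) +> x" and y': "y' \<in> ideal_pow R I (Suc j) +> y"
  shows "x' \<otimes> y' \<in> carrier R" "x' \<otimes> y' \<ominus> x \<otimes> y \<in> ideal_pow R I (Suc (i + j))"
proof -
  note carr = ideal_pow_carrier[OF I]
  have pow: "ideal (ideal_pow R I n) R" for n by (rule ideal_pow_ideal[OF I])
  have x'': "x' \<in> carrier R" "x' \<ominus> x \<in> ideal_pow R I (Suc i)"
    using ideal_coset_iff[OF pow carr[OF x]] x' by auto
  have y'': "y' \<in> carrier R" "y' \<ominus> y \<in> ideal_pow R I (Suc j)"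
    using ideal_coset_iff[OF pow carr[OF y]] y' by auto
  show "x' \<otimes> y' \<in> carrier R" using x'' y'' by simp
  have "y' = (y' \<ominus> y) \<oplus> y" using y'' carr[OF y] by (simp add: a_minus_def a_assoc l_neg)
  moreover have "y' \<ominus> y \<in> ideal_pow R I j"
    using y''(2) ideal_pow_antimono[OF I, of j "Suc j"] by auto
  ultimately have yj: "y' \<in> ideal_pow R I j"
    using y additive_subgroup.a_closed[OF ideal.axioms(1)[OF pow]] by metis
  have "x' \<otimes> y' \<ominus> x \<otimes> y = (x' \<ominus> x) \<otimes> y' \<oplus> x \<otimes> (y' \<ominus> y)"
    using x'' y'' carr[OF x] carr[OF y]
    by (simp add: a_minus_def l_distr r_distr l_minus r_minus a_assoc r_neg1)
  also have "\<dots> \<in> ideal_pow R I (Suc (i + j))"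
    using ideal_pow_mult[OF I x''(2) yj] ideal_pow_mult[OF I x y''(2)]
      additive_subgroup.a_closed[OF ideal.axioms(1)[OF pow]] by simp
  finally show "x' \<otimes> y' \<ominus> x \<otimes> y \<in> ideal_pow R I (Suc (i + j))" .
qed

lemma rcoset_mult_forms:
  assumes x: "x \<in> ideal_pow R I i" and y: "y \<in> ideal_pow R I j"
  shows "rcoset_mult R (ideal_pow R I (Suc (i + j))) (ideal_pow R I (Suc i) +> x) (ideal_pow R I (Suc j) +> y)
    = ideal_pow R I (Suc (i + j)) +> (x \<otimes> y)"
proof -
  note carr = ideal_pow_carrier[OF I]
  have pow: "ideal (ideal_pow R I n) R" for n by (rule ideal_pow_ideal[OF I])
  have zero: "\<zero> \<in> ideal_pow R I n" for n
    by (rule additive_subgroup.zero_closed[OF ideal.axioms(1)[OF pow]])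
  have self: "x \<in> ideal_pow R I (Suc i) +> x" "y \<in> ideal_pow R I (Suc j) +> y"
    using ideal_coset_iff[OF pow] carr[OF x] carr[OF y] zero by (auto simp: a_minus_def r_neg)
  have "ideal_pow R I (Suc (i + j)) +> (x' \<otimes> y') = ideal_pow R I (Suc (i + j)) +> (x \<otimes> y)"
    if "x' \<in> ideal_pow R I (Suc i) +> x" "y' \<in> ideal_pow R I (Suc j) +> y" for x' y'
    using product_congruent[OF x y that] carr[OF x] carr[OF y] by (subst ideal_coset_eq_iff[OF pow]) auto
  then show ?thesis unfolding rcoset_mult_def using self by blast
qed

lemma initial_forms_carrier:
  assumes p: "p \<in> carrier (rees_ring R I)"
  shows "initial_forms p \<in> carrier (form_ring R I)"
proof -
  have "bound \<zero> n p \<Longrightarrow> m > n \<Longrightarrow> coeff (UP R) p m = \<zero>" for n m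
    using p by (auto simp: rees_ring_sel UP_def)
  moreover obtain n where "bound \<zero> n p" using p by (auto simp: rees_ring_sel UP_def)
  ultimately have "{m. initial_forms p m \<noteq> ideal_pow R I (Suc m)} \<subseteq> {..n}"
    using ideal_coset_zero[OF ideal_pow_ideal[OF I]] by (force simp: initial_forms_def not_le[symmetric])
  then have "finite {m. initial_forms p m \<noteq> ideal_pow R I (Suc m)}"
    using finite_subset by blast
  then show ?thesis using p by (auto simp: form_ring_def initial_forms_def rees_ring_sel)
qed

lemma initial_forms_surj:
  assumes f: "f \<in> carrier (form_ring R I)"
  shows "\<exists>p\<in>carrier (rees_ring R I). f = initial_forms p"
proof -
  note carr = ideal_pow_carrier[OF I]
  have zero: "\<zero> \<in> ideal_pow R I n" for n
    by (rule additive_subgroup.zero_closed[OF ideal.axioms(1)[OF ideal_pow_ideal[OF I]]])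
  have fin: "finite {n. f n \<noteq> ideal_pow R I (Suc n)}"
    and "\<forall>n. \<exists>x\<in>ideal_pow R I n. f n = ideal_pow R I (Suc n) +> x"
    using f by (auto simp: form_ring_def)
  then obtain x where x: "\<And>n. x n \<in> ideal_pow R I n" "\<And>n. f n = ideal_pow R I (Suc n) +> x n"
    by metis
  define p where "p n = (if f n = ideal_pow R I (Suc n) then \<zero> else x n)" for n
  have p: "p n \<in> ideal_pow R I n" for n using x(1) zero by (simp add: p_def)
  obtain b where b: "{n. f n \<noteq> ideal_pow R I (Suc n)} \<subseteq> {..b}"
    using fin finite_nat_iff_bounded_le by blast
  have "bound \<zero> b p" using b by (force simp: p_def)
  then have up: "p \<in> up R" using carr[OF p] by blast
  then have "p \<in> carrier (rees_ring R I)" using p by (auto simp: rees_ring_sel UP_def)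
  moreover have "f = initial_forms p"
  proof
    fix n
    show "f n = initial_forms p n"
      using up x(2)[of n] ideal_coset_zero[OF ideal_pow_ideal[OF I], of "Suc n"]
      by (simp add: initial_forms_def UP_def) (simp add: p_def)
  qed

  ultimately show ?thesis by blast
qed

lemma initial_forms_hom: "initial_forms \<in> ring_hom (rees_ring R I) (form_ring R I)"
proof (rule ring_hom_memI)
  interpret P: UP_cring R "UP R" by unfold_locales
  note carr = ideal_pow_carrier[OF I]
  have pow: "ideal (ideal_pow R I n) R" for n by (rule ideal_pow_ideal[OF I])
  show "initial_forms \<one>\<^bsub>rees_ring R I\<^esub> = \<one>\<^bsub>form_ring R I\<^esub>"
    using ideal_coset_zero[OF pow] by (intro ext) (auto simp: initial_forms_def rees_ring_sel form_ring_def)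
  fix p assume p: "p \<in> carrier (rees_ring R I)"
  show "initial_forms p \<in> carrier (form_ring R I)" by (rule initial_forms_carrier[OF p])
  fix s assume s: "s \<in> carrier (rees_ring R I)"
  have pn: "coeff (UP R) p n \<in> ideal_pow R I n" "coeff (UP R) s n \<in> ideal_pow R I n" for n
    using p s by (auto simp: rees_ring_sel)
  have ps: "p \<in> carrier (UP R)" "s \<in> carrier (UP R)" using p s by (auto simp: rees_ring_sel)
  show "initial_forms (p \<oplus>\<^bsub>rees_ring R I\<^esub> s) = initial_forms p \<oplus>\<^bsub>form_ring R I\<^esub> initial_forms s"
    using ps carr[OF pn(1)] carr[OF pn(2)] abelian_subgroup.a_rcos_sum[OF abelian_subgroupI3[OF ideal.axioms(1)[OF pow] abelian_group_axioms]]
    by (intro ext) (simp add: initial_forms_def rees_ring_sel form_ring_def)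
  show "initial_forms (p \<otimes>\<^bsub>rees_ring R I\<^esub> s) = initial_forms p \<otimes>\<^bsub>form_ring R I\<^esub> initial_forms s"
  proof
    fix n
    let ?J = "ideal_pow R I (Suc n)"
    interpret h: ring_hom_cring R "R Quot ?J" "(+>) ?J"
      by (rule ideal.rcos_ring_hom_cring[OF pow cring_axioms])
    let ?t = "\<lambda>i. coeff (UP R) p i \<otimes> coeff (UP R) s (n - i)"
    have t: "?t \<in> {..n} \<rightarrow> carrier R" using carr[OF pn(1)] carr[OF pn(2)] by auto
    have "(initial_forms p \<otimes>\<^bsub>form_ring R I\<^esub> initial_forms s) n
        = (\<Oplus>\<^bsub>R Quot ?J\<^esub>i\<in>{..n}. rcoset_mult R ?J (initial_forms p i) (initial_forms s (n - i)))"
      by (simp add: form_ring_def)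
    also have "\<dots> = (\<Oplus>\<^bsub>R Quot ?J\<^esub>i\<in>{..n}. ?J +> ?t i)"
    proof (rule h.S.finsum_cong')
      show "(\<lambda>i. ?J +> ?t i) \<in> {..n} \<rightarrow> carrier (R Quot ?J)"
        using t h.hom_closed by blast
      fix i assume "i \<in> {..n}"
      then have "i + (n - i) = n" by simp
      then show "rcoset_mult R ?J (initial_forms p i) (initial_forms s (n - i)) = ?J +> ?t i"
        using rcoset_mult_forms[OF pn(1)[of i] pn(2)[of "n - i"]] by (simp add: initial_forms_def)
    qed simp
    also have "\<dots> = ?J +> (\<Oplus>i\<in>{..n}. ?t i)"
      using h.hom_finsum[OF t] by (simp add: o_def)
    also have "\<dots> = initial_forms (p \<otimes>\<^bsub>rees_ring R I\<^esub> s) n"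
      using ps by (simp add: initial_forms_def rees_ring_sel)
    finally show "initial_forms (p \<otimes>\<^bsub>rees_ring R I\<^esub> s) n = (initial_forms p \<otimes>\<^bsub>form_ring R I\<^esub> initial_forms s) n" ..
  qed
qed

lemma form_ring_cring: "cring (form_ring R I)"
proof -
  interpret P: UP_cring R "UP R" by unfold_locales
  interpret rees: cring "rees_ring R I" by (rule rees_ring_cring)
  have img: "initial_forms ` carrier (rees_ring R I) = carrier (form_ring R I)"
    using initial_forms_carrier initial_forms_surj by blast
  have "initial_forms \<zero>\<^bsub>rees_ring R I\<^esub> = \<zero>\<^bsub>form_ring R I\<^esub>"
    using ideal_coset_zero[OF ideal_pow_ideal[OF I]]
    by (intro ext) (auto simp: initial_forms_def rees_ring_sel form_ring_def)
  then have ring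
: "ring (form_ring R I)"
    using rees.ring_hom_imp_img_ring[OF initial_forms_hom] img by simp
  then interpret form: ring "form_ring R I" .
  show ?thesis
  proof (intro cring.intro ring form.monoid_comm_monoidI)
    fix f g assume "f \<in> carrier (form_ring R I)" "g \<in> carrier (form_ring R I)"
    then obtain p s where "p \<in> carrier (rees_ring R I)" "f = initial_forms p"
      "s \<in> carrier (rees_ring R I)" "g = initial_forms s" using img by blast
    then show "f \<otimes>\<^bsub>form_ring R I\<^esub> g = g \<otimes>\<^bsub>form_ring R I\<^esub> f"
      using ring_hom_mult[OF initial_forms_hom] rees.m_comm by metis
  qed
qed

lemma form_elem_eq:
  assumes "a \<in> ideal_pow R I c"
  shows "form_elem R I c a = initial_forms (monom (UP R) a c)"
proof -
  interpret P: UP_cring R "UP R" by unfold_locales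
  show ?thesis
    using ideal_pow_carrier[OF I assms] ideal_coset_zero[OF ideal_pow_ideal[OF I]]
    by (intro ext) (auto simp: form_elem_def initial_forms_def)
qed

end

end

context module
begin

context
  fixes I assumes I: "ideal I R"
begin

lemma smult_forms:
  assumes r: "r \<in> ideal_pow R I i" and y: "y \<in> ideal_pow_module R I M j"
  shows "(\<Union>r'\<in>ideal_pow R I (Suc i) +> r. \<Union>y'\<in>ideal_pow_module R I M (Suc j) +>\<^bsub>M\<^esub> y.
      ideal_pow_module R I M (Suc (i + j)) +>\<^bsub>M\<^esub> (r' \<odot>\<^bsub>M\<^esub> y'))
    = ideal_pow_module R I M (Suc (i + j)) +>\<^bsub>M\<^esub> (r \<odot>\<^bsub>M\<^esub> y)"
proof -
  let ?P = "ideal_pow_module R I M"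
  note carr = R.ideal_pow_carrier[OF I] and Pcarr = ideal_pow_module_carrier[OF I]
  have pow: "ideal (ideal_pow R I n) R" for n by (rule R.ideal_pow_ideal[OF I])
  note Psub = ideal_pow_module_submodule[OF I]
  have zero: "\<zero> \<in> ideal_pow R I n" for n
    by (rule additive_subgroup.zero_closed[OF ideal.axioms(1)[OF pow]])
  have self: "r \<in> ideal_pow R I (Suc i) +> r" "y \<in> ?P (Suc j) +>\<^bsub>M\<^esub> y"
    using R.ideal_coset_iff[OF pow] carr[OF r] zero coset_self[OF Psub] Pcarr[OF y]
    by (auto simp: a_minus_def R.r_neg)
  have "?P (Suc (i + j)) +>\<^bsub>M\<^esub> (r' \<odot>\<^bsub>M\<^esub> y') = ?P (Suc (i + j)) +>\<^bsub>M\<^esub> (r \<odot>\<^bsub>M\<^esub> y)"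
    if r': "r' \<in> ideal_pow R I (Suc i) +> r" and y': "y' \<in> ?P (Suc j) +>\<^bsub>M\<^esub> y" for r' y'
  proof -
    have r'': "r' \<in> carrier R" "r' \<ominus> r \<in> ideal_pow R I (Suc i)"
      using R.ideal_coset_iff[OF pow carr[OF r]] r' by auto
    have y'': "y' \<in> carrier M" "y' \<ominus>\<^bsub>M\<^esub> y \<in> ?P (Suc j)"
      using coset_iff[OF Psub Pcarr[OF y]] y' by auto
    have "y' \<ominus>\<^bsub>M\<^esub> y \<in> ?P j" using y''(2) ideal_pow_module_antimono[OF I, of j "Suc j"] by auto
    then have yj: "y' \<in> ?P j"
      using submodule_add[OF Psub _ y] minus_add_cancel[OF y''(1) Pcarr[OF y]] by metis
    have "r' \<odot>\<^bsub>M\<^esub> y' \<ominus>\<^bsub>M\<^esub> r \<odot>\<^bsub>M\<^esub> y = (r' \<ominus> r) \<odot>\<^bsub>M\<^esub> y' \<oplus>\<^bsub>M\<^esub> r \<odot>\<^bsub>M\<^esub> (y' \<ominus>\<^bsub>M\<^esub> y)"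
      using r'' y'' carr[OF r] Pcarr[OF y]
      by (simp add: a_minus_def smult_l_distr smult_r_distr smult_l_minus smult_r_minus M.a_assoc M.r_neg1)
    also have "\<dots> \<in> ?P (Suc (i + j))"
      using ideal_pow_module_mult[OF I r''(2) yj] ideal_pow_module_mult[OF I r y''(2)]
        submodule_add[OF Psub] by simp
    finally show ?thesis
      using r'' y'' carr[OF r] Pcarr[OF y] by (subst coset_eq_iff[OF Psub]) auto
  qed
  then show ?thesis using self by blast
qed

lemma form_smult_zero_iff:
  assumes p: "p \<in> carrier (rees_ring R I)" and y: "y \<in> ideal_pow_module R I M d"
  shows "R.initial_forms I p \<odot>\<^bsub>form_module R I M\<^esub>
      (\<lambda>n. if n = d then ideal_pow_module R I M (Suc n) +>\<^bsub>M\<^esub> y else ideal_pow_module R I M (Suc n))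
      = \<zero>\<^bsub>form_module R I M\<^esub> \<longleftrightarrow> (\<forall>i. coeff (UP R) p i \<in> form_annihilator R I M y d i)"
    (is "?f \<odot>\<^bsub>form_module R I M\<^esub> ?g = _ \<longleftrightarrow> _")
proof -
  let ?P = "ideal_pow_module R I M"
  note carr = R.ideal_pow_carrier[OF I] and Pcarr = ideal_pow_module_carrier[OF I]
  note Psub = ideal_pow_module_submodule[OF I]
  have pn: "coeff (UP R) p n \<in> ideal_pow R I n" for n using p by (simp add: R.rees_ring_sel[OF I])
  have P0: "?P n +>\<^bsub>M\<^esub> \<zero>\<^bsub>M\<^esub> = ?P n" for n
    using coset_eq_submodule_iff[OF Psub M.zero_closed] submodule_zero[OF Psub] by blast
  have g: "?g k = ?P (Suc k) +>\<^bsub>M\<^esub> (if k = d then y else \<zero>\<^bsub>M\<^esub>)" for k by (simp add: P0)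
  have comp: "(?f \<odot>\<^bsub>form_module R I M\<^esub> ?g) n =
      (if d \<le> n then ?P (Suc n) +>\<^bsub>M\<^esub> (coeff (UP R) p (n - d) \<odot>\<^bsub>M\<^esub> y) else ?P (Suc n))" for n
  proof -
    interpret Q: module R "quot_module M (?P (Suc n))" by (rule quot_is_module[OF Psub])
    let ?F = "\<lambda>i. ?P (Suc n) +>\<^bsub>M\<^esub> (coeff (UP R) p i \<odot>\<^bsub>M\<^esub> y)"
    have F: "?F i \<in> carrier (quot_module M (?P (Suc n)))" for i
      using carr[OF pn] Pcarr[OF y] by auto
    have "(?f \<odot>\<^bsub>form_module R I M\<^esub> ?g) n = (\<Oplus>\<^bsub>quot_module M (?P (Suc n))\<^esub>i\<in>{..n}.
        (\<Union>r\<in>?f i. \<Union>m\<in>?g (n - i). ?P (Suc n) +>\<^bsub>M\<^esub> (r \<odot>\<^bsub>M\<^esub> m)))"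
      by (simp add: form_module_def)
    also have "\<dots> = (\<Oplus>\<^bsub>quot_module M (?P (Suc n))\<^esub>i\<in>{..n}.
        if d \<le> n \<and> n - d = i then ?F i else \<zero>\<^bsub>quot_module M (?P (Suc n))\<^esub>)"
    proof (rule Q.finsum_cong')
      fix i assume i: "i \<in> {..n}"
      then have eq: "i + (n - i) = n" by simp
      have "(if n - i = d then y else \<zero>\<^bsub>M\<^esub>) \<in> ?P (n - i)"
        using y submodule_zero[OF Psub] by auto
      from smult_forms[OF pn[of i] this] have "(\<Union>r\<in>?f i. \<Union>m\<in>?g (n - i). ?P (Suc n) +>\<^bsub>M\<^esub> (r \<odot>\<^bsub>M\<^esub> m))
          = ?P (Suc n) +>\<^bsub>M\<^esub> (coeff (UP R) p i \<odot>\<^bsub>M\<^esub> (if n - i = d then y else \<zero>\<^bsub>M\<^esub>))"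
        unfolding g R.initial_forms_def[OF I] eq .

      also have "\<dots> = (if d \<le> n \<and> n - d = i then ?F i else \<zero>\<^bsub>quot_module M (?P (Suc n))\<^esub>)"
        using i carr[OF pn[of i]] P0 by (auto simp: quot_module_sel)
      finally show "(\<Union>r\<in>?f i. \<Union>m\<in>?g (n - i). ?P (Suc n) +>\<^bsub>M\<^esub> (r \<odot>\<^bsub>M\<^esub> m))
          = (if d \<le> n \<and> n - d = i then ?F i else \<zero>\<^bsub>quot_module M (?P (Suc n))\<^esub>)" .
    qed (use F in auto)
    also have "\<dots> = (if d \<le> n then ?F (n - d) else ?P (Suc n))"
    proof (cases "d \<le> n")
      case True
      then show ?thesis using Q.add.finprod_singleton[of "n - d" "{..n}" ?F] F by auto
    next
      case False
      then have "(\<Oplus>\<^bsub>quot_module M (?P (Suc n))\<^esub>i\<in>{..n}.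
          if d \<le> n \<and> n - d = i then ?F i else \<zero>\<^bsub>quot_module M (?P (Suc n))\<^esub>) = \<zero>\<^bsub>quot_module M (?P (Suc n))\<^esub>"
        by simp
      also have "\<dots> = ?P (Suc n)" by (rule quot_module_sel)
      finally show ?thesis unfolding if_not_P[OF False] .
    qed

    finally show ?thesis .
  qed
  have z: "\<zero>\<^bsub>form_module R I M\<^esub> = (\<lambda>n. ?P (Suc n))" by (simp add: form_module_def)
  have "?f \<odot>\<^bsub>form_module R I M\<^esub> ?g = \<zero>\<^bsub>form_module R I M\<^esub> \<longleftrightarrow>
      (\<forall>n. d \<le> n \<longrightarrow> coeff (UP R) p (n - d) \<odot>\<^bsub>M\<^esub> y \<in> ?P (Suc n))"
    unfolding z fun_eq_iff comp using coset_eq_submodule_iff[OF Psub] carr[OF pn] Pcarr[OF y]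
    by auto
  also have "\<dots> \<longleftrightarrow> (\<forall>i. coeff (UP R) p i \<odot>\<^bsub>M\<^esub> y \<in> ?P (Suc (i + d)))"
    by (metis add_diff_cancel_right' le_add2 le_add_diff_inverse2)
  also have "\<dots> \<longleftrightarrow> (\<forall>i. coeff (UP R) p i \<in> form_annihilator R I M y d i)"
    using pn by (simp add: form_annihilator_def)
  finally show ?thesis .
qed

text \<open>The homogeneous annihilator is prime as soon as it is prime for homogeneous elements:
  in a product of two elements outside it, consider the lowest components outside it.\<close>

lemma form_annihilator_Ass:
  assumes y: "y \<in> ideal_pow_module R I M d" and y': "y \<notin> ideal_pow_module R I M (Suc d)"
    and prime: "\<And>i j r s. r \<in> ideal_pow R I i \<Longrightarrow> s \<in> ideal_pow R I j \<Longrightarrow>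
      r \<otimes> s \<in> form_annihilator R I M y d (i + j) \<Longrightarrow>
      r \<in> form_annihilator R I M y d i \<or> s \<in> form_annihilator R I M y d j"
  shows "R.initial_forms I ` {p \<in> carrier (rees_ring R I). \<forall>i. coeff (UP R) p i \<in> form_annihilator R I M y d i}
    \<in> Ass (form_ring R I) (form_module R I M)"
    and "\<And>p. p \<in> carrier (rees_ring R I) \<Longrightarrow> R.initial_forms I p \<in>
      R.initial_forms I ` {p \<in> carrier (rees_ring R I). \<forall>i. coeff (UP R) p i \<in> form_annihilator R I M y d i}
      \<longleftrightarrow> (\<forall>i. coeff (UP R) p i \<in> form_annihilator R I M y d i)"
proof -
  let ?P = "ideal_pow_module R I M" and ?\<phi> = "R.initial_forms I" and ?F = "form_ring R I"
  let ?ann = "form_annihilator R I M y d"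
  let ?g = "\<lambda>n. if n = d then ?P (Suc n) +>\<^bsub>M\<^esub> y else ?P (Suc n)"
  note carr = R.ideal_pow_carrier[OF I] and Pcarr = ideal_pow_module_carrier[OF I]
  note Psub = ideal_pow_module_submodule[OF I]
  interpret P: UP_cring R "UP R" by unfold_locales
  interpret rees: cring "rees_ring R I" by (rule R.rees_ring_cring[OF I])
  interpret form: cring ?F by (rule R.form_ring_cring[OF I])
  interpret h: ring_hom_cring "rees_ring R I" ?F ?\<phi>
    by (intro ring_hom_cring.intro ring_hom_cring_axioms.intro rees.cring_axioms form.cring_axioms
        R.initial_forms_hom[OF I])
  note rees_sel = R.rees_ring_sel[OF I]
  define \<PP> where "\<PP> = {f \<in> carrier ?F. f \<odot>\<^bsub>form_module R I M\<^esub> ?g = \<zero>\<^bsub>form_module R I M\<^esub>}"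
  have mem: "?\<phi> p \<in> \<PP> \<longleftrightarrow> (\<forall>i. coeff (UP R) p i \<in> ?ann i)" if "p \<in> carrier (rees_ring R I)" for p
    using form_smult_zero_iff[OF that y] h.hom_closed[OF that] by (simp add: \<PP>_def)
  have lift: "\<exists>p\<in>carrier (rees_ring R I). f = ?\<phi> p" if "f \<in> carrier ?F" for f
    using R.initial_forms_surj[OF I that] .
  have ann: "ideal (?ann i) R" for i
    using stable_familyD(1)[OF form_annihilator_stable[OF I Pcarr[OF y]]]
    by (simp add: R.regular_submodule_iff)
  note ann_add = additive_subgroup.a_closed[OF ideal.axioms(1)[OF ann]]
    and ann_neg = additive_subgroup.a_inv_closed[OF ideal.axioms(1)[OF ann]]
    and ann_zero = additive_subgroup.zero_closed[OF ideal.axioms(1)[OF ann]]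
  have ann_mult: "s \<otimes> r \<in> ?ann n" if "s \<in> ideal_pow R I j" "r \<in> ?ann i" "j + i = n" for s r i j n
  proof -
    have r: "r \<in> ideal_pow R I i" "r \<odot>\<^bsub>M\<^esub> y \<in> ?P (Suc (i + d))"
      using that(2) by (auto simp: form_annihilator_def)
    have "s \<otimes> r \<odot>\<^bsub>M\<^esub> y \<in> ?P (j + Suc (i + d))"
      using ideal_pow_module_mult[OF I that(1) r(2)] carr[OF that(1)] carr[OF r(1)] Pcarr[OF y]
      by (simp add: smult_assoc1)
    then show ?thesis
      using R.ideal_pow_mult[OF I that(1) r(1)] that(3) by (auto simp: form_annihilator_def ac_simps)
  qed
  have add: "?\<phi> p \<oplus>\<^bsub>?F\<^esub> ?\<phi> s \<in> \<PP>"
    if "?\<phi> p \<in> \<PP>" "?\<phi> s \<in> \<PP>" "p \<in> carrier (rees_ring R I)" "s \<in> carrier (rees_ring R I)" for p s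
  proof -
    have "coeff (UP R) p i \<in> ?ann i" "coeff (UP R) s i \<in> ?ann i" for i
      using that(1,2) unfolding mem[OF that(3)] mem[OF that(4)] by blast+
    moreover have "p \<in> carrier (UP R)" "s \<in> carrier (UP R)" using that(3,4) by (simp_all add: rees_sel)
    ultimately have "\<forall>i. coeff (UP R) (p \<oplus>\<^bsub>rees_ring R I\<^esub> s) i \<in> ?ann i"
      by (simp add: rees_sel(4) ann_add)
    then have "?\<phi> (p \<oplus>\<^bsub>rees_ring R I\<^esub> s) \<in> \<PP>"
      unfolding mem[OF rees.a_closed[OF that(3,4)]] .
    then show ?thesis using that(3,4) by simp
  qed
  have mult: "?\<phi> s \<otimes>\<^bsub>?F\<^esub> ?\<phi> p \<in> \<PP>"
    if "?\<phi> p \<in> \<PP>" "p \<in> carrier (rees_ring R I)" "s \<in> carrier (rees_ring R I)" for p s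
  proof -
    have p: "coeff (UP R) p i \<in> ?ann i" for i
      using that(1) unfolding mem[OF that(2)] by blast
    have s: "coeff (UP R) s i \<in> ideal_pow R I i" for i using that(3) by (simp add: rees_sel)
    have "(\<Oplus>i\<in>{..n}. coeff (UP R) s i \<otimes> coeff (UP R) p (n - i)) \<in> ?ann n" for n
      by (rule R.ideal_finsum[OF ann], rule ann_mult[OF s p]) simp
    moreover have "p \<in> carrier (UP R)" "s \<in> carrier (UP R)" using that(2,3) by (simp_all add: rees_sel)
    ultimately have "\<forall>i. coeff (UP R) (s \<otimes>\<^bsub>rees_ring R I\<^esub> p) i \<in> ?ann i"
      by (simp add: rees_sel(2))
    then have "?\<phi> (s \<otimes>\<^bsub>rees_ring R I\<^esub> p) \<in> \<PP>"
      unfolding mem[OF rees.m_closed[OF that(3,2)]] .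
    then show ?thesis using that(2,3) by simp

  qed
  have "primeideal \<PP> ?F"
  proof (rule primeidealI)
    show "ideal \<PP> ?F"
    proof (rule idealI)
      show "ring ?F" by (rule form.ring_axioms)
      show "subgroup \<PP> (add_monoid ?F)"
      proof (rule form.add.subgroupI)
        show "\<PP> \<subseteq> carrier ?F" by (auto simp: \<PP>_def)
        have "?\<phi> \<zero>\<^bsub>rees_ring R I\<^esub> \<in> \<PP>" using mem[OF rees.zero_closed] ann_zero by (simp add: rees_sel)
        then show "\<PP> \<noteq> {}" by blast
        fix f assume f: "f \<in> \<PP>"
        then obtain p where p: "p \<in> carrier (rees_ring R I)" "f = ?\<phi> p" using lift by (auto simp: \<PP>_def)
        have "?\<phi> (\<ominus>\<^bsub>rees_ring R I\<^esub> \<one>\<^bsub>rees_ring R I\<^esub>) \<otimes>\<^bsub>?F\<^esub> ?\<phi> p \<in> \<PP>"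
          by (rule mult) (use f p in auto)

        then show "\<ominus>\<^bsub>?F\<^esub> f \<in> \<PP>" using p by (simp add: form.l_minus)

        fix f' assume f': "f' \<in> \<PP>"
        then obtain p' where "p' \<in> carrier (rees_ring R I)" "f' = ?\<phi> p'" using lift by (auto simp: \<PP>_def)
        then show "f \<oplus>\<^bsub>?F\<^esub> f' \<in> \<PP>" using
 add[of p p'] p f f' by simp
      qed
      fix f g assume f: "f \<in> \<PP>" and g: "g \<in> carrier ?F"
      then have fc: "f \<in> carrier ?F" by (simp add: \<PP>_def)
      obtain p where p: "p \<in> carrier (rees_ring R I)" "f = ?\<phi> p" using lift[OF fc] by blast
      obtain s where s: "s \<in> carrier (rees_ring R I)" "g = ?\<phi> s" using lift[OF g] by blast
      show "g \<otimes>\<^bsub>?F\<^esub> f \<in> \<PP>" using mult[of p s] p s f by simp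
      then show "f \<otimes>\<^bsub>?F\<^esub> g \<in> \<PP>" using form.m_comm[OF fc g] by simp
    qed
    show "cring ?F" by (rule form.cring_axioms)
    have "\<one> \<notin> ?ann 0" using y y' Pcarr by (simp add: form_annihilator_def)
    then have "?\<phi> \<one>\<^bsub>rees_ring R I\<^esub> \<notin> \<PP>"
      using mem[OF rees.one_closed] by (auto simp: rees_sel dest: spec[of _ 0])
    then show "carrier ?F \<noteq> \<PP>" using h.hom_closed[OF rees.one_closed] by blast
    fix f g assume "f \<in> carrier ?F" "g \<in> carrier ?F" and fg: "f \<otimes>\<^bsub>?F\<^esub> g \<in> \<PP>"
    then obtain p s where p: "p \<in> carrier (rees_ring R I)" "f = ?\<phi> p"
      and s: "s \<in> carrier (rees_ring R I)" "g = ?\<phi> s" using lift by metis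
    have pn: "coeff (UP R) p n \<in> ideal_pow R I n" "coeff (UP R) s n \<in> ideal_pow R I n" for n
      using p s by (auto simp: rees_sel)
    show "f \<in> \<PP> \<or> g \<in> \<PP>"
    proof (rule ccontr)
      assume "\<not> ?thesis"
      then have ex: "\<exists>i. coeff (UP R) p i \<notin> ?ann i" "\<exists>j. coeff (UP R) s j \<notin> ?ann j"
        using mem p s by auto
      define i where "i = (LEAST i. coeff (UP R) p i \<notin> ?ann i)"
      define j where "j = (LEAST j. coeff (UP R) s j \<notin> ?ann j)"
      have i: "coeff (UP R) p i \<notin> ?ann i" "\<And>l. l < i \<Longrightarrow> coeff (UP R) p l \<in> ?ann l"
        unfolding i_def using LeastI_ex[OF ex(1)] not_less_Least by blast+
      have j: "coeff (UP R) s j \<notin> ?ann j" "\<And>l. l < j \<Longrightarrow> coeff (UP R) s l \<in> ?ann l"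
        unfolding j_def using LeastI_ex[OF ex(2)] not_less_Least by blast+

      define t where "t = (\<lambda>l. coeff (UP R) p l \<otimes> coeff (UP R) s (i + j - l))"
      have t: "t l \<in> carrier R" for l using carr[OF pn(1)] carr[OF pn(2)] by (simp add: t_def)
      have other: "t l \<in> ?ann (i + j)" if "l \<le> i + j" "l \<noteq> i" for l
      proof (cases "l < i")
        case True
        have "coeff (UP R) s (i + j - l) \<otimes> coeff (UP R) p l \<in> ?ann (i + j)"
          by (rule ann_mult[OF pn(2) i(2)[OF True]]) (use that in simp)
        then show ?thesis using carr[OF pn(1)] carr[OF pn(2)] by (simp add: t_def R.m_comm)
      next
        case False
        then have "i + j - l < j" using that by simp
        then show ?thesis unfolding t_def by (rule ann_mult[OF pn(1) j(2)]) (use that in simp)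
      qed
      have "?\<phi> (p \<otimes>\<^bsub>rees_ring R I\<^esub> s) \<in> \<PP>" using fg p s by simp
      then have "coeff (UP R) (p \<otimes>\<^bsub>rees_ring R I\<^esub> s) (i + j) \<in> ?ann (i + j)"
        using mem p s rees.m_closed by blast
      then have total: "(\<Oplus>l\<in>{..i + j}. t l) \<in> ?ann (i + j)"
        using p s by (simp add: rees_sel t_def)
      let ?rest = "\<Oplus>l\<in>{..i + j} - {i}. t l"
      have "{..i + j} = insert i ({..i + j} - {i})" by auto
      then have "(\<Oplus>l\<in>{..i + j}. t l) = (\<Oplus>l\<in>insert i ({..i + j} - {i}). t l)" by simp
      also have "\<dots> = t i \<oplus> ?rest"
        by (rule R.finsum_insert) (use t in auto)
      finally have "t i = (\<Oplus>l\<in>{..i + j}. t l) \<oplus> \<ominus> ?rest"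
        using t by (simp add: R.a_assoc R.r_neg)
      moreover have "?rest \<in> ?ann (i + j)" by (rule R.ideal_finsum[OF ann]) (use other in auto)
      ultimately have "t i \<in> ?ann (i + j)" using ann_add total ann_neg by metis
      then show False unfolding t_def using prime[OF pn(1)[of i] pn(2)[of j]] i(1) j(1) by simp
    qed
  qed
  moreover have "?g \<in> carrier (form_module R I M)"
  proof -
    have "finite {n. ?g n \<noteq> ?P (Suc n)}" by (rule finite_subset[of _ "{d}"]) auto
    moreover have "\<exists>x\<in>?P n. ?g n = ?P (Suc n) +>\<^bsub>M\<^esub> x" for n
    proof (cases "n = d")
      case False
      have "?P (Suc n) = ?P (Suc n) +>\<^bsub>M\<^esub> \<zero>\<^bsub>M\<^esub>"
        using coset_eq_submodule_iff[OF Psub M.zero_closed] submodule_zero[OF Psub] by blast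
      then show ?thesis using False submodule_zero[OF Psub] by auto
    qed (use y in auto)
    ultimately show ?thesis by (simp add: form_module_def)
  qed
  ultimately have "\<PP> \<in> Ass ?F (form_module R I M)" unfolding Ass_def \<PP>_def by blast
  moreover have "\<PP> = ?\<phi> ` {p \<in> carrier (rees_ring R I). \<forall>i. coeff (UP R) p i \<in> ?ann i}"
  proof (intro Set.equalityI subsetI)
    fix f assume f: "f \<in> \<PP>"
    then obtain p where "p \<in> carrier (rees_ring R I)" "f = ?\<phi> p" using lift by (auto simp: \<PP>_def)
    then show "f \<in> ?\<phi> ` {p \<in> carrier (rees_ring R I). \<forall>i. coeff (UP R) p i \<in> ?ann i}"
      using f mem by auto
  qed (use mem in auto)
  ultimately show "?\<phi> ` {p \<in> carrier (rees_ring R I). \<forall>i. coeff (UP R) p i \<in> ?ann i}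
      \<in> Ass ?F (form_module R I M)"
    and "\<And>p. p \<in> carrier (rees_ring R I) \<Longrightarrow> ?\<phi> p \<in>
      ?\<phi> ` {p \<in> carrier (rees_ring R I). \<forall>i. coeff (UP R) p i \<in> ?ann i}
      \<longleftrightarrow> (\<forall>i. coeff (UP R) p i \<in> ?ann i)"
    using mem by auto
qed

text \<open>The prime annihilator of a class \<open>y\<^sup>\<star>\<close> as above contains the form of \<open>a\<close>, because \<open>a\<close> kills
  \<open>y\<^sup>\<star>\<close>, and it does not contain the irrelevant ideal, because some element of \<open>I\<close>, taken in
  degree one, does not kill \<open>y\<^sup>\<star>\<close>. The condition on associated primes forbids this.\<close>

lemma Ass_condition_kernel_empty:
  assumes R: "noetherian_ring R" and a: "a \<in> ideal_pow R I c"
    and Ass: "\<And>\<PP>. \<PP> \<in> Ass (form_ring R I) (form_module R I M) - V_set (form_ring R I) (form_ring_plus R I)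
      \<Longrightarrow> form_elem R I c a \<notin> \<PP>"
  shows "non_nilpotent_kernel R I M a c = {}"
proof (rule ccontr)
  let ?P = "ideal_pow_module R I M"
  assume "non_nilpotent_kernel R I M a c \<noteq> {}"
  then obtain y d where yd: "(y, d) \<in> non_nilpotent_kernel R I M a c"
    and prime: "\<And>i j r s. r \<in> ideal_pow R I i \<Longrightarrow> s \<in> ideal_pow R I j \<Longrightarrow>
      r \<otimes> s \<in> form_annihilator R I M y d (i + j) \<Longrightarrow>
      r \<in> form_annihilator R I M y d i \<or> s \<in> form_annihilator R I M y d j"
    using prime_form_annihilator[OF I R a] by blast
  interpret P: UP_cring R "UP R" by unfold_locales
  note carr = R.ideal_pow_carrier[OF I]
  note Psub = ideal_pow_module_submodule[OF I]
  have y: "y \<in> ?P d" "a \<odot>\<^bsub>M\<^esub> y \<in> ?P (Suc (c + d))"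
    and nn: "\<And>k. \<exists>p\<in>ideal_pow R I k. p \<odot>\<^bsub>M\<^esub> y \<notin> ?P (Suc (k + d))"
    using yd by (auto simp: non_nilpotent_kernel_def)
  have y': "y \<notin> ?P (Suc d)"
    using nn[of 0] submodule_smult[OF Psub] by (auto simp: R.ideal_pow_0)
  define \<PP> where "\<PP> = R.initial_forms I ` {p \<in> carrier (rees_ring R I). \<forall>i. coeff (UP R) p i \<in> form_annihilator R I M y d i}"
  have PP_Ass: "\<PP> \<in> Ass (form_ring R I) (form_module R I M)"
    unfolding \<PP>_def by (rule form_annihilator_Ass(1)[OF y(1) y']) (rule prime)
  have PP_mem: "R.initial_forms I p \<in> \<PP> \<longleftrightarrow> (\<forall>i. coeff (UP R) p i \<in> form_annihilator R I M y d i)"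
    if "p \<in> carrier (rees_ring R I)" for p
    unfolding \<PP>_def by (rule form_annihilator_Ass(2)[OF y(1) y' _ that]) (rule prime)
  have ann_zero: "\<zero> \<in> form_annihilator R I M y d i" for i
    using additive_subgroup.zero_closed[OF ideal.axioms(1)[OF R.ideal_pow_ideal[OF I]]]
      ideal_pow_module_carrier[OF I y(1)] submodule_zero[OF Psub] by (simp add: form_annihilator_def)
  have monom: "R.initial_forms I (monom (UP R) r k) \<in> \<PP> \<longleftrightarrow> r \<in> form_annihilator R I M y d k"
    if "r \<in> ideal_pow R I k" for r k
    unfolding PP_mem[OF R.monom_in_rees[OF I that]]
    using carr[OF that] ann_zero by auto
  have "form_elem R I c a \<in> \<PP>"
    using y(2) a by (simp add: R.form_elem_eq[OF I a] monom form_annihilator_def)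
  moreover have "\<PP> \<notin> V_set (form_ring R I) (form_ring_plus R I)"
  proof -
    obtain p where p: "p \<in> ideal_pow R I (Suc 0)" "p \<odot>\<^bsub>M\<^esub> y \<notin> ?P (Suc (Suc 0 + d))"
      using nn[of "Suc 0"] by blast
    have "R.initial_forms I (monom (UP R) p (Suc 0)) \<in> form_ring_plus R I"
      using R.initial_forms_carrier[OF I R.monom_in_rees[OF I p(1)]] carr[OF p(1)]
        R.ideal_coset_zero[OF R.ideal_pow_ideal[OF I]]
      by (simp add: form_ring_plus_def R.initial_forms_def[OF I])
    moreover have "R.initial_forms I (monom (UP R) p (Suc 0)) \<notin> \<PP>"
      using monom[OF p(1)] p(2) by (simp add: form_annihilator_def)
    ultimately show ?thesis by (auto simp: V_set_def)
  qed
  ultimately show False using Ass[of \<PP>] PP_Ass by blast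

qed

end

end

section \<open>Intersections with powers of the ideal\<close>

context module
begin

text \<open>By the Artin-Rees lemma, an element of \<open>a M \<inter> I\<^sup>n M\<close> is \<open>a x'\<close> with \<open>x' \<in> I\<^sup>n\<^sup>-\<^sup>k M\<close> for a fixed \<open>k\<close>.
  If the form of \<open>a\<close> acts injectively in large degrees, then the power of \<open>I\<close> for \<open>x'\<close> can be
  raised by one as long as it is below \<open>n - c\<close>.\<close>

lemma multiple_in_power:
  assumes R: "noetherian_ring R" and M: "noetherian_module R M" and I: "ideal I R"
    and a: "a \<in> ideal_pow R I c" and empty: "non_nilpotent_kernel R I M a c = {}"
  shows "\<exists>n1. \<forall>n\<ge>n1. \<forall>x\<in>carrier M. a \<odot>\<^bsub>M\<^esub> x \<in> ideal_pow_module R I M n \<longrightarrow>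
    (\<exists>x'\<in>ideal_pow_module R I M (n - c). a \<odot>\<^bsub>M\<^esub> x' = a \<odot>\<^bsub>M\<^esub> x)"
proof -
  let ?P = "ideal_pow_module R I M"
  note carr = R.ideal_pow_carrier[OF I] and Pcarr = ideal_pow_module_carrier[OF I]
  note Psub = ideal_pow_module_submodule[OF I]
  obtain n0 where n0: "\<And>n x. n \<ge> n0 \<Longrightarrow> x \<in> ?P n \<Longrightarrow> a \<odot>\<^bsub>M\<^esub> x \<in> ?P (Suc (c + n)) \<Longrightarrow> x \<in> ?P (Suc n)"
    using form_kernel_vanishes[OF I R M a empty] by blast
  define K where "K n = ?P n \<inter> (\<lambda>x. a \<odot>\<^bsub>M\<^esub> x) ` carrier M" for n
  have Ksub: "submodule (K n) R M" for n
    unfolding K_def by (intro submodule_Int Psub submodule_image_smult carrier_is_submodule carr[OF a])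
  have "stable_family R M I K"
    unfolding stable_family_def
  proof (intro conjI allI ballI Ksub)
    fix t n x assume t: "t \<in> I" and x: "x \<in> K n"
    have t1: "t \<in> ideal_pow R I (Suc 0)" using t R.ideal_pow_1[OF I] by simp
    have "t \<odot>\<^bsub>M\<^esub> x \<in> (\<lambda>x. a \<odot>\<^bsub>M\<^esub> x) ` carrier M"
      by (rule submodule_smult[OF submodule_image_smult[OF carrier_is_submodule carr[OF a]] carr[OF t1]])
        (use x in \<open>simp add: K_def\<close>)
    moreover have "t \<odot>\<^bsub>M\<^esub> x \<in> ?P (Suc n)"
      using ideal_pow_module_mult[OF I t1, of x n] x by (simp add: K_def)
    ultimately show "t \<odot>\<^bsub>M\<^esub> x \<in> K (Suc n)" by (simp add: K_def)
  qed
  moreover have "K \<le> ?P" by (auto simp: K_def le_fun_def)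
  ultimately obtain k where k: "\<And>m. K (k + m) \<subseteq> ideal_smult R (ideal_pow R I m) M (K k)"
    using artin_rees[OF R M I] by blast
  have AR: "K (k + m) \<subseteq> (\<lambda>x. a \<odot>\<^bsub>M\<^esub> x) ` ?P m" for m
  proof -
    have "ideal_smult R (ideal_pow R I m) M (K k) \<subseteq> (\<lambda>x. a \<odot>\<^bsub>M\<^esub> x) ` ?P m"
    proof (rule ideal_smult_least[OF submodule_image_smult[OF Psub carr[OF a]]])
      fix r z assume r: "r \<in> ideal_pow R I m" and "z \<in> K k"
      then obtain x where x: "x \<in> carrier M" "z = a \<odot>\<^bsub>M\<^esub> x" by (auto simp: K_def)
      have "r \<odot>\<^bsub>M\<^esub> z = a \<odot>\<^bsub>M\<^esub> (r \<odot>\<^bsub>M\<^esub> x)"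
        using x carr[OF r] carr[OF a] by (simp add: R.m_comm flip: smult_assoc1)
      moreover have "r \<odot>\<^bsub>M\<^esub> x \<in> ?P m"
        unfolding ideal_pow_module_def by (rule ideal_smult_mem[OF r x(1)])
      ultimately show "r \<odot>\<^bsub>M\<^esub> z \<in> (\<lambda>x. a \<odot>\<^bsub>M\<^esub> x) ` ?P m" by blast
    qed
    then show ?thesis using k by blast
  qed
  have "\<exists>x'\<in>?P (n - c). a \<odot>\<^bsub>M\<^esub> x' = a \<odot>\<^bsub>M\<^esub> x"
    if n: "n \<ge> k + n0 + c" and x: "x \<in> carrier M" and ax: "a \<odot>\<^bsub>M\<^esub> x \<in> ?P n" for n x
  proof -
    have "a \<odot>\<^bsub>M\<^esub> x \<in> K (k + (n - k))" using n x ax by (simp add: K_def)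
    then obtain x' where x': "x' \<in> ?P (n - k)" "a \<odot>\<^bsub>M\<^esub> x' = a \<odot>\<^bsub>M\<^esub> x"
      using AR[of "n - k"] by (metis (no_types, lifting) imageE subsetD)
    have "x' \<in> ?P (n0 + j)" if "n0 + j + c \<le> n" for j
      using that
    proof (induct j)
      case 0
      have "n0 \<le> n - k" using n by simp
      then show ?case using x'(1) ideal_pow_module_antimono[OF I] by (metis add_0_right subsetD)
    next
      case (Suc j)
      then have "x' \<in> ?P (n0 + j)" by simp
      moreover have "Suc (c + (n0 + j)) \<le> n" using Suc.prems by simp
      then have "a \<odot>\<^bsub>M\<^esub> x' \<in> ?P (Suc (c + (n0 + j)))"
        using ax x'(2) ideal_pow_module_antimono[OF I, of "Suc (c + (n0 + j))" n] by auto
      ultimately show ?case using n0[of "n0 + j" x'] by simp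
    qed
    from this[of "n - c - n0"] have "x' \<in> ?P (n - c)" using n by simp
    then show ?thesis using x'(2) by blast
  qed
  then show ?thesis by blast
qed

lemma genideal_insert_smult:
  assumes "X \<subseteq> carrier R" "a \<in> carrier R" "z \<in> ideal_smult R (genideal R (insert a X)) M (carrier M)"
  shows "\<exists>u\<in>ideal_smult R (genideal R X) M (carrier M). \<exists>x\<in>carrier M. z = u \<oplus>\<^bsub>M\<^esub> a \<odot>\<^bsub>M\<^esub> x"
proof -
  let ?U = "ideal_smult R (genideal R X) M (carrier M)"
  let ?T = "{u \<oplus>\<^bsub>M\<^esub> v | u v. u \<in> ?U \<and> v \<in> (\<lambda>x. a \<odot>\<^bsub>M\<^esub> x) ` carrier M}"
  have "ideal (genideal R X) R" by (rule R.genideal_ideal[OF assms(1)])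
  then have U: "submodule ?U R M" by (intro ideal_smult_submodule) (auto dest: ideal.Icarr)
  have T: "submodule ?T R M"
    by (intro submodule_sum U submodule_image_smult carrier_is_submodule assms)
  have "genideal R (insert a X) \<subseteq> {r \<in> carrier R. \<forall>x\<in>carrier M. r \<odot>\<^bsub>M\<^esub> x \<in> ?T}"
  proof (rule R.genideal_minimal[OF ideal_transporter[OF T]])
    show "insert a X \<subseteq> {r \<in> carrier R. \<forall>x\<in>carrier M. r \<odot>\<^bsub>M\<^esub> x \<in> ?T}"
    proof
      fix r assume r: "r \<in> insert a X"
      have "r \<odot>\<^bsub>M\<^esub> x \<in> ?T" if x: "x \<in> carrier M" for x
      proof (cases "r = a")
        case True
        then have "r \<odot>\<^bsub>M\<^esub> x = \<zero>\<^bsub>M\<^esub> \<oplus>\<^bsub>M\<^esub> a \<odot>\<^bsub>M\<^esub> x" using x assms by simp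
        then show ?thesis using submodule_zero[OF U] x by blast
      next
        case False
        then have "r \<in> genideal R X" using r R.genideal_self[OF assms(1)] by auto
        then have "r \<odot>\<^bsub>M\<^esub> x \<in> ?U" by (rule ideal_smult_mem[OF _ x])
        moreover have "r \<odot>\<^bsub>M\<^esub> x = r \<odot>\<^bsub>M\<^esub> x \<oplus>\<^bsub>M\<^esub> a \<odot>\<^bsub>M\<^esub> \<zero>\<^bsub>M\<^esub>"
          using submodule_carrier[OF U calculation] assms by simp
        ultimately show ?thesis using M.zero_closed by blast
      qed
      then show "r \<in> {r \<in> carrier R. \<forall>x\<in>carrier M. r \<odot>\<^bsub>M\<^esub> x \<in> ?T}" using r assms by auto
    qed
  qed simp
  then have "ideal_smult R (genideal R (insert a X)) M (carrier M) \<subseteq> ?T"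
    by (intro ideal_smult_least[OF T]) blast
  then show ?thesis using assms(3) by blast
qed

section \<open>Modules of finite length over a local ring\<close>

lemma noetherian_module_maximal:
  assumes M: "noetherian_module R M" and \<F>: "\<F> \<noteq> {}" "\<And>W. W \<in> \<F> \<Longrightarrow> submodule W R M"
  shows "\<exists>W\<in>\<F>. \<forall>W'\<in>\<F>. W \<subseteq> W' \<longrightarrow> W' = W"
proof -
  let ?S = "{(W', W). W \<in> \<F> \<and> W' \<in> \<F> \<and> W \<subset> W'}"
  have "wf ?S"
    unfolding wf_iff_no_infinite_down_chain
  proof
    assume "\<exists>f. \<forall>i. (f (Suc i), f i) \<in> ?S"
    then obtain f where "\<forall>i. (f (Suc i), f i) \<in> ?S" ..
    then have f: "f i \<in> \<F>" "f i \<subset> f (Suc i)" for i by auto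

    have "\<exists>k0. \<forall>k\<ge>k0. f k = f k0"
      by (rule noetherian_moduleD[OF M]) (use f \<F>(2) in auto)
    then obtain k0 where "\<And>k. k \<ge> k0 \<Longrightarrow> f k = f k0" by blast
    from this[of "Suc k0"] f(2)[of k0] show False by simp
  qed
  then obtain W where W: "W \<in> \<F>" "\<And>W'. (W', W) \<in> ?S \<Longrightarrow> W' \<notin> \<F>"
    using \<F>(1) by (metis (no_types, lifting) wf_eq_minimal all_not_in_conv)
  then show ?thesis by (intro bexI[OF _ W(1)]) blast
qed

end

lemma local_ring_proper_ideal:
  assumes R: "noetherian_ring R" and loc: "local_ring R \<mm>" and J: "ideal J R" "J \<noteq> carrier R"
  shows "J \<subseteq> \<mm>"
proof -
  interpret cring R using loc by (simp add: local_ring_def)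
  interpret reg: module R "regular_module R" by (rule regular_module)
  let ?\<F> = "{K. ideal K R \<and> K \<noteq> carrier R \<and> J \<subseteq> K}"
  have "\<exists>K\<in>?\<F>. \<forall>K'\<in>?\<F>. K \<subseteq> K' \<longrightarrow> K' = K"
    by (rule reg.noetherian_module_maximal[OF regular_module_noetherian[OF R cring_axioms]])
      (use J in \<open>auto simp: regular_submodule_iff\<close>)
  then obtain K where "K \<in> ?\<F>" and max: "\<forall>K'\<in>?\<F>. K \<subseteq> K' \<longrightarrow> K' = K" by (rule bexE)
  then have K: "ideal K R" "K \<noteq> carrier R" "J \<subseteq> K" by simp_all
  have "maximalideal K R"
  proof (rule maximalidealI)
    fix K' assume "ideal K' R" "K \<subseteq> K'"
    then show "K' = K \<or> K' = carrier R" using max K(3) by blast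
  qed (use K in auto)
  then show ?thesis using loc K(3) by (auto simp: local_ring_def)
qed

lemma local_ring_one_minus_unit:
  fixes R (structure)
  assumes R: "noetherian_ring R" and loc: "local_ring R \<mm>" and J: "ideal J R" "J \<noteq> carrier R" and r: "r \<in> J"
  shows "\<exists>u\<in>carrier R. u \<otimes> (\<one> \<ominus> r) = \<one>"

proof -
  interpret cring R using loc by (simp add: local_ring_def)
  interpret m: maximalideal \<mm> R using loc by (simp add: local_ring_def)
  have rm: "r \<in> \<mm>" using local_ring_proper_ideal[OF R loc J] r by blast
  then have rR: "r \<in> carrier R" by (rule m.Icarr)
  have pid: "ideal (PIdl (\<one> \<ominus> r)) R" by (rule cgenideal_ideal) (use rR in simp)
  have "PIdl (\<one> \<ominus> r) = carrier R"
  proof (rule ccontr)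
    assume "PIdl (\<one> \<ominus> r) \<noteq> carrier R"
    then have "PIdl (\<one> \<ominus> r) \<subseteq> \<mm>" by (rule local_ring_proper_ideal[OF R loc pid])
    then have "\<one> \<ominus> r \<in> \<mm>" using cgenideal_self[of "\<one> \<ominus> r"] rR by auto
    then have "(\<one> \<ominus> r) \<oplus> r \<in> \<mm>" using rm by simp
    moreover have "(\<one> \<ominus> r) \<oplus> r = \<one>" using rR by (simp add: a_minus_def a_assoc l_neg)
    ultimately show False using m.one_imp_carrier m.I_notcarr by simp
  qed
  then have "\<one> \<in> PIdl (\<one> \<ominus> r)" by simp
  then show ?thesis by (auto simp: cgenideal_def intro: sym)

qed

context module
begin

text \<open>If \<open>N\<close> is not zero, let \<open>W\<close> be a maximal proper submodule and \<open>y \<in> N - W\<close>, so that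
  \<open>N = W + R y\<close>. Then \<open>N \<subseteq> I N \<subseteq> W + I y\<close> gives \<open>(1 - r) y \<in> W\<close> for some \<open>r \<in> I\<close>, and \<open>1 - r\<close> is a unit.\<close>

lemma nakayama:
  assumes R: "noetherian_ring R" and loc: "local_ring R \<mm>" and I: "ideal I R" "I \<noteq> carrier R"
    and M: "noetherian_module R M" and N: "submodule N R M" and le: "N \<subseteq> ideal_smult R I M N"
  shows "N = {\<zero>\<^bsub>M\<^esub>}"
proof (rule ccontr)
  assume ne: "N \<noteq> {\<zero>\<^bsub>M\<^esub>}"
  let ?\<F> = "{W. submodule W R M \<and> W \<subset> N}"
  have "{\<zero>\<^bsub>M\<^esub>} \<in> ?\<F>" using zero_submodule submodule_zero[OF N] ne by auto
  then have "?\<F> \<noteq> {}" by blast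
  from noetherian_module_maximal[OF M this] have "\<exists>W\<in>?\<F>. \<forall>W'\<in>?\<F>. W \<subseteq> W' \<longrightarrow> W' = W" by simp
  then obtain W where "W \<in> ?\<F>" and max: "\<forall>W'\<in>?\<F>. W \<subseteq> W' \<longrightarrow> W' = W" by (rule bexE)
  then have W: "submodule W R M" "W \<subset> N" by simp_all
  obtain y where y: "y \<in> N" "y \<notin> W" using W(2) by blast
  note Ncarr = submodule_carrier[OF N] and Wcarr = submodule_carrier[OF W(1)]
  have yM: "y \<in> carrier M" using y Ncarr by blast
  let ?C = "{w \<oplus>\<^bsub>M\<^esub> v | w v. w \<in> W \<and> v \<in> (\<lambda>r. r \<odot>\<^bsub>M\<^esub> y) ` carrier R}"
  have C: "submodule ?C R M"
    by (intro submodule_sum W submodule_image_ideal R.oneideal yM)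
  have C_N: "?C \<subseteq> N" using W(2) y(1) submodule_add[OF N] submodule_smult[OF N] by blast
  have W_C: "W \<subseteq> ?C"
  proof
    fix w assume w: "w \<in> W"
    then have "w = w \<oplus>\<^bsub>M\<^esub> \<zero> \<odot>\<^bsub>M\<^esub> y" using Wcarr yM by simp
    then show "w \<in> ?C" using w R.zero_closed by blast
  qed
  have y_C: "y \<in> ?C"
  proof -
    have "y = \<zero>\<^bsub>M\<^esub> \<oplus>\<^bsub>M\<^esub> \<one> \<odot>\<^bsub>M\<^esub> y" using yM by simp
    then show ?thesis using submodule_zero[OF W(1)] R.one_closed by blast
  qed
  have CN: "?C = N"
  proof (rule ccontr)
    assume "?C \<noteq> N"
    then have "?C \<in> ?\<F>" using C C_N by simp
    from bspec[OF max this] W_C have "?C = W" by simp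
    then show False using y_C y(2) by simp
  qed

  let ?T = "{w \<oplus>\<^bsub>M\<^esub> v | w v. w \<in> W \<and> v \<in> (\<lambda>r. r \<odot>\<^bsub>M\<^esub> y) ` I}"
  have T: "submodule ?T R M"
    by (intro submodule_sum W submodule_image_ideal I yM)
  have "ideal_smult R I M N \<subseteq> ?T"
  proof (rule ideal_smult_least[OF T])
    fix r x assume r: "r \<in> I" and "x \<in> N"
    then obtain w s where ws: "w \<in> W" "s \<in> carrier R" "x = w \<oplus>\<^bsub>M\<^esub> s \<odot>\<^bsub>M\<^esub> y" using CN by blast
    have rR: "r \<in> carrier R" using ideal.Icarr[OF I(1) r] .
    have "r \<odot>\<^bsub>M\<^esub> x = r \<odot>\<^bsub>M\<^esub> w \<oplus>\<^bsub>M\<^esub> (r \<otimes> s) \<odot>\<^bsub>M\<^esub> y"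
      using ws rR Wcarr yM by (simp add: smult_r_distr smult_assoc1)
    moreover have "r \<odot>\<^bsub>M\<^esub> w \<in> W" "r \<otimes> s \<in> I"
      using submodule_smult[OF W(1) rR ws(1)] ideal.I_r_closed[OF I(1) r ws(2)] .
    ultimately show "r \<odot>\<^bsub>M\<^esub> x \<in> ?T" by blast
  qed
  then obtain w r where wr: "w \<in> W" "r \<in> I" "y = w \<oplus>\<^bsub>M\<^esub> r \<odot>\<^bsub>M\<^esub> y" using le y(1) by blast
  have rR: "r \<in> carrier R" using ideal.Icarr[OF I(1) wr(2)] .
  obtain u where u: "u \<in> carrier R" "u \<otimes> (\<one> \<ominus> r) = \<one>"
    using local_ring_one_minus_unit[OF R loc I wr(2)] by blast
  have "(\<one> \<ominus> r) \<odot>\<^bsub>M\<^esub> y = y \<ominus>\<^bsub>M\<^esub> r \<odot>\<^bsub>M\<^esub> y"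
    using yM rR by (simp add: a_minus_def smult_l_distr smult_l_minus)
  also have "\<dots> = (w \<oplus>\<^bsub>M\<^esub> r \<odot>\<^bsub>M\<^esub> y) \<ominus>\<^bsub>M\<^esub> r \<odot>\<^bsub>M\<^esub> y" using wr(3) by simp
  also have "\<dots> = w" using wr(1) Wcarr yM rR by (simp add: a_minus_def M.a_assoc M.r_neg)
  finally have "u \<odot>\<^bsub>M\<^esub> w = y"
    using u yM rR by (metis R.minus_closed R.one_closed smult_assoc1 smult_one)
  then show False using submodule_smult[OF W(1) u(1) wr(1)] y(2) by simp
qed

text \<open>A bound on the length of chains forces \<open>I\<^sup>i\<^sup>+\<^sup>1 M = I\<^sup>i M\<close> for some \<open>i\<close>, and Nakayama's lemma
  applies to \<open>I\<^sup>i M\<close>.\<close>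

lemma finite_length_powers_vanish:
  assumes R: "noetherian_ring R" and loc: "local_ring R \<mm>" and I: "ideal I R" "I \<noteq> carrier R"
    and M: "noetherian_module R M" and fl: "finite_length R M"
  shows "\<exists>n0. \<forall>n\<ge>n0. ideal_pow_module R I M n = {\<zero>\<^bsub>M\<^esub>}"
proof -
  let ?P = "ideal_pow_module R I M"
  note Psub = ideal_pow_module_submodule[OF I(1)]
  note anti = ideal_pow_module_antimono[OF I(1)]
  obtain b where b: "\<And>n N. (\<forall>i\<le>n. submodule (N i) R M) \<Longrightarrow> (\<forall>i<n. N i \<subset> N (Suc i)) \<Longrightarrow> n \<le> b"
    using fl unfolding finite_length_def by blast
  have "\<exists>i. ?P (Suc i) = ?P i"
  proof (rule ccontr)
    assume "\<not> ?thesis"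
    then have "?P (Suc i) \<subset> ?P i" for i using anti[of i "Suc i"] by auto
    from this[of "b - _"] have "\<forall>i<Suc b. ?P (Suc b - i) \<subset> ?P (Suc b - Suc i)"
      by (metis Suc_diff_le diff_Suc_Suc less_Suc_eq_le)
    then have "Suc b \<le> b" using b[of "Suc b" "\<lambda>i. ?P (Suc b - i)"] Psub by blast
    then show False by simp
  qed
  then obtain i where i: "?P (Suc i) = ?P i" by blast
  have "?P (Suc i) \<subseteq> ideal_smult R I M (?P i)"
  proof -
    have Icarr: "I \<subseteq> carrier R" using ideal.Icarr[OF I(1)] by blast
    have sub: "submodule (ideal_smult R I M (?P i)) R M"
      by (rule ideal_smult_submodule[OF Icarr submoduleE(1)[OF Psub]])
    have "ideal_pow R I (Suc i) \<subseteq> {r \<in> carrier R. \<forall>x\<in>carrier M. r \<odot>\<^bsub>M\<^esub> x \<in> ideal_smult R I M (?P i)}" (is "_ \<subseteq> ?T")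
      unfolding R.ideal_pow_Suc
    proof (rule ideal_prod_subset[OF ideal_transporter[OF sub]])
      fix s t assume s: "s \<in> ideal_pow R I i" and t: "t \<in> I"
      have st: "s \<in> carrier R" "t \<in> carrier R" using s t Icarr R.ideal_pow_carrier[OF I(1)] by auto
      have "(s \<otimes> t) \<odot>\<^bsub>M\<^esub> x \<in> ideal_smult R I M (?P i)" if x: "x \<in> carrier M" for x
      proof -
        have "s \<odot>\<^bsub>M\<^esub> x \<in> ?P i" unfolding ideal_pow_module_def by (rule ideal_smult_mem[OF s x])
        then have "t \<odot>\<^bsub>M\<^esub> (s \<odot>\<^bsub>M\<^esub> x) \<in> ideal_smult R I M (?P i)" by (rule ideal_smult_mem[OF t])
        then show ?thesis using st x by (simp add: R.m_comm flip: smult_assoc1)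
      qed
      then show "s \<otimes> t \<in> ?T" using st by simp
    qed simp
    then have "ideal_smult R (ideal_pow R I (Suc i)) M (carrier M) \<subseteq> ideal_smult R I M (?P i)"
      by (intro ideal_smult_least[OF sub]) blast
    then show ?thesis by (simp only: ideal_pow_module_def)
  qed
  then have "?P i = {\<zero>\<^bsub>M\<^esub>}" using nakayama[OF R loc I M Psub, of i] i by simp
  then have "?P n = {\<zero>\<^bsub>M\<^esub>}" if "n \<ge> i" for n
    using anti[OF that] submodule_zero[OF Psub, of n] by auto
  then show ?thesis by blast
qed

section \<open>Expansion of large powers along a system of parameters\<close>

text \<open>Induction on the number of elements. Modulo \<open>U = (a\<^sub>1, \<dots>, a\<^sub>i) M\<close> the element \<open>z\<close> is a multiple
  of the next element \<open>b\<close>, hence \<open>z - b x' \<in> U\<close> for some \<open>x'\<close> in the expected power of \<open>I\<close>, and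
  \<open>z - b x'\<close> still lies in \<open>I\<^sup>n M\<close>.\<close>

lemma intersection_expansion:
  fixes t :: nat
  assumes R: "noetherian_ring R" and M: "noetherian_module R M" and I: "ideal I R"
    and a: "\<And>i. i \<in> {1..t} \<Longrightarrow> a i \<in> ideal_pow R I (c i)"
    and Ass: "\<And>i \<PP>. i \<in> {1..t} \<Longrightarrow> \<PP> \<in> Ass (form_ring R I)
        (form_module R I (quot_module M (ideal_smult R (genideal R (a ` {1..<i})) M (carrier M))))
        - V_set (form_ring R I) (form_ring_plus R I) \<Longrightarrow> form_elem R I (c i) (a i) \<notin> \<PP>"
    and "i \<le> t"
  shows "\<exists>n1. \<forall>n\<ge>n1. \<forall>z\<in>ideal_pow_module R I M n.
    z \<in> ideal_smult R (genideal R (a ` {1..i})) M (carrier M) \<longrightarrow>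
    (\<exists>y. (\<forall>j\<in>{1..i}. y j \<in> ideal_pow_module R I M (n - c j)) \<and> z = (\<Oplus>\<^bsub>M\<^esub>j\<in>{1..i}. a j \<odot>\<^bsub>M\<^esub> y j))"
  using assms(6)
proof (induct i)
  case 0
  have "genideal R {} \<subseteq> {\<zero>}" by (rule R.genideal_minimal[OF R.zeroideal]) simp
  then have "ideal_smult R (genideal R {}) M (carrier M) \<subseteq> {\<zero>\<^bsub>M\<^esub>}"
    by (intro ideal_smult_least[OF zero_submodule]) auto
  then show ?case by auto
next
  case (Suc i)
  let ?P = "ideal_pow_module R I M"
  let ?X = "a ` {1..i}"
  let ?U = "ideal_smult R (genideal R ?X) M (carrier M)"
  let ?Q = "quot_module M ?U"
  let ?a = "a (Suc i)" and ?c = "c (Suc i)"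
  note carr = R.ideal_pow_carrier[OF I] and Pcarr = ideal_pow_module_carrier[OF I]
  note Psub = ideal_pow_module_submodule[OF I]
  have aS: "?a \<in> ideal_pow R I ?c" using a Suc.prems by auto
  have X: "?X \<subseteq> carrier R"
  proof
    fix r assume "r \<in> ?X"
    then obtain j where "j \<in> {1..i}" "r = a j" by blast
    moreover from this have "j \<in> {1..t}" using Suc.prems by simp
    ultimately show
 "r \<in> carrier R" using carr[OF a] by simp
  qed

  have aR: "?a \<in> carrier R" using carr[OF aS] .
  have U: "submodule ?U R M"
    using ideal.Icarr[OF R.genideal_ideal[OF X]] by (intro ideal_smult_submodule) auto
  interpret Q: module R ?Q by (rule quot_is_module[OF U])
  have "{1..<Suc i} = {1..i}" by auto
  then have "non_nilpotent_kernel R I ?Q ?a ?c = {}"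
    using Q.Ass_condition_kernel_empty[OF I R aS] Ass[of "Suc i"] Suc.prems by simp
  then obtain n2 where n2: "\<And>n x. n \<ge> n2 \<Longrightarrow> x \<in> carrier ?Q \<Longrightarrow> ?a \<odot>\<^bsub>?Q\<^esub> x \<in> ideal_pow_module R I ?Q n \<Longrightarrow>
      \<exists>x'\<in>ideal_pow_module R I ?Q (n - ?c). ?a \<odot>\<^bsub>?Q\<^esub> x' = ?a \<odot>\<^bsub>?Q\<^esub> x"
    using Q.multiple_in_power[OF R quot_noetherian[OF U M] I aS] by blast
  obtain n1 where n1: "\<And>n z. n \<ge> n1 \<Longrightarrow> z \<in> ?P n \<Longrightarrow> z \<in> ?U \<Longrightarrow>
      \<exists>y. (\<forall>j\<in>{1..i}. y j \<in> ?P (n - c j)) \<and> z = (\<Oplus>\<^bsub>M\<^esub>j\<in>{1..i}. a j \<odot>\<^bsub>M\<^esub> y j)"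
    using Suc by auto
  have ins: "{1..Suc i} = insert (Suc i) {1..i}" by auto
  have "\<exists>y. (\<forall>j\<in>{1..Suc i}. y j \<in> ?P (n - c j)) \<and> z = (\<Oplus>\<^bsub>M\<^esub>j\<in>{1..Suc i}. a j \<odot>\<^bsub>M\<^esub> y j)"
    if n: "n \<ge> n1 + n2 + ?c" and z: "z \<in> ?P n"
      and zU: "z \<in> ideal_smult R (genideal R (a ` {1..Suc i})) M (carrier M)" for n z
  proof -
    obtain u x where ux: "u \<in> ?U" "x \<in> carrier M" "z = u \<oplus>\<^bsub>M\<^esub> ?a \<odot>\<^bsub>M\<^esub> x"
      using genideal_insert_smult[OF X aR zU[unfolded ins image_insert]] by blast

    have zM: "z \<in> carrier M" and uM: "u \<in> carrier M" using Pcarr[OF z] submodule_carrier[OF U ux(1)] .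
    have "z \<ominus>\<^bsub>M\<^esub> ?a \<odot>\<^bsub>M\<^esub> x = u" using ux aR uM by (simp add: a_minus_def M.a_assoc M.r_neg)
    then have zx: "?U +>\<^bsub>M\<^esub> z = ?U +>\<^bsub>M\<^esub> (?a \<odot>\<^bsub>M\<^esub> x)"
      using coset_eq_iff[OF U zM smult_closed[OF aR ux(2)]] ux(1) by simp
    have "?a \<odot>\<^bsub>?Q\<^esub> (?U +>\<^bsub>M\<^esub> x) = ?U +>\<^bsub>M\<^esub> z"
      using coset_smult[OF U aR ux(2)] zx by simp
    moreover have "?U +>\<^bsub>M\<^esub> z \<in> ideal_pow_module R I ?Q n"
      unfolding quot_ideal_pow_module[OF U I] using z by blast
    moreover have "?U +>\<^bsub>M\<^esub> x \<in> carrier ?Q" using ux(2) by (rule coset_in_quot)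
    ultimately obtain X' where X': "X' \<in> ideal_pow_module R I ?Q (n - ?c)" "?a \<odot>\<^bsub>?Q\<^esub> X' = ?U +>\<^bsub>M\<^esub> z"
      using n2[of n "?U +>\<^bsub>M\<^esub> x"] n by auto
    then obtain x' where x': "x' \<in> ?P (n - ?c)" "X' = ?U +>\<^bsub>M\<^esub> x'"
      unfolding quot_ideal_pow_module[OF U I] by blast
    have x'M: "x' \<in> carrier M" using Pcarr[OF x'(1)] .
    have "?U +>\<^bsub>M\<^esub> z = ?U +>\<^bsub>M\<^esub> (?a \<odot>\<^bsub>M\<^esub> x')"
      using X'(2) x'(2) coset_smult[OF U aR x'M] by simp
    then have "z \<ominus>\<^bsub>M\<^esub> ?a \<odot>\<^bsub>M\<^esub> x' \<in> ?U"
      using coset_eq_iff[OF U zM smult_closed[OF aR x'M]] by blast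
    moreover have "?a \<odot>\<^bsub>M\<^esub> x' \<in> ?P n"
      by (rule ideal_pow_module_mult'[OF I aS x'(1)]) (use n in simp)
    then have "z \<ominus>\<^bsub>M\<^esub> ?a \<odot>\<^bsub>M\<^esub> x' \<in> ?P n" using submodule_minus[OF Psub z] by blast
    ultimately obtain y where y: "\<And>j. j \<in> {1..i} \<Longrightarrow> y j \<in> ?P (n - c j)"
      "z \<ominus>\<^bsub>M\<^esub> ?a \<odot>\<^bsub>M\<^esub> x' = (\<Oplus>\<^bsub>M\<^esub>j\<in>{1..i}. a j \<odot>\<^bsub>M\<^esub> y j)"
      using n1[of n "z \<ominus>\<^bsub>M\<^esub> ?a \<odot>\<^bsub>M\<^esub> x'"] n by (meson add_leD1)

    let ?y = "y(Suc i := x')"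
    have ay: "a j \<odot>\<^bsub>M\<^esub> y j \<in> carrier M" if "j \<in> {1..i}" for j
      using that X Pcarr[OF y(1)[OF that]] by (intro smult_closed) auto

    have "(\<Oplus>\<^bsub>M\<^esub>j\<in>{1..Suc i}. a j \<odot>\<^bsub>M\<^esub> ?y j) = ?a \<odot>\<^bsub>M\<^esub> x' \<oplus>\<^bsub>M\<^esub> (\<Oplus>\<^bsub>M\<^esub>j\<in>{1..i}. a j \<odot>\<^bsub>M\<^esub> ?y j)"
      unfolding ins by (subst M.finsum_insert) (use ay aR x'M in \<open>auto simp: Pi_def\<close>)
    also have "(\<Oplus>\<^bsub>M\<^esub>j\<in>{1..i}. a j \<odot>\<^bsub>M\<^esub> ?y j) = (\<Oplus>\<^bsub>M\<^esub>j\<in>{1..i}. a j \<odot>\<^bsub>M\<^esub> y j)"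
      by (rule M.finsum_cong') (use ay in auto)
    also have "?a \<odot>\<^bsub>M\<^esub> x' \<oplus>\<^bsub>M\<^esub> \<dots> = z"
      unfolding y(2)[symmetric] using minus_add_cancel[OF zM] x'M aR zM by (simp add: M.a_comm)
    finally have "z = (\<Oplus>\<^bsub>M\<^esub>j\<in>{1..Suc i}. a j \<odot>\<^bsub>M\<^esub> ?y j)" ..
    moreover have "\<forall>j\<in>{1..Suc i}. ?y j \<in> ?P (n - c j)" using y(1) x'(1) by (auto simp: le_Suc_eq)
    ultimately show ?thesis by blast
  qed
  then show ?case by blast
qed

text \<open>Expand \<open>z\<close> repeatedly into terms \<open>a\<^sup>\<alpha> x\<close> with monomials in the \<open>a\<^sub>j\<close>. While all exponents
  \<open>\<alpha>\<^sub>j\<close> are below \<open>k\<close>, the coefficient \<open>x\<close> lies in \<open>I\<^sup>N M\<close> for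
  \<open>N = n + \<Sum>\<^sub>j (k - \<alpha>\<^sub>j) c\<^sub>j \<ge> n\<^sub>1\<close>, and \<open>x\<close> can be expanded once more. When an exponent
  reaches \<open>k\<close>, the term is a multiple of \<open>a\<^sub>i\<^sup>k\<close> of the required kind. Writing degrees with
  \<open>k - \<alpha>\<^sub>j\<close> avoids a subtraction in the total degree.\<close>

lemma power_expansion:
  fixes J :: "'i set"
  assumes I
: "ideal I R" and J: "finite J"
    and a: "\<And>j. j \<in> J \<Longrightarrow> a j \<in> ideal_pow R I (c j)"
    and base: "\<And>n z. n \<ge> n1 \<Longrightarrow> z \<in> ideal_pow_module R I M n \<Longrightarrow>
      \<exists>y. (\<forall>j\<in>J. y j \<in> ideal_pow_module R I M (n - c j)) \<and> z = (\<Oplus>\<^bsub>M\<^esub>j\<in>J. a j \<odot>\<^bsub>M\<^esub> y j)"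
    and n: "n \<ge> n1" and z: "z \<in> ideal_pow_module R I M (n + k * (\<Sum>j\<in>J. c j))"
  shows "\<exists>y. (\<forall>i\<in>J. y i \<in> ideal_pow_module R I M (n + k * (\<Sum>j\<in>J - {i}. c j))) \<and>
    z = (\<Oplus>\<^bsub>M\<^esub>i\<in>J. (a i [^] k) \<odot>\<^bsub>M\<^esub> y i)"
proof -
  let ?P = "ideal_pow_module R I M"
  let ?e = "\<lambda>i. n + k * (\<Sum>j\<in>J - {i}. c j)"
  note carr = R.ideal_pow_carrier[OF I] and Pcarr = ideal_pow_module_carrier[OF I]
  note Psub = ideal_pow_module_submodule[OF I]
  have aR: "a j \<in> carrier R" if "j \<in> J" for j using carr[OF a[OF that]] .
  define S where "S = {\<Oplus>\<^bsub>M\<^esub>i\<in>J. (a i [^] k) \<odot>\<^bsub>M\<^esub> y i | y. \<forall>i\<in>J. y i \<in> ?P (?e i)}"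
  have S_mem: "(\<Oplus>\<^bsub>M\<^esub>i\<in>J. (a i [^] k) \<odot>\<^bsub>M\<^esub> y i) \<in> S" if "\<And>i. i \<in> J \<Longrightarrow> y i \<in> ?P (?e i)" for y
    unfolding S_def using that by blast
  have S_zero: "\<zero>\<^bsub>M\<^esub> \<in> S"
  proof -
    have "(\<Oplus>\<^bsub>M\<^esub>i\<in>J. (a i [^] k) \<odot>\<^bsub>M\<^esub> \<zero>\<^bsub>M\<^esub>) = (\<Oplus>\<^bsub>M\<^esub>i\<in>J. \<zero>\<^bsub>M\<^esub>)"
      by (rule M.finsum_cong') (use aR in auto)
    then show ?thesis using S_mem[of "\<lambda>_. \<zero>\<^bsub>M\<^esub>"] submodule_zero[OF Psub] by simp
  qed
  have S_add: "u \<oplus>\<^bsub>M\<^esub> v \<in> S" if u: "u \<in> S" and v: "v \<in> S" for u v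
  proof -
    obtain y y' where y: "\<forall>i\<in>J. y i \<in> ?P (?e i)" "u = (\<Oplus>\<^bsub>M\<^esub>i\<in>J. (a i [^] k) \<odot>\<^bsub>M\<^esub> y i)"
      and y': "\<forall>i\<in>J. y' i \<in> ?P (?e i)" "v = (\<Oplus>\<^bsub>M\<^esub>i\<in>J. (a i [^] k) \<odot>\<^bsub>M\<^esub> y' i)"
      using u v unfolding S_def by blast
    have yM
: "y i \<in> carrier M" "y' i \<in> carrier M" if "i \<in> J" for i
      using Pcarr y(1) y'(1) that by blast+
    have "u \<oplus>\<^bsub>M\<^esub> v = (\<Oplus>\<^bsub>M\<^esub>i\<in>J. (a i [^] k) \<odot>\<^bsub>M\<^esub> y i \<oplus>\<^bsub>M\<^esub> (a i [^] k) \<odot>\<^bsub>M\<^esub> y' i)"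
      unfolding y(2) y'(2) by (rule M.finsum_addf[symmetric]) (use aR yM in auto)
    also have "\<dots> = (\<Oplus>\<^bsub>M\<^esub>i\<in>J. (a i [^] k) \<odot>\<^bsub>M\<^esub> (y i \<oplus>\<^bsub>M\<^esub> y' i))"
      by (rule M.finsum_cong') (use aR yM in \<open>auto simp: smult_r_distr\<close>)
    finally show ?thesis
      using S_mem[of "\<lambda>i. y i \<oplus>\<^bsub>M\<^esub> y' i"] y(1) y'(1) submodule_add[OF Psub] by simp
  qed
  have S_sum: "(\<Oplus>\<^bsub>M\<^esub>i\<in>J'. f i) \<in> S" if "finite J'" "\<And>i. i \<in> J' \<Longrightarrow> f i \<in> S" for f and J' :: "'i set"
    using that
  proof (induct J' rule: finite_induct)
    case (insert i J')
    have SM: "S \<subseteq> carrier M" unfolding S_def using aR Pcarr by (auto intro!: M.finsum_closed)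
    then have "f \<in> J' \<rightarrow> carrier M" "f i \<in> carrier M" using insert.prems by auto
    then show ?case using insert S_add by simp
  qed (simp add: S_zero)
  have "(\<Otimes>j\<in>J. a j [^] \<alpha> j) \<odot>\<^bsub>M\<^esub> x \<in> S"
    if "\<And>j. j \<in> J \<Longrightarrow> \<alpha> j \<le> k" "x \<in> ?P (n + (\<Sum>j\<in>J. (k - \<alpha> j) * c j))" for \<alpha> x
    using that
  proof (induct "\<Sum>j\<in>J. k - \<alpha> j" arbitrary: \<alpha> x rule: less_induct)
    case (less \<alpha> x)
    have apow: "a j [^] \<alpha> j \<in> ideal_pow R I (\<alpha> j * c j)" if "j \<in> J" for j
      by (rule R.ideal_pow_nat_pow[OF I a[OF that]])
    have xM: "x \<in> carrier M" using Pcarr[OF less.prems(2)] .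
    show ?case
    proof (cases "\<exists>i\<in>J. \<alpha> i = k")
      case True
      then obtain i where i: "i \<in> J" "\<alpha> i = k" by blast
      let ?w = "\<Otimes>j\<in>J - {i}. a j [^] \<alpha> j"
      have w: "?w \<in> ideal_pow R I (\<Sum>j\<in>J - {i}. \<alpha> j * c j)"
        by (rule R.ideal_pow_finprod[OF I]) (use J apow in auto)
      have "(\<Otimes>j\<in>J. a j [^] \<alpha> j) = (\<Otimes>j\<in>insert i (J - {i}). a j [^] \<alpha> j)"
        using i(1) by (simp add: insert_absorb)
      also have "\<dots> = a i [^] k \<otimes> ?w"
        using J aR i by (subst R.finprod_insert) auto
      finally have prod: "(\<Otimes>j\<in>J. a j [^] \<alpha> j) \<odot>\<^bsub>M\<^esub> x = a i [^] k \<odot>\<^bsub>M\<^esub> (?w \<odot>\<^bsub>M\<^esub> x)"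
        using xM carr[OF w] aR[OF i(1)] by (simp add: smult_assoc1)
      have "(\<Sum>j\<in>J. (k - \<alpha> j) * c j) = (\<Sum>j\<in>J - {i}. (k - \<alpha> j) * c j)"
        using i J by (simp add: sum.remove)
      moreover have "(\<Sum>j\<in>J - {i}. \<alpha> j * c j) + (\<Sum>j\<in>J - {i}. (k - \<alpha> j) * c j) = k * (\<Sum>j\<in>J - {i}. c j)"
        unfolding sum.distrib[symmetric] sum_distrib_left
        by (rule sum.cong) (use less.prems(1) in \<open>auto simp flip: add_mult_distrib\<close>)
      ultimately have deg: "(\<Sum>j\<in>J - {i}. \<alpha> j * c j) + (n + (\<Sum>j\<in>J. (k - \<alpha> j) * c j)) = ?e i" by simp
      have wx: "?w \<odot>\<^bsub>M\<^esub> x \<in> ?P (?e i)"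
        unfolding deg[symmetric] by (rule ideal_pow_module_mult[OF I w less.prems(2)])

      let ?y = "\<lambda>j. if i = j then ?w \<odot>\<^bsub>M\<^esub> x else \<zero>\<^bsub>M\<^esub>"
      let ?g = "\<lambda>j. a j [^] k \<odot>\<^bsub>M\<^esub> (?w \<odot>\<^bsub>M\<^esub> x)"
      have g: "?g \<in> J \<rightarrow> carrier M" using aR carr[OF w] xM by auto
      have "(\<Oplus>\<^bsub>M\<^esub>j\<in>J. a j [^] k \<odot>\<^bsub>M\<^esub> ?y j) = (\<Oplus>\<^bsub>M\<^esub>j\<in>J. if i = j then ?g j else \<zero>\<^bsub>M\<^esub>)"
        by (rule M.finsum_cong') (use g aR in auto)
      also have "\<dots> = a i [^] k \<odot>\<^bsub>M\<^esub> (?w \<odot>\<^bsub>M\<^esub> x)"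
        by (rule M.add.finprod_singleton[OF i(1) J g])
      finally have eq: "(\<Oplus>\<^bsub>M\<^esub>j\<in>J. a j [^] k \<odot>\<^bsub>M\<^esub> ?y j) = a i [^] k \<odot>\<^bsub>M\<^esub> (?w \<odot>\<^bsub>M\<^esub> x)" .
      show ?thesis
        unfolding prod eq[symmetric] by (rule S_mem) (use wx submodule_zero[OF Psub] in auto)

    next
      case False
      then have lt: "\<alpha> j < k" if "j \<in> J" for j using less.prems(1)[OF that] that by (auto simp: le_less)
      let ?N = "n + (\<Sum>j\<in>J. (k - \<alpha> j) * c j)"
      let ?w = "\<Otimes>j\<in>J. a j [^] \<alpha> j"
      have wR: "?w \<in> carrier R" using aR by (intro R.finprod_closed) auto
      have "?N \<ge> n1" using n by simp
      from base[OF this less.prems(2)] obtain y where y: "\<And>j. j \<in> J \<Longrightarrow> y j \<in> ?P (?N - c j)"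
        "x = (\<Oplus>\<^bsub>M\<^esub>j\<in>J. a j \<odot>\<^bsub>M\<^esub> y j)" by blast
      have yM: "y j \<in> carrier M" if "j \<in> J" for j using Pcarr[OF y(1)[OF that]] .
      have "?w \<odot>\<^bsub>M\<^esub> x = (\<Oplus>\<^bsub>M\<^esub>j\<in>J. ?w \<odot>\<^bsub>M\<^esub> (a j \<odot>\<^bsub>M\<^esub> y j))"
        unfolding y(2) by (rule finsum_smult_ldistr[OF J wR]) (use aR yM in auto)
      moreover have "?w \<odot>\<^bsub>M\<^esub> (a i \<odot>\<^bsub>M\<^esub> y i) \<in> S" if i: "i \<in> J" for i
      proof -
        let ?\<beta> = "\<alpha>(i := Suc (\<alpha> i))"
        have Ji: "J = insert i (J - {i})" using i by blast
        have other: "(\<Otimes>j\<in>J - {i}. a j [^] ?\<beta> j) = (\<Otimes>j\<in>J - {i}. a j [^] \<alpha> j)"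
          by (rule R.finprod_cong') (use aR in auto)
        let ?v = "\<Otimes>j\<in>J - {i}. a j [^] \<alpha> j"
        have vR: "?v \<in> carrier R" using aR by (intro R.finprod_closed) auto
        have "(\<Otimes>j\<in>J. a j [^] ?\<beta> j) = (\<Otimes>j\<in>insert i (J - {i}). a j [^] ?\<beta> j)" using Ji by simp
        also have "\<dots> = a i [^] Suc (\<alpha> i) \<otimes> (\<Otimes>j\<in>J - {i}. a j [^] ?\<beta> j)"
          using J aR i by (subst R.finprod_insert) auto
        finally have \<beta>: "(\<Otimes>j\<in>J. a j [^] ?\<beta> j) = a i [^] Suc (\<alpha> i) \<otimes> ?v" using other by simp
        have "?w = (\<Otimes>j\<in>insert i (J - {i}). a j [^] \<alpha> j)" using Ji by simp
        also have "\<dots> = a i [^] \<alpha> i \<otimes> ?v" using J aR i by (subst R.finprod_insert) auto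
        finally have "?w \<otimes> a i = (\<Otimes>j\<in>J. a j [^] ?\<beta> j)"
          using aR[OF i] vR \<beta> by (simp add: nat_pow_Suc R.m_ac)
        then have eq: "?w \<odot>\<^bsub>M\<^esub> (a i \<odot>\<^bsub>M\<^esub> y i) = (\<Otimes>j\<in>J. a j [^] ?\<beta> j) \<odot>\<^bsub>M\<^esub> y i"
          using wR aR[OF i] yM[OF i] by (simp flip: smult_assoc1)
        have rem: "(\<Sum>j\<in>J. f j) = f i + (\<Sum>j\<in>J - {i}. f j)" for f :: "'i \<Rightarrow> nat"
          by (rule sum.remove[OF J i])
        have deg: "(\<Sum>j\<in>J - {i}. (k - ?\<beta> j) * c j) = (\<Sum>j\<in>J - {i}. (k - \<alpha> j) * c j)"
          by (rule sum.cong) auto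
        have ki: "k - \<alpha> i = Suc (k - Suc (\<alpha> i))" using lt[OF i] by simp
        have "?N - c i = n + (\<Sum>j\<in>J. (k - ?\<beta> j) * c j)"
          unfolding rem deg ki by simp
        moreover have "(\<Sum>j\<in>J. k - ?\<beta> j) < (\<Sum>j\<in>J. k - \<alpha> j)"
          by (rule sum_strict_mono_ex1[OF J]) (use i lt[OF i] in auto)

        ultimately show ?thesis
          unfolding eq using less.hyps[of ?\<beta> "y i"] lt less.prems(1) y(1)[OF i] i by (auto simp: Suc_le_eq)
      qed
      ultimately show ?thesis using S_sum[OF J] by simp
    qed
  qed
  from this[of "\<lambda>_. 0" z] have "(\<Otimes>j\<in>J. a j [^] (0::nat)) \<odot>\<^bsub>M\<^esub> z \<in> S"
    using z by (simp add: sum_distrib_left)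
  moreover have "(\<Otimes>j\<in>J. a j [^] (0::nat)) = \<one>" by simp
  ultimately have "z \<in> S" using Pcarr[OF z] by simp
  then show ?thesis unfolding S_def by blast
qed

end

section \<open>Localization at an element\<close>

context module
begin

context
  fixes x assumes x: "x \<in> carrier R"
begin

lemma pow_smult_add: "m \<in> carrier M \<Longrightarrow> x [^] (i::nat) \<odot>\<^bsub>M\<^esub> (x [^] (j::nat) \<odot>\<^bsub>M\<^esub> m) = x [^] (i + j) \<odot>\<^bsub>M\<^esub> m"
  using x by (simp add: R.nat_pow_mult flip: smult_assoc1)

lemma pow_smult_closed [simp]: "m \<in> carrier M \<Longrightarrow> x [^] (i::nat) \<odot>\<^bsub>M\<^esub> m \<in> carrier M"
  using x by simp

lemma frac_iff: "(u, j) \<in> frac R M x m k \<longleftrightarrow>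
    u \<in> carrier M \<and> (\<exists>l. x [^] (l + j) \<odot>\<^bsub>M\<^esub> m = x [^] (l + k) \<odot>\<^bsub>M\<^esub> u)"
  by (simp add: frac_def)

lemma frac_self: "m \<in> carrier M \<Longrightarrow> (m, k) \<in> frac R M x m k"
  by (auto simp: frac_iff)

lemma frac_subset:
  assumes m: "m \<in> carrier M" and m': "m' \<in> carrier M"
    and eq: "x [^] (l + k') \<odot>\<^bsub>M\<^esub> m = x [^] (l + k) \<odot>\<^bsub>M\<^esub> m'"
  shows "frac R M x m k \<subseteq> frac R M x m' k'"
proof (rule subrelI)
  fix u j assume "(u, j) \<in> frac R M x m k"
  then obtain p where u: "u \<in> carrier M" and p: "x [^] (p + j) \<odot>\<^bsub>M\<^esub> m = x [^] (p + k) \<odot>\<^bsub>M\<^esub> u"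
    by (auto simp: frac_iff)
  have "x [^] ((l + k + p) + j) \<odot>\<^bsub>M\<^esub> m' = x [^] (p + j) \<odot>\<^bsub>M\<^esub> (x [^] (l + k) \<odot>\<^bsub>M\<^esub> m')"
    using m' by (simp add: pow_smult_add ac_simps)
  also have "\<dots> = x [^] (l + k') \<odot>\<^bsub>M\<^esub> (x [^] (p + j) \<odot>\<^bsub>M\<^esub> m)"
    unfolding eq[symmetric] using m by (simp add: pow_smult_add ac_simps)
  also have "\<dots> = x [^] ((l + k + p) + k') \<odot>\<^bsub>M\<^esub> u"
    unfolding p using u by (simp add: pow_smult_add ac_simps)
  finally show "(u, j) \<in> frac R M x m' k'" using u by (auto simp: frac_iff)
qed

lemma frac_eq_iff:
  assumes m: "m \<in> carrier M" and m': "m' \<in> carrier M"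
  shows "frac R M x m k = frac R M x m' k' \<longleftrightarrow> (\<exists>l. x [^] (l + k') \<odot>\<^bsub>M\<^esub> m = x [^] (l + k) \<odot>\<^bsub>M\<^esub> m')"
proof
  assume "frac R M x m k = frac R M x m' k'"
  then have "(m', k') \<in> frac R M x m k" using frac_self[OF m'] by simp
  then show "\<exists>l. x [^] (l + k') \<odot>\<^bsub>M\<^esub> m = x [^] (l + k) \<odot>\<^bsub>M\<^esub> m'" by (simp add: frac_iff)
next
  assume "\<exists>l. x [^] (l + k') \<odot>\<^bsub>M\<^esub> m = x [^] (l + k) \<odot>\<^bsub>M\<^esub> m'"
  then obtain l where l: "x [^] (l + k') \<odot>\<^bsub>M\<^esub> m = x [^] (l + k) \<odot>\<^bsub>M\<^esub> m'" by blast
  show "frac R M x m k = frac R M x m' k'"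
    using frac_subset[OF m m' l] frac_subset[OF m' m l[symmetric]] by blast
qed

lemma frac_mem_eq:
  assumes "m \<in> carrier M" "(u, j) \<in> frac R M x m k"
  shows "u \<in> carrier M" "frac R M x u j = frac R M x m k"
proof -
  show u: "u \<in> carrier M" using assms by (simp add: frac_iff)
  have "\<exists>l. x [^] (l + j) \<odot>\<^bsub>M\<^esub> m = x [^] (l + k) \<odot>\<^bsub>M\<^esub> u" using assms by (simp add: frac_iff)
  then have "frac R M x m k = frac R M x u j" unfolding frac_eq_iff[OF assms(1) u] .
  then show "frac R M x u j = frac R M x m k" by simp

qed

lemma frac_expand:
  assumes m: "m \<in> carrier M" shows "frac R M x (x [^] j \<odot>\<^bsub>M\<^esub> m) (k + j) = frac R M x m k"
proof -
  have "x [^] (0 + k) \<odot>\<^bsub>M\<^esub> (x [^] j \<odot>\<^bsub>M\<^esub> m) = x [^] (0 + (k + j)) \<odot>\<^bsub>M\<^esub> m"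
    using m by (simp add: pow_smult_add)
  then show ?thesis using m by (subst frac_eq_iff) (auto intro!: exI[of _ 0])
qed

text \<open>The operations on fractions are unions over representatives; they are evaluated by showing
  that each representative contributes the same fraction.\<close>

lemma frac_union:
  assumes m: "m \<in> carrier M"
    and eq: "\<And>u j. u \<in> carrier M \<Longrightarrow> frac R M x u j = frac R M x m k \<Longrightarrow> h u j = h m k"
  shows "(\<Union>(u, j)\<in>frac R M x m k. h u j) = h m k"
proof -
  have "h u j = h m k" if "(u, j) \<in> frac R M x m k" for u j
    using eq frac_mem_eq[OF m that] by blast
  then have "(\<Union>(u, j)\<in>frac R M x m k. h u j) = (\<Union>z\<in>frac R M x m k. h m k)"
    by (intro SUP_cong) auto
  also have "\<dots> = h m k" using frac_self[OF m, of k] by blast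
  finally show ?thesis .

qed

lemma loc_sel:
  "carrier (loc_module R M x) = {frac R M x m k | m k. m \<in> carrier M}"
  "\<zero>\<^bsub>loc_module R M x\<^esub> = frac R M x \<zero>\<^bsub>M\<^esub> 0"
  by (simp_all add: loc_module_def)

lemma frac_in_loc [intro, simp]: "m \<in> carrier M \<Longrightarrow> frac R M x m k \<in> carrier (loc_module R M x)"
  by (auto simp: loc_sel)

lemma loc_carrierE:
  assumes "U \<in> carrier (loc_module R M x)"
  obtains m k where "m \<in> carrier M" "U = frac R M x m k"
  using assms by (auto simp: loc_sel)

lemma frac_zero: "frac R M x \<zero>\<^bsub>M\<^esub> k = \<zero>\<^bsub>loc_module R M x\<^esub>"
  using frac_expand[of "\<zero>\<^bsub>M\<^esub>" k 0] x by (simp add: loc_sel)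

lemma frac_sum_cong:
  assumes m: "m \<in> carrier M" and m': "m' \<in> carrier M" and u: "u \<in> carrier M" and v: "v \<in> carrier M"
    and mu: "frac R M x u j = frac R M x m k" and mv: "frac R M x v j' = frac R M x m' k'"
  shows "frac R M x (x [^] j' \<odot>\<^bsub>M\<^esub> u \<oplus>\<^bsub>M\<^esub> x [^] j \<odot>\<^bsub>M\<^esub> v) (j + j')
    = frac R M x (x [^] k' \<odot>\<^bsub>M\<^esub> m \<oplus>\<^bsub>M\<^esub> x [^] k \<odot>\<^bsub>M\<^esub> m') (k + k')"
proof -
  obtain l where l: "x [^] (l + k) \<odot>\<^bsub>M\<^esub> u = x [^] (l + j) \<odot>\<^bsub>M\<^esub> m"
    using mu frac_eq_iff[OF u m] by blast
  obtain p where p: "x [^] (p + k') \<odot>\<^bsub>M\<^esub> v = x [^] (p + j') \<odot>\<^bsub>M\<^esub> m'"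
    using mv frac_eq_iff[OF v m'] by blast
  have 1: "x [^] ((l + p) + (k + k')) \<odot>\<^bsub>M\<^esub> (x [^] j' \<odot>\<^bsub>M\<^esub> u)
      = x [^] ((l + p) + (j + j')) \<odot>\<^bsub>M\<^esub> (x [^] k' \<odot>\<^bsub>M\<^esub> m)"
  proof -
    have "x [^] ((l + p) + (k + k')) \<odot>\<^bsub>M\<^esub> (x [^] j' \<odot>\<^bsub>M\<^esub> u) = x [^] (p + k' + j') \<odot>\<^bsub>M\<^esub> (x [^] (l + k) \<odot>\<^bsub>M\<^esub> u)"
      using u by (simp add: pow_smult_add ac_simps)
    also have "\<dots> = x [^] ((l + p) + (j + j')) \<odot>\<^bsub>M\<^esub> (x [^] k' \<odot>\<^bsub>M\<^esub> m)"
      unfolding l using m by (simp add: pow_smult_add ac_simps)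
    finally show ?thesis .
  qed
  have 2: "x [^] ((l + p) + (k + k')) \<odot>\<^bsub>M\<^esub> (x [^] j \<odot>\<^bsub>M\<^esub> v)
      = x [^] ((l + p) + (j + j')) \<odot>\<^bsub>M\<^esub> (x [^] k \<odot>\<^bsub>M\<^esub> m')"
  proof -
    have "x [^] ((l + p) + (k + k')) \<odot>\<^bsub>M\<^esub> (x [^] j \<odot>\<^bsub>M\<^esub> v) = x [^] (l + k + j) \<odot>\<^bsub>M\<^esub> (x [^] (p + k') \<odot>\<^bsub>M\<^esub> v)"
      using v by (simp add: pow_smult_add ac_simps)
    also have "\<dots> = x [^] ((l + p) + (j + j')) \<odot>\<^bsub>M\<^esub> (x [^] k \<odot>\<^bsub>M\<^esub> m')"
      unfolding p using m' by (simp add: pow_smult_add ac_simps)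
    finally show ?thesis .
  qed
  have "x [^] ((l + p) + (k + k')) \<odot>\<^bsub>M\<^esub> (x [^] j' \<odot>\<^bsub>M\<^esub> u \<oplus>\<^bsub>M\<^esub> x [^] j \<odot>\<^bsub>M\<^esub> v)
      = x [^] ((l + p) + (j + j')) \<odot>\<^bsub>M\<^esub> (x [^] k' \<odot>\<^bsub>M\<^esub> m \<oplus>\<^bsub>M\<^esub> x [^] k \<odot>\<^bsub>M\<^esub> m')"
    using x m m' u v 1 2 by (simp add: smult_r_distr)
  then show ?thesis using m m' u v by (subst frac_eq_iff) auto
qed

lemma frac_add:
  assumes m: "m \<in> carrier M" and m': "m' \<in> carrier M"
  shows "frac R M x m k \<oplus>\<^bsub>loc_module R M x\<^esub> frac R M x m' k'
    = frac R M x (x [^] k' \<odot>\<^bsub>M\<^esub> m \<oplus>\<^bsub>M\<^esub> x [^] k \<odot>\<^bsub>M\<^esub> m') (k + k')"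
proof -
  have inner: "(\<Union>(v, j')\<in>frac R M x m' k'. frac R M x (x [^] j' \<odot>\<^bsub>M\<^esub> u \<oplus>\<^bsub>M\<^esub> x [^] j \<odot>\<^bsub>M\<^esub> v) (j + j'))
      = frac R M x (x [^] k' \<odot>\<^bsub>M\<^esub> u \<oplus>\<^bsub>M\<^esub> x [^] j \<odot>\<^bsub>M\<^esub> m') (j + k')"
    if "u \<in> carrier M" for u j
    by (rule frac_union[OF m']) (rule frac_sum_cong[OF that m' that], auto)
  have "frac R M x m k \<oplus>\<^bsub>loc_module R M x\<^esub> frac R M x m' k' =
      (\<Union>(u, j)\<in>frac R M x m k. \<Union>(v, j')\<in>frac R M x m' k'.
         frac R M x (x [^] j' \<odot>\<^bsub>M\<^esub> u \<oplus>\<^bsub>M\<^esub> x [^] j \<odot>\<^bsub>M\<^esub> v) (j + j'))"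
    by (simp add: loc_module_def)
  also have "\<dots> = (\<Union>(v, j')\<in>frac R M x m' k'.
         frac R M x (x [^] j' \<odot>\<^bsub>M\<^esub> m \<oplus>\<^bsub>M\<^esub> x [^] k \<odot>\<^bsub>M\<^esub> v) (k + j'))"
  proof (rule frac_union[OF m])
    fix u j assume u: "u \<in> carrier M" and "frac R M x u j = frac R M x m k"
    then show "(\<Union>(v, j')\<in>frac R M x m' k'. frac R M x (x [^] j' \<odot>\<^bsub>M\<^esub> u \<oplus>\<^bsub>M\<^esub> x [^] j \<odot>\<^bsub>M\<^esub> v) (j + j'))
      = (\<Union>(v, j')\<in>frac R M x m' k'. frac R M x (x [^] j' \<odot>\<^bsub>M\<^esub> m \<oplus>\<^bsub>M\<^esub> x [^] k \<odot>\<^bsub>M\<^esub> v) (k + j'))"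
      unfolding inner[OF u] inner[OF m] by (intro frac_sum_cong m m' u) auto
  qed
  also have "\<dots> = frac R M x (x [^] k' \<odot>\<^bsub>M\<^esub> m \<oplus>\<^bsub>M\<^esub> x [^] k \<odot>\<^bsub>M\<^esub> m') (k + k')" by (rule inner[OF m])
  finally show ?thesis .
qed

lemma frac_add_same:
  assumes "m \<in> carrier M" "m' \<in> carrier M"
  shows "frac R M x m k \<oplus>\<^bsub>loc_module R M x\<^esub> frac R M x m' k = frac R M x (m \<oplus>\<^bsub>M\<^esub> m') k"
proof -
  have "frac R M x m k \<oplus>\<^bsub>loc_module R M x\<^esub> frac R M x m' k = frac R M x (x [^] k \<odot>\<^bsub>M\<^esub> (m \<oplus>\<^bsub>M\<^esub> m')) (k + k)"
    using assms x by (simp add: frac_add smult_r_distr)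
  then show ?thesis using frac_expand assms by simp
qed

lemma frac_smult:
  assumes m: "m \<in> carrier M" and r: "r \<in> carrier R"
  shows "r \<odot>\<^bsub>loc_module R M x\<^esub> frac R M x m k = frac R M x (r \<odot>\<^bsub>M\<^esub> m) k"
proof -
  have "frac R M x (r \<odot>\<^bsub>M\<^esub> u) j = frac R M x (r \<odot>\<^bsub>M\<^esub> m) k"
    if u: "u \<in> carrier M" and eq: "frac R M x u j = frac R M x m k" for u j
  proof -
    obtain l where l: "x [^] (l + k) \<odot>\<^bsub>M\<^esub> u = x [^] (l + j) \<odot>\<^bsub>M\<^esub> m"
      using eq frac_eq_iff[OF u m] by blast
    have "x [^] (l + k) \<odot>\<^bsub>M\<^esub> (r \<odot>\<^bsub>M\<^esub> u) = r \<odot>\<^bsub>M\<^esub> (x [^] (l + k) \<odot>\<^bsub>M\<^esub> u)"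
      using u r x by (simp add: R.m_comm flip: smult_assoc1)
    also have "\<dots> = x [^] (l + j) \<odot>\<^bsub>M\<^esub> (r \<odot>\<^bsub>M\<^esub> m)"
      unfolding l using m r x by (simp add: R.m_comm flip: smult_assoc1)
    finally show ?thesis using u m r by (subst frac_eq_iff) auto
  qed
  then have "(\<Union>(u, j)\<in>frac R M x m k. frac R M x (r \<odot>\<^bsub>M\<^esub> u) j) = frac R M x (r \<odot>\<^bsub>M\<^esub> m) k"
    by (rule frac_union[OF m])
  then show ?thesis by (simp add: loc_module_def)
qed

lemma common_denominator:
  assumes "U \<in> carrier (loc_module R M x)" "V \<in> carrier (loc_module R M x)"
  obtains m m' k where "m \<in> carrier M" "m' \<in> carrier M" "U = frac R M x m k" "V = frac R M x m' k"
proof -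
  obtain m k where m: "m \<in> carrier M" "U = frac R M x m k" using assms(1) by (rule loc_carrierE)
  obtain m' k' where m': "m' \<in> carrier M" "V = frac R M x m' k'" using assms(2) by (rule loc_carrierE)
  show thesis
  proof
    show "U = frac R M x (x [^] k' \<odot>\<^bsub>M\<^esub> m) (k + k')" using m frac_expand by simp
    show "V = frac R M x (x [^] k \<odot>\<^bsub>M\<^esub> m') (k + k')" using m' frac_expand[of m' k k'] by (simp add: add.commute)
  qed (use m m' in auto)
qed

lemma loc_is_module: "module R (loc_module R M x)"
proof (rule moduleI)
  let ?L = "loc_module R M x"
  note fadd = frac_add_same and fs = frac_smult
  show "cring R" by (rule R.cring_axioms)
  show "abelian_group ?L"
  proof (rule abelian_groupI)
    fix U V W assume U: "U \<in> carrier ?L" and V: "V \<in> carrier ?L"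
    then obtain m m' k where m: "m \<in> carrier M" "m' \<in> carrier M" "U = frac R M x m k" "V = frac R M x m' k"
      by (rule common_denominator)
    show UV: "U \<oplus>\<^bsub>?L\<^esub> V \<in> carrier ?L" unfolding m(3,4) using m by (simp add: fadd)
    show "U \<oplus>\<^bsub>?L\<^esub> V = V \<oplus>\<^bsub>?L\<^esub> U" unfolding m(3,4) using m by (simp add: fadd M.a_comm)
    assume W: "W \<in> carrier ?L"
    then obtain w j where w: "w \<in> carrier M" "W = frac R M x w j" by (rule loc_carrierE)
    define u where "u = x [^] j \<odot>\<^bsub>M\<^esub> m"
    define v where "v = x [^] j \<odot>\<^bsub>M\<^esub> m'"
    define w' where "w' = x [^] k \<odot>\<^bsub>M\<^esub> w"
    have uvw: "u \<in> carrier M" "v \<in> carrier M" "w' \<in> carrier M" using m w by (simp_all add: u_def v_def w'_def)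
    have eqs: "U = frac R M x u (k + j)" "V = frac R M x v (k + j)" "W = frac R M x w' (k + j)"
      unfolding u_def v_def w'_def m(3,4) w(2)
      using m w frac_expand[of m j k] frac_expand[of m' j k] frac_expand[of w k j] by (simp_all add: add.commute)
    show "U \<oplus>\<^bsub>?L\<^esub> V \<oplus>\<^bsub>?L\<^esub> W = U \<oplus>\<^bsub>?L\<^esub> (V \<oplus>\<^bsub>?L\<^esub> W)"
      unfolding eqs using uvw by (simp add: fadd M.a_assoc)
  next
    fix U assume "U \<in> carrier ?L"
    then obtain m k where m: "m \<in> carrier M" "U = frac R M x m k" by (rule loc_carrierE)
    show "\<zero>\<^bsub>?L\<^esub> \<oplus>\<^bsub>?L\<^esub> U = U"
      unfolding m(2) frac_zero[of k, symmetric] using m by (simp add: fadd)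
    have "frac R M x (\<ominus>\<^bsub>M\<^esub> m) k \<oplus>\<^bsub>?L\<^esub> U = \<zero>\<^bsub>?L\<^esub>"
      unfolding m(2) using m by (simp add: fadd M.l_neg frac_zero)
    then show "\<exists>V\<in>carrier ?L. V \<oplus>\<^bsub>?L\<^esub> U = \<zero>\<^bsub>?L\<^esub>" using m by (meson frac_in_loc M.a_inv_closed)
  next
    show "\<zero>\<^bsub>?L\<^esub> \<in> carrier ?L" by (simp add: loc_sel(2))
  qed
  fix r U assume r: "r \<in> carrier R" and "U \<in> carrier ?L"
  then obtain m k where m: "m \<in> carrier M" "U = frac R M x m k" by (elim loc_carrierE)
  show "r \<odot>\<^bsub>?L\<^esub> U \<in> carrier ?L" unfolding m(2) using m r by (simp add: fs)
next
  let ?L = "loc_module R M x"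
  fix r s U assume rs: "r \<in> carrier R" "s \<in> carrier R" and "U \<in> carrier ?L"
  then obtain m k where m: "m \<in> carrier M" "U = frac R M x m k" by (elim loc_carrierE)
  show "(r \<oplus> s) \<odot>\<^bsub>?L\<^esub> U = r \<odot>\<^bsub>?L\<^esub> U \<oplus>\<^bsub>?L\<^esub> s \<odot>\<^bsub>?L\<^esub> U"
    unfolding m(2) using m rs by (simp add: frac_smult frac_add_same smult_l_distr)
  show "(r \<otimes> s) \<odot>\<^bsub>?L\<^esub> U = r \<odot>\<^bsub>?L\<^esub> (s \<odot>\<^bsub>?L\<^esub> U)"
    unfolding m(2) using m rs by (simp add: frac_smult smult_assoc1)
next
  let ?L = "loc_module R M x"
  fix r U V assume r: "r \<in> carrier R" and UV: "U \<in> carrier ?L" "V \<in> carrier ?L"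
  obtain m m' k where m: "m \<in> carrier M" "m' \<in> carrier M" "U = frac R M x m k" "V = frac R M x m' k"
    using UV by (rule common_denominator)
  show "r \<odot>\<^bsub>?L\<^esub> (U \<oplus>\<^bsub>?L\<^esub> V) = r \<odot>\<^bsub>?L\<^esub> U \<oplus>\<^bsub>?L\<^esub> r \<odot>\<^bsub>?L\<^esub> V"
    unfolding m(3,4) using m r by (simp add: frac_smult frac_add_same smult_r_distr)
next
  let ?L = "loc_module R M x"
  fix U assume "U \<in> carrier ?L"
  then obtain m k where m: "m \<in> carrier M" "U = frac R M x m k" by (rule loc_carrierE)
  show "\<one> \<odot>\<^bsub>?L\<^esub> U = U" unfolding m(2) using m by (simp add: frac_smult)
qed

lemma frac_uminus:
  assumes m: "m \<in> carrier M"
  shows "\<ominus>\<^bsub>loc_module R M x\<^esub> frac R M x m k = frac R M x (\<ominus>\<^bsub>M\<^esub> m) k"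
proof -
  interpret L: module R "loc_module R M x" by (rule loc_is_module)
  show ?thesis
    by (rule L.minus_equality) (use m in \<open>simp_all add: frac_add_same M.l_neg frac_zero\<close>)
qed

lemma frac_finsum:
  assumes "finite I" "\<And>i. i \<in> I \<Longrightarrow> f i \<in> carrier M"
  shows "frac R M x (\<Oplus>\<^bsub>M\<^esub>i\<in>I. f i) k = (\<Oplus>\<^bsub>loc_module R M x\<^esub>i\<in>I. frac R M x (f i) k)"
  using assms
proof (induct I rule: finite_induct)
  interpret L: module R "loc_module R M x" by (rule loc_is_module)
  case empty
  then show ?case by (simp add: frac_zero)
next
  interpret L: module R "loc_module R M x" by (rule loc_is_module)
  case (insert i I)
  then have f: "f i \<in> carrier M" "f \<in> I \<rightarrow> carrier M" by auto
  then show ?case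
    using insert by (simp add: frac_add_same[symmetric] Pi_def)
qed

context
  fixes y assumes y: "y \<in> carrier R"
begin

lemma xy_pow_smult: "m \<in> carrier M \<Longrightarrow>
  (x \<otimes> y) [^] (i::nat) \<odot>\<^bsub>M\<^esub> (y [^] (j::nat) \<odot>\<^bsub>M\<^esub> m) = y [^] (i + j) \<odot>\<^bsub>M\<^esub> (x [^] i \<odot>\<^bsub>M\<^esub> m)"
  using x y
  by (simp add: R.nat_pow_distrib R.m_ac flip: R.nat_pow_mult smult_assoc1)

lemma loc_map_frac:
  assumes m: "m \<in> carrier M"
  shows "loc_map R M y (x \<otimes> y) (frac R M x m k) = frac R M (x \<otimes> y) (y [^] k \<odot>\<^bsub>M\<^esub> m) k"
  unfolding loc_map_def
proof (rule frac_union[OF m])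
  fix u j assume u: "u \<in> carrier M" and eq: "frac R M x u j = frac R M x m k"
  obtain l where l: "x [^] (l + k) \<odot>\<^bsub>M\<^esub> u = x [^] (l + j) \<odot>\<^bsub>M\<^esub> m"
    using eq frac_eq_iff[OF u m] by blast
  have "(x \<otimes> y) [^] (l + k) \<odot>\<^bsub>M\<^esub> (y [^] j \<odot>\<^bsub>M\<^esub> u) = (x \<otimes> y) [^] (l + j) \<odot>\<^bsub>M\<^esub> (y [^] k \<odot>\<^bsub>M\<^esub> m)"
    unfolding xy_pow_smult[OF u] xy_pow_smult[OF m] l by (simp add: ac_simps)
  then show "frac R M (x \<otimes> y) (y [^] j \<odot>\<^bsub>M\<^esub> u) j = frac R M (x \<otimes> y) (y [^] k \<odot>\<^bsub>M\<^esub> m) k"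
    using u m x y by (subst module.frac_eq_iff[OF module_axioms]) auto
qed

lemma loc_map_closed:
  assumes "U \<in> carrier (loc_module R M x)"
  shows "loc_map R M y (x \<otimes> y) U \<in> carrier (loc_module R M (x \<otimes> y))"
proof -
  obtain m k where m: "m \<in> carrier M" "U = frac R M x m k" using assms by (rule loc_carrierE)
  then show ?thesis using x y by (simp add: loc_map_frac module.frac_in_loc[OF module_axioms])
qed

lemma loc_map_add:
  assumes "U \<in> carrier (loc_module R M x)" "V \<in> carrier (loc_module R M x)"
  shows "loc_map R M y (x \<otimes> y) (U \<oplus>\<^bsub>loc_module R M x\<^esub> V)
    = loc_map R M y (x \<otimes> y) U \<oplus>\<^bsub>loc_module R M (x \<otimes> y)\<^esub> loc_map R M y (x \<otimes> y) V"
proof -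
  obtain m m' k where m: "m \<in> carrier M" "m' \<in> carrier M" "U = frac R M x m k" "V = frac R M x m' k"
    using assms by (rule common_denominator)
  then show ?thesis
    using x y by (simp add: frac_add_same loc_map_frac module.frac_add_same[OF module_axioms] smult_r_distr)
qed

end

end

end

section \<open>The top of the Cech complex\<close>

text \<open>The common frame for both complexes: \<open>gr n\<close> is \<open>I\<^sup>n M\<close> in the one case, and the homogeneous
  part of degree \<open>n\<close> of the Rees module in the other. As the latter is not a submodule, \<open>gr n\<close>
  is only required to be a subgroup.\<close>

locale cech_setting = module R M for R (structure) and M (structure) +
  fixes gr :: "nat \<Rightarrow> 'c set" and x :: "nat \<Rightarrow> 'a" and c :: "nat \<Rightarrow> nat" and t :: nat
  assumes x: "j \<in> {1..t} \<Longrightarrow> x j \<in> carrier R"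
    and gr_carrier: "m \<in> gr i \<Longrightarrow> m \<in> carrier M"
    and gr_zero: "\<zero>\<^bsub>M\<^esub> \<in> gr i"
    and gr_add: "m \<in> gr i \<Longrightarrow> m' \<in> gr i \<Longrightarrow> m \<oplus>\<^bsub>M\<^esub> m' \<in> gr i"
    and gr_uminus: "m \<in> gr i \<Longrightarrow> \<ominus>\<^bsub>M\<^esub> m \<in> gr i"
    and gr_smult: "j \<in> {1..t} \<Longrightarrow> m \<in> gr i \<Longrightarrow> x j \<odot>\<^bsub>M\<^esub> m \<in> gr (i + c j)"
begin

abbreviation "xs \<equiv> cech_elem R x"
abbreviation "L J \<equiv> loc_module R M (xs J)"
abbreviation "C \<equiv> cech_term R M x t"
abbreviation "d \<equiv> cech_diff R M x t"

lemma index_subset: "J \<in> cech_index t i \<Longrightarrow> J \<subseteq> {1..t}"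
  by (simp add: cech_index_def)

lemma index_finite: "J \<in> cech_index t i \<Longrightarrow> finite J"
  using finite_subset by (auto simp: cech_index_def)

lemma index_remove: "J \<in> cech_index t (Suc i) \<Longrightarrow> j \<in> J \<Longrightarrow> J - {j} \<in> cech_index t i"
  using index_finite[of J "Suc i"] by (auto simp: cech_index_def)

lemma xs_closed: "J \<subseteq> {1..t} \<Longrightarrow> xs J \<in> carrier R"
  unfolding cech_elem_def using x by (intro R.finprod_closed) auto

lemma xs_remove:
  assumes "J \<subseteq> {1..t}" "j \<in> J" shows "xs J = xs (J - {j}) \<otimes> x j"
proof -
  have fin: "finite J" using assms(1) finite_subset by blast
  have "xs J = (\<Otimes>i\<in>insert j (J - {j}). x i)" using assms(2) by (simp add: cech_elem_def insert_absorb)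
  also have "\<dots> = x j \<otimes> xs (J - {j})"
    unfolding cech_elem_def by (rule R.finprod_insert) (use fin x assms in auto)
  also have "\<dots> = xs (J - {j}) \<otimes> x j"
    by (rule R.m_comm) (use x xs_closed[of "J - {j}"] assms in auto)
  finally show ?thesis .

qed

lemma L_module: "J \<subseteq> {1..t} \<Longrightarrow> module R (L J)"
  by (rule loc_is_module[OF xs_closed])

lemma cech_sel:
  "carrier (C i) = (\<Pi>\<^sub>E J\<in>cech_index t i. carrier (L J))"
  "\<zero>\<^bsub>C i\<^esub> = (\<lambda>J\<in>cech_index t i. \<zero>\<^bsub>L J\<^esub>)"
  "f \<oplus>\<^bsub>C i\<^esub> g = (\<lambda>J\<in>cech_index t i. f J \<oplus>\<^bsub>L J\<^esub> g J)"
  by (simp_all add: cech_term_def)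

lemma cochain_mem: "f \<in> carrier (C i) \<Longrightarrow> J \<in> cech_index t i \<Longrightarrow> f J \<in> carrier (L J)"
  by (auto simp: cech_sel)

lemma cech_term_abelian_group: "abelian_group (C i)"
proof (rule abelian_groupI)
  have L: "abelian_group (L J)" if "J \<in> cech_index t i" for J
    using L_module[OF index_subset[OF that]] module.axioms(2) by blast
  then have Lm: "abelian_monoid (L J)" if "J \<in> cech_index t i" for J
    using that abelian_group.axioms(1) by blast
  fix f assume f: "f \<in> carrier (C i)"
  have fJ: "f J \<in> carrier (L J)" if "J \<in> cech_index t i" for J using cochain_mem[OF f that] .
  have fext: "f = (\<lambda>J\<in>cech_index t i. f J)" using f by (simp add: cech_sel)
  show "\<zero>\<^bsub>C i\<^esub> \<oplus>\<^bsub>C i\<^esub> f = f"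
    unfolding cech_sel(2,3) using abelian_monoid.l_zero[OF Lm] fJ
    by (subst (2) fext) (intro restrict_ext, simp)

  have "(\<lambda>J\<in>cech_index t i. \<ominus>\<^bsub>L J\<^esub> f J) \<oplus>\<^bsub>C i\<^esub> f = \<zero>\<^bsub>C i\<^esub>"
    unfolding cech_sel(2,3) using abelian_group.l_neg[OF L] fJ by (intro restrict_ext) simp
  moreover have "(\<lambda>J\<in>cech_index t i. \<ominus>\<^bsub>L J\<^esub> f J) \<in> carrier (C i)"
    using abelian_group.a_inv_closed[OF L] fJ by (auto simp: cech_sel)
  ultimately show "\<exists>g\<in>carrier (C i). g \<oplus>\<^bsub>C i\<^esub> f = \<zero>\<^bsub>C i\<^esub>" by blast
  fix g assume g: "g \<in> carrier (C i)"
  have gJ: "g J \<in> carrier (L J)" if "J \<in> cech_index t i" for J using cochain_mem[OF g that] .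
  show "f \<oplus>\<^bsub>C i\<^esub> g \<in> carrier (C i)"
    using abelian_monoid.a_closed[OF Lm] fJ gJ by (auto simp: cech_sel)
  show "f \<oplus>\<^bsub>C i\<^esub> g = g \<oplus>\<^bsub>C i\<^esub> f"
    unfolding cech_sel(3) using abelian_monoid.a_comm[OF Lm] fJ gJ by (intro restrict_ext) simp
  fix h assume h: "h \<in> carrier (C i)"
  have hJ: "h J \<in> carrier (L J)" if "J \<in> cech_index t i" for J using cochain_mem[OF h that] .
  show "f \<oplus>\<^bsub>C i\<^esub> g \<oplus>\<^bsub>C i\<^esub> h = f \<oplus>\<^bsub>C i\<^esub> (g \<oplus>\<^bsub>C i\<^esub> h)"
    unfolding cech_sel(3) using abelian_monoid.a_assoc[OF Lm] fJ gJ hJ by (intro restrict_ext) simp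
next
  show "\<zero>\<^bsub>C i\<^esub> \<in> carrier (C i)"
    unfolding cech_sel
  proof (rule restrict_PiE_iff[THEN iffD2], rule ballI)
    fix J assume "J \<in> cech_index t i"
    then interpret LJ: module R "L J" by (rule L_module[OF index_subset])
    show "\<zero>\<^bsub>L J\<^esub> \<in> carrier (L J)" by (rule LJ.zero_closed)
  qed

qed

definition signed_face :: "(nat set \<Rightarrow> ('c \<times> nat) set) \<Rightarrow> nat set \<Rightarrow> nat \<Rightarrow> ('c \<times> nat) set" where
  "signed_face f J j = (let u = loc_map R M (x j) (xs J) (f (J - {j}))
     in if even (card {k \<in> J. k < j}) then u else \<ominus>\<^bsub>L J\<^esub> u)"

lemma cech_diff_eq: "d i f = (\<lambda>J\<in>cech_index t (Suc i). \<Oplus>\<^bsub>L J\<^esub>j\<in>J. signed_face f J j)"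
  by (simp add: cech_diff_def signed_face_def)

lemma face_closed:
  assumes "f \<in> carrier (C i)" "J \<in> cech_index t (Suc i)" "j \<in> J"
  shows "loc_map R M (x j) (xs J) (f (J - {j})) \<in> carrier (L J)"
proof -
  have J: "J \<subseteq> {1..t}" by (rule index_subset[OF assms(2)])
  then have "xs (J - {j}) \<in> carrier R" "x j \<in> carrier R"
    using xs_closed[of "J - {j}"] x[of j] assms(3) by auto
  then show ?thesis
    unfolding xs_remove[OF J assms(3)]
    using cochain_mem[OF assms(1) index_remove[OF assms(2,3)]] by (rule loc_map_closed)
qed

lemma signed_face_closed:
  assumes "f \<in> carrier (C i)" "J \<in> cech_index t (Suc i)" "j \<in> J"
  shows "signed_face f J j \<in> carrier (L J)"
proof -
  interpret LJ: module R "L J" by (rule L_module[OF index_subset[OF assms(2)]])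
  show ?thesis using face_closed[OF assms] by (simp add: signed_face_def Let_def)
qed

lemma signed_face_add:
  assumes f: "f \<in> carrier (C i)" and g: "g \<in> carrier (C i)" and J: "J \<in> cech_index t (Suc i)" and j: "j \<in> J"
  shows "signed_face (f \<oplus>\<^bsub>C i\<^esub> g) J j = signed_face f J j \<oplus>\<^bsub>L J\<^esub> signed_face g J j"
proof -
  interpret LJ: module R "L J" by (rule L_module[OF index_subset[OF J]])
  have J': "J \<subseteq> {1..t}" by (rule index_subset[OF J])
  then have "xs (J - {j}) \<in> carrier R" "x j \<in> carrier R"
    using xs_closed[of "J - {j}"] x[of j] j by auto
  note add = loc_map_add[OF this cochain_mem[OF f index_remove[OF J j]] cochain_mem[OF g index_remove[OF J j]],
      folded xs_remove[OF J' j]]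
  have "(f \<oplus>\<^bsub>C i\<^esub> g) (J - {j}) = f (J - {j}) \<oplus>\<^bsub>L (J - {j})\<^esub> g (J - {j})"
    using index_remove[OF J j] by (simp add: cech_sel)
  then show ?thesis
    using add face_closed[OF f J j] face_closed[OF g J j]
    by (simp add: signed_face_def Let_def LJ.minus_add)
qed

lemma cech_diff_hom: "d i \<in> hom (add_monoid (C i)) (add_monoid (C (Suc i)))"
proof (rule homI)
  fix f assume f: "f \<in> carrier (add_monoid (C i))"
  have "(\<Oplus>\<^bsub>L J\<^esub>j\<in>J. signed_face f J j) \<in> carrier (L J)" if J: "J \<in> cech_index t (Suc i)" for J
  proof -
    interpret LJ: module R "L J" by (rule L_module[OF index_subset[OF J]])
    show ?thesis by (rule LJ.finsum_closed) (use signed_face_closed[of f i J] f J in auto)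
  qed
  then show "d i f \<in> carrier (add_monoid (C (Suc i)))" by (simp add: cech_diff_eq cech_sel)
  fix g assume g: "g \<in> carrier (add_monoid (C i))"
  have "(\<Oplus>\<^bsub>L J\<^esub>j\<in>J. signed_face (f \<oplus>\<^bsub>C i\<^esub> g) J j)
      = (\<Oplus>\<^bsub>L J\<^esub>j\<in>J. signed_face f J j) \<oplus>\<^bsub>L J\<^esub> (\<Oplus>\<^bsub>L J\<^esub>j\<in>J. signed_face g J j)"
    if J: "J \<in> cech_index t (Suc i)" for J
  proof -
    interpret LJ: module R "L J" by (rule L_module[OF index_subset[OF J]])
    have "(\<Oplus>\<^bsub>L J\<^esub>j\<in>J. signed_face (f \<oplus>\<^bsub>C i\<^esub> g) J j)
        = (\<Oplus>\<^bsub>L J\<^esub>j\<in>J. signed_face f J j \<oplus>\<^bsub>L J\<^esub> signed_face g J j)"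
      by (rule LJ.finsum_cong')
        (use f g signed_face_add[of f i g J] signed_face_closed[of f i J] signed_face_closed[of g i J] J in auto)
    also have "\<dots> = (\<Oplus>\<^bsub>L J\<^esub>j\<in>J. signed_face f J j) \<oplus>\<^bsub>L J\<^esub> (\<Oplus>\<^bsub>L J\<^esub>j\<in>J. signed_face g J j)"
      by (rule LJ.finsum_addf)
        (use f g signed_face_closed[of f i J] signed_face_closed[of g i J] J in auto)
    finally show ?thesis .
  qed
  then show "d i (f \<otimes>\<^bsub>add_monoid (C i)\<^esub> g) = d i f \<otimes>\<^bsub>add_monoid (C (Suc i))\<^esub> d i g"
    by (simp add: cech_diff_eq cech_sel(3)[of "Suc i"] cong: restrict_cong)
qed

lemma xs_smult_gr:
  assumes "J \<subseteq> {1..t}" "m \<in> gr i"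
  shows "xs J \<odot>\<^bsub>M\<^esub> m \<in> gr (i + (\<Sum>j\<in>J. c j))"
proof -
  have "finite J" using assms(1) finite_subset by blast
  then show ?thesis
    using assms
  proof (induct J arbitrary: m i rule: finite_induct)
    case empty
    then show ?case using gr_carrier by (simp add: cech_elem_def)
  next
    case (insert j J)
    have xJ: "xs J \<in> carrier R" "x j \<in> carrier R" using xs_closed[of J] x[of j] insert.prems by auto

    have "xs (insert j J) = xs J \<otimes> x j" using xs_remove[of "insert j J" j] insert by simp
    then have "xs (insert j J) \<odot>\<^bsub>M\<^esub> m = xs J \<odot>\<^bsub>M\<^esub> (x j \<odot>\<^bsub>M\<^esub> m)"
      using xJ gr_carrier[OF insert.prems(2)] by (simp add: smult_assoc1)
    also have "\<dots> \<in> gr (i + c j + (\<Sum>j\<in>J. c j))"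
      using insert.hyps(3)[OF _ gr_smult[of j m i]] insert.prems by simp
    finally show ?case using insert.hyps by (simp add: ac_simps)
  qed
qed

lemma xs_pow_smult_gr:
  assumes J: "J \<subseteq> {1..t}" and m: "m \<in> gr i"
  shows "xs J [^] (k::nat) \<odot>\<^bsub>M\<^esub> m \<in> gr (i + k * (\<Sum>j\<in>J. c j))"
proof (induct k)
  case 0
  then show ?case using m gr_carrier by simp
next
  case (Suc k)
  have "xs J [^] Suc k \<odot>\<^bsub>M\<^esub> m = xs J \<odot>\<^bsub>M\<^esub> (xs J [^] k \<odot>\<^bsub>M\<^esub> m)"
    using xs_closed[OF J] gr_carrier[OF m] by (simp add: nat_pow_Suc R.m_comm flip: smult_assoc1)
  then show ?case using xs_smult_gr[OF J Suc] by (simp add: ac_simps)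
qed

definition homogeneous_cochains :: "nat \<Rightarrow> nat \<Rightarrow> (nat set \<Rightarrow> ('c \<times> nat) set) set" where
  "homogeneous_cochains n i = (\<Pi>\<^sub>E J\<in>cech_index t i. loc_part R M gr (xs J) (\<Sum>j\<in>J. c j) n)"

lemma loc_part_subgroup:
  fixes n :: nat
  assumes
 J: "J \<subseteq> {1..t}"
  defines "P \<equiv> loc_part R M gr (xs J) (\<Sum>j\<in>J. c j) n"
  shows "P \<subseteq> carrier (L J)" "\<zero>\<^bsub>L J\<^esub> \<in> P"
    and "U \<in> P \<Longrightarrow> V \<in> P \<Longrightarrow> U \<oplus>\<^bsub>L J\<^esub> V \<in> P" "U \<in> P \<Longrightarrow> \<ominus>\<^bsub>L J\<^esub> U \<in> P"
proof -
  let ?e = "\<Sum>j\<in>J. c j"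
  note xJ = xs_closed[OF J]
  show "P \<subseteq> carrier (L J)"
    using frac_in_loc[OF xJ] gr_carrier by (auto simp: P_def loc_part_def)
  have "frac R M (xs J) \<zero>\<^bsub>M\<^esub> 0 \<in> P" unfolding P_def loc_part_def using gr_zero by blast
  then show "\<zero>\<^bsub>L J\<^esub> \<in> P" by (simp add: loc_sel[OF xJ])
  show "U \<oplus>\<^bsub>L J\<^esub> V \<in> P" if UV: "U \<in> P" "V \<in> P"
  proof -
    obtain m k where m: "m \<in> gr (n + k * ?e)" "U = frac R M (xs J) m k"
      using UV(1) by (auto simp: P_def loc_part_def)
    obtain m' k' where m': "m' \<in> gr (n + k' * ?e)" "V = frac R M (xs J) m' k'"
      using UV(2) by (auto simp: P_def loc_part_def)
    have "xs J [^] k' \<odot>\<^bsub>M\<^esub> m \<in> gr (n + (k + k') * ?e)" "xs J [^] k \<odot>\<^bsub>M\<^esub> m' \<in> gr (n + (k + k') * ?e)"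
      using xs_pow_smult_gr[OF J m(1), of k'] xs_pow_smult_gr[OF J m'(1), of k]
      by (simp_all add: algebra_simps)
    then have "xs J [^] k' \<odot>\<^bsub>M\<^esub> m \<oplus>\<^bsub>M\<^esub> xs J [^] k \<odot>\<^bsub>M\<^esub> m' \<in> gr (n + (k + k') * ?e)" by (rule gr_add)
    then show ?thesis
      unfolding m(2) m'(2) frac_add[OF xJ gr_carrier[OF m(1)] gr_carrier[OF m'(1)]]
      unfolding P_def loc_part_def by blast
  qed
  show "\<ominus>\<^bsub>L J\<^esub> U \<in> P" if U: "U \<in> P"
  proof -
    obtain m k where m: "m \<in> gr (n + k * ?e)" "U = frac R M (xs J) m k"
      using U by (auto simp: P_def loc_part_def)
    show ?thesis
      unfolding m(2) frac_uminus[OF xJ gr_carrier[OF m(1)]]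
      unfolding P_def loc_part_def using gr_uminus[OF m(1)] by blast
  qed
qed

lemma homogeneous_cochains_subgroup: "subgroup (homogeneous_cochains n i) (add_monoid (C i))"
proof -
  interpret C: abelian_group "C i" by (rule cech_term_abelian_group)
  note P = loc_part_subgroup[OF index_subset]
  show ?thesis
  proof (rule C.add.subgroupI)
    show "homogeneous_cochains n i \<subseteq> carrier (C i)"
      using P(1) by (fastforce simp: homogeneous_cochains_def cech_sel PiE_iff)
    have "\<zero>\<^bsub>C i\<^esub> \<in> homogeneous_cochains n i"
      using P(2) by (auto simp: homogeneous_cochains_def cech_sel)
    then show "homogeneous_cochains n i \<noteq> {}" by blast
    fix f assume f: "f \<in> homogeneous_cochains n i"
    then have fJ: "f J \<in> loc_part R M gr (xs J) (\<Sum>j\<in>J. c j) n" if "J \<in> cech_index t i" for J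
      using that by (auto simp: homogeneous_cochains_def)
    have fC: "f \<in> carrier (C i)" using f \<open>homogeneous_cochains n i \<subseteq> carrier (C i)\<close> by blast
    define g where "g = (\<lambda>J\<in>cech_index t i. \<ominus>\<^bsub>L J\<^esub> f J)"
    have g: "g \<in> homogeneous_cochains n i"
      using P(4) fJ by (auto simp: homogeneous_cochains_def g_def)
    then have gC: "g \<in> carrier (C i)" using \<open>homogeneous_cochains n i \<subseteq> carrier (C i)\<close> by blast
    have "g \<oplus>\<^bsub>C i\<^esub> f = \<zero>\<^bsub>C i\<^esub>"
      unfolding cech_sel(2,3)
    proof (rule restrict_ext)
      fix J assume J: "J \<in> cech_index t i"
      interpret LJ: module R "L J" by (rule L_module[OF index_subset[OF J]])
      show "g J \<oplus>\<^bsub>L J\<^esub> f J = \<zero>\<^bsub>L J\<^esub>" using J cochain_mem[OF fC J] by (simp add: g_def LJ.l_neg)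
    qed
    then have "\<ominus>\<^bsub>C i\<^esub> f = g" using fC gC by (rule C.minus_equality)
    then show "\<ominus>\<^bsub>C i\<^esub> f \<in> homogeneous_cochains n i" using g by simp
    fix h assume "h \<in> homogeneous_cochains n i"
    then have hJ: "h J \<in> loc_part R M gr (xs J) (\<Sum>j\<in>J. c j) n" if "J \<in> cech_index t i" for J
      using that by (auto simp: homogeneous_cochains_def)
    show "f \<oplus>\<^bsub>C i\<^esub> h \<in> homogeneous_cochains n i"
      using P(3) fJ hJ by (auto simp: homogeneous_cochains_def cech_sel)
  qed
qed

lemma top_index: "cech_index t t = {{1..t}}"
proof -
  have "J = {1..t}" if "J \<subseteq> {1..t}" "card J = t" for J
    by (rule card_subset_eq) (use that in auto)
  then show ?thesis by (auto simp: cech_index_def)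
qed

lemma beyond_top_index: "cech_index t (Suc t) = {}"
proof -
  have "card J \<noteq> Suc t" if "J \<subseteq> {1..t}" for J
    using card_mono[OF _ that] by auto
  then show ?thesis by (auto simp: cech_index_def)
qed

lemma cocycles_top: "cocycles C d t = carrier (C t)"
  by (simp add: cocycles_def cech_diff_eq cech_sel(2) beyond_top_index restrict_def)

text \<open>A top cochain \<open>m / x\<^sup>k\<close>, with \<open>x\<close> the product of all \<open>x\<^sub>i\<close>, is a coboundary if
  \<open>m = \<Sum>\<^sub>i x\<^sub>i\<^sup>k y\<^sub>i\<close>: the \<open>i\<close>-th summand is the image of \<open>y\<^sub>i\<close> over the \<open>k\<close>-th power of the
  product of the other elements.\<close>

lemma top_cochain_coboundary:
  assumes t: "t = Suc s"
    and expand: "\<And>k m. m \<in> gr (n + k * (\<Sum>j\<in>{1..t}. c j)) \<Longrightarrow>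
      \<exists>y. (\<forall>i\<in>{1..t}. y i \<in> gr (n + k * (\<Sum>j\<in>{1..t} - {i}. c j))) \<and> m = (\<Oplus>\<^bsub>M\<^esub>i\<in>{1..t}. (x i [^] k) \<odot>\<^bsub>M\<^esub> y i)"
    and z: "z \<in> homogeneous_cochains n t"
  shows "z \<in> d s ` homogeneous_cochains n s"
proof -
  let ?J = "{1..t}"
  interpret LJ: module R "L ?J" by (rule L_module) simp
  have xJ: "xs ?J \<in> carrier R" by (rule xs_closed) simp
  have "z ?J \<in> loc_part R M gr (xs ?J) (\<Sum>j\<in>?J. c j) n"
    using z by (auto simp: homogeneous_cochains_def top_index)
  then obtain m k where m: "m \<in> gr (n + k * (\<Sum>j\<in>?J. c j))" "z ?J = frac R M (xs ?J) m k"
    by (auto simp: loc_part_def)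
  obtain y where y: "\<And>i. i \<in> ?J \<Longrightarrow> y i \<in> gr (n + k * (\<Sum>j\<in>?J - {i}. c j))"
    and my: "m = (\<Oplus>\<^bsub>M\<^esub>i\<in>?J. (x i [^] k) \<odot>\<^bsub>M\<^esub> y i)"
    using expand[OF m(1)] by blast
  define y' where "y' i = (if even (card {l \<in> ?J. l < i}) then y i else \<ominus>\<^bsub>M\<^esub> y i)" for i
  have y': "y' i \<in> gr (n + k * (\<Sum>j\<in>?J - {i}. c j))" if "i \<in> ?J" for i
    using y[OF that] gr_uminus by (simp add: y'_def)
  define g where "g = (\<lambda>J\<in>cech_index t s. frac R M (xs J) (y' (the_elem (?J - J))) k)"
  have face: "\<exists>i\<in>?J. J = ?J - {i}" if "J \<in> cech_index t s" for J
  proof -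
    have J: "J \<subseteq> ?J" "card J = s" using that by (auto simp: cech_index_def)
    then have "card (?J - J) = 1" using t card_Diff_subset[of J ?J] finite_subset[OF J(1)] by simp
    then obtain i where "?J - J = {i}" by (rule card_1_singletonE)
    then show ?thesis using J(1) by blast
  qed
  have g_face: "g (?J - {i}) = frac R M (xs (?J - {i})) (y' i) k" if i: "i \<in> ?J" for i
  proof -
    have "?J - {i} \<in> cech_index t s" using i t by (auto simp: cech_index_def)
    moreover have "?J - (?J - {i}) = {i}" using i by blast
    ultimately show ?thesis by (simp add: g_def)
  qed
  have g: "g \<in> homogeneous_cochains n s"
    unfolding homogeneous_cochains_def
  proof (rule PiE_I)
    fix J assume "J \<in> cech_index t s"
    then obtain i where i: "i \<in> ?J" "J = ?J - {i}" using face by blast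
    show "g J \<in> loc_part R M gr (xs J) (\<Sum>j\<in>J. c j) n"
      unfolding i(2) g_face[OF i(1)] loc_part_def using y'[OF i(1)] by blast
  qed (simp add: g_def)
  have sf: "signed_face g ?J i = frac R M (xs ?J) (x i [^] k \<odot>\<^bsub>M\<^esub> y i) k" if i: "i \<in> ?J" for i
  proof -
    have carr: "xs (?J - {i}) \<in> carrier R" "x i \<in> carrier R" "y i \<in> carrier M" "y' i \<in> carrier M"
      using xs_closed[of "?J - {i}"] x[of i] i gr_carrier[OF y[OF i]] gr_carrier[OF y'[OF i]] by auto
    have "loc_map R M (x i) (xs ?J) (g (?J - {i})) = frac R M (xs ?J) (x i [^] k \<odot>\<^bsub>M\<^esub> y' i) k"
      unfolding g_face[OF i] xs_remove[OF order.refl i] by (rule loc_map_frac[OF carr(1,2,4)])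
    then show ?thesis
      using carr xJ by (simp add: signed_face_def y'_def smult_r_minus frac_uminus)
  qed
  have xy: "x i [^] k \<odot>\<^bsub>M\<^esub> y i \<in> carrier M" if "i \<in> ?J" for i
    using x[OF that] gr_carrier[OF y[OF that]] by simp
  have "z ?J = (\<Oplus>\<^bsub>L ?J\<^esub>i\<in>?J. frac
 R M (xs ?J) (x i [^] k \<odot>\<^bsub>M\<^esub> y i) k)"
    unfolding m(2) my by (rule frac_finsum[OF xJ]) (use xy in auto)
  also have "\<dots> = (\<Oplus>\<^bsub>L ?J\<^esub>i\<in>?J. signed_face g ?J i)"
    by (rule LJ.finsum_cong') (use sf frac_in_loc[OF xJ xy] in auto)
  also have "\<dots> = d s g ?J"
    using top_index by (simp add: cech_diff_eq t[symmetric])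
  finally have "z ?J = d s g ?J" .
  then have "z = d s g"
    using z by (intro ext) (auto simp: homogeneous_cochains_def top_index cech_diff_eq t[symmetric] PiE_iff extensional_def)
  then show ?thesis using g by blast
qed

text \<open>The group \<open>D\<close> whose image is factored out is a parameter: it consists of the homogeneous
  cochains for the subcomplex, and of all cochains for local cohomology. For \<open>t = 0\<close> the
  expansion has no summands, so it says that \<open>gr n\<close> is zero.\<close>

lemma top_coset:
  assumes expand: "\<And>k m. m \<in> gr (n + k * (\<Sum>j\<in>{1..t}. c j)) \<Longrightarrow>
      \<exists>y. (\<forall>i\<in>{1..t}. y i \<in> gr (n + k * (\<Sum>j\<in>{1..t} - {i}. c j))) \<and> m = (\<Oplus>\<^bsub>M\<^esub>i\<in>{1..t}. (x i [^] k) \<odot>\<^bsub>M\<^esub> y i)"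
    and z: "z \<in> homogeneous_cochains n t"
    and D: "\<And>i. subgroup (D i) (add_monoid (C i))" "\<And>i. homogeneous_cochains n i \<subseteq> D i"
  shows "(case t of 0 \<Rightarrow> {\<zero>\<^bsub>C 0\<^esub>} | Suc s \<Rightarrow> d s ` D s) +>\<^bsub>C t\<^esub> z
    = (case t of 0 \<Rightarrow> {\<zero>\<^bsub>C 0\<^esub>} | Suc s \<Rightarrow> d s ` D s)"
proof (cases t)
  case 0
  interpret C: abelian_group "C 0" by (rule cech_term_abelian_group)
  have zero: "m = \<zero>\<^bsub>M\<^esub>" if "m \<in> gr n" for m
    using expand[of m 0] that 0 by simp
  have idx: "cech_index t t = {{}}" using top_index 0 by simp
  have zP: "z \<in> (\<Pi>\<^sub>E J\<in>{{}}. loc_part R M gr (xs J) (\<Sum>j\<in>J. c j) n)"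
    using z unfolding homogeneous_cochains_def idx .
  then have "z {} \<in> loc_part R M gr (xs {}) (\<Sum>j\<in>{}. c j) n" by (rule PiE_mem) simp
  then obtain m k where m: "m \<in> gr n" and zm: "z {} = frac R M (xs {}) m k"
    by (auto simp: loc_part_def)
  have z0: "z {} = \<zero>\<^bsub>L {}\<^esub>"
    unfolding zm zero[OF m] by (rule frac_zero[OF xs_closed]) simp
  have "z = \<zero>\<^bsub>C t\<^esub>"
    unfolding cech_sel(2) idx
  proof
    fix J
    show "z J = (\<lambda>J\<in>{{}}. \<zero>\<^bsub>L J\<^esub>) J"
      using z0 PiE_arb[OF zP, of J] by (cases "J = {}") simp_all
  qed
  then have "z = \<zero>\<^bsub>C 0\<^esub>" by (simp only: 0)
  moreover have "{\<zero>\<^bsub>C 0\<^esub>} +>\<^bsub>C 0\<^esub> \<zero>\<^bsub>C 0\<^esub> = {\<zero>\<^bsub>C 0\<^esub>}" by (simp add: a_r_coset_def')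
  ultimately show ?thesis by (simp only: 0 nat.case)

next
  case (Suc s)
  interpret C: abelian_group "C t" by (rule cech_term_abelian_group)
  interpret C': abelian_group "C s" by (rule cech_term_abelian_group)
  have "group_hom (add_monoid (C s)) (add_monoid (C t)) (d s)"
    using cech_diff_hom[of s] Suc by (intro group_hom.intro group_hom_axioms.intro C.a_group C'.a_group) simp
  then have sub: "subgroup (d s ` D s) (add_monoid (C t))"
    by (rule group_hom.subgroup_img_is_subgroup[OF _ D(1)])
  have "z \<in> d s ` homogeneous_cochains n s"
    by (rule top_cochain_coboundary[OF Suc expand z])
  then have zD: "z \<in> d s ` D s" using D(2) by blast
  have "z \<in> carrier (C t)" using subgroup.mem_carrier[OF sub zD] by simp
  then have "d s ` D s +>\<^bsub>C t\<^esub> z = d s ` D s"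
    using C.a_coset_join2[OF _ sub zD] by simp
  then show ?thesis using Suc by simp
qed

end

section \<open>Blowup parts of localizations\<close>

context module
begin

lemma powers_cech_setting:
  assumes I: "ideal I R" and a: "\<And>j. j \<in> {1..t} \<Longrightarrow> a j \<in> ideal_pow R I (c j)"
  shows "cech_setting R M (ideal_pow_module R I M) a c t"
proof (intro cech_setting.intro cech_setting_axioms.intro module_axioms)
  note Psub = ideal_pow_module_submodule[OF I]
  show "a j \<in> carrier R" if "j \<in> {1..t}" for j using R.ideal_pow_carrier[OF I a[OF that]] .
  show "a j \<odot>\<^bsub>M\<^esub> m \<in> ideal_pow_module R I M (i + c j)" if "j \<in> {1..t}" "m \<in> ideal_pow_module R I M i" for j m i
    using ideal_pow_module_mult[OF I a[OF that(1)] that(2)] by (simp add: add.commute)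
qed (use ideal_pow_module_submodule[OF I] ideal_pow_module_carrier[OF I] in
    \<open>auto intro: submodule_zero submodule_add submoduleE(3)\<close>)

lemma frac_in_blowup:
  assumes I: "ideal I R" and x: "x \<in> carrier R" and p: "p \<in> ideal_pow R I (k * e)" and v: "v \<in> carrier M"
  shows "frac R M x (p \<odot>\<^bsub>M\<^esub> v) k \<in> blowup_part R I M e x"
proof (cases "k = 0")
  case True
  interpret L: module R "loc_module R M x" by (rule loc_is_module[OF x])
  have "p \<odot>\<^bsub>M\<^esub> v \<in> carrier M" using p v R.ideal_pow_carrier[OF I] by simp
  then have "frac R M x (p \<odot>\<^bsub>M\<^esub> v) k = frac R M x (p \<odot>\<^bsub>M\<^esub> v) 0 \<oplus>\<^bsub>loc_module R M x\<^esub>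
      (\<Oplus>\<^bsub>loc_module R M x\<^esub>i\<in>{1..0}. frac R M x (\<zero> \<odot>\<^bsub>M\<^esub> (p \<odot>\<^bsub>M\<^esub> v)) i)"
    using True frac_in_loc[OF x] by simp
  moreover have "\<forall>i\<le>0. p \<odot>\<^bsub>M\<^esub> v \<in> carrier M" "\<forall>i\<in>{1..0}. \<zero> \<in> ideal_pow R I (e * i)"
    using \<open>p \<odot>\<^bsub>M\<^esub> v \<in> carrier M\<close> by auto
  ultimately show ?thesis unfolding blowup_part_def
    by (intro CollectI exI[of _ "0::nat"] exI[of _ "\<lambda>_. p \<odot>\<^bsub>M\<^esub> v"] exI[of _ "\<lambda>_. \<zero>"]) auto
next
  case False
  interpret L: module R "loc_module R M x" by (rule loc_is_module[OF x])
  have pR: "p \<in> carrier R" using p R.ideal_pow_carrier[OF I] by simp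
  let ?m = "\<lambda>i. if i = k then v else \<zero>\<^bsub>M\<^esub>" and ?q = "\<lambda>i. if i = k then p else \<zero>"
  let ?f = "\<lambda>i. frac R M x (p \<odot>\<^bsub>M\<^esub> v) i"
  have f: "?f \<in> {1..k} \<rightarrow> carrier (loc_module R M x)" using frac_in_loc[OF x] pR v by auto
  have "(\<Oplus>\<^bsub>loc_module R M x\<^esub>i\<in>{1..k}. frac R M x (?q i \<odot>\<^bsub>M\<^esub> ?m i) i)
      = (\<Oplus>\<^bsub>loc_module R M x\<^esub>i\<in>{1..k}. if k = i then ?f i else \<zero>\<^bsub>loc_module R M x\<^esub>)"
    by (rule L.finsum_cong') (use f frac_zero[OF x] in auto)
  also have "\<dots> = ?f k" by (rule L.add.finprod_singleton) (use False f in auto)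
  finally have "frac R M x (p \<odot>\<^bsub>M\<^esub> v) k = frac R M x (?m 0) 0 \<oplus>\<^bsub>loc_module R M x\<^esub>
      (\<Oplus>\<^bsub>loc_module R M x\<^esub>i\<in>{1..k}. frac R M x (?q i \<odot>\<^bsub>M\<^esub> ?m i) i)"
    using False frac_zero[OF x] frac_in_loc[OF x] pR v by simp
  moreover have "\<forall>i\<le>k. ?m i \<in> carrier M" using v by simp
  moreover have "\<forall>i\<in>{1..k}. ?q i \<in> ideal_pow R I (e * i)"
    using p additive_subgroup.zero_closed[OF ideal.axioms(1)[OF R.ideal_pow_ideal[OF I]]] by (simp add: mult.commute)
  ultimately show ?thesis unfolding blowup_part_def
    by (intro CollectI exI[of _ k] exI[of _ ?m] exI[of _ ?q]) auto
qed

text \<open>Let \<open>x\<close> be the product of the \<open>a\<^sub>j\<close> and \<open>e\<close> the sum of the \<open>c\<^sub>j\<close> with \<open>j \<in> J\<close>. Since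
  \<open>x \<in> I\<^sup>e\<close>, sums of fractions \<open>m / x\<^sup>k\<close> with \<open>m \<in> I\<^sup>n\<^sup>+\<^sup>k\<^sup>e M\<close> are again of this form on a common denominator. Conversely
  \<open>I\<^sup>n\<^sup>+\<^sup>k\<^sup>e = I\<^sup>n I\<^sup>k\<^sup>e\<close> splits off the factor \<open>I\<^sup>n\<close>.\<close>

lemma blowup_eq_loc_part:
  assumes I: "ideal I R" and a: "\<And>j. j \<in> {1..t} \<Longrightarrow> a j \<in> ideal_pow R I (c j)" and J: "J \<subseteq> {1..t}"
  shows "ideal_smult R (ideal_pow R I n) (loc_module R M (cech_elem R a J))
      (blowup_part R I M (\<Sum>j\<in>J. c j) (cech_elem R a J))
    = loc_part R M (ideal_pow_module R I M) (cech_elem R a J) (\<Sum>j\<in>J. c j) n"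
proof -
  let ?P = "ideal_pow_module R I M"
  interpret A: cech_setting R M ?P a c t by (rule powers_cech_setting[OF I a])
  define x where "x = cech_elem R a J"
  define e where "e = (\<Sum>j\<in>J. c j)"
  let ?L = "loc_module R M x" and ?B = "blowup_part R I M e x" and ?T = "loc_part R M ?P x e n"
  have x: "x \<in> carrier R" unfolding x_def by (rule A.xs_closed[OF J])
  interpret L: module R ?L by (rule loc_is_module[OF x])
  note carr = R.ideal_pow_carrier[OF I] and Pcarr = ideal_pow_module_carrier[OF I]
  note Psub = ideal_pow_module_submodule[OF I]
  have T: "submodule ?T R ?L"
  proof (rule L.submoduleI)
    fix r U assume r: "r \<in> carrier R" and "U \<in> ?T"
    then obtain m k where m: "m \<in> ?P (n + k * e)" "U = frac R M x m k" by (auto simp: loc_part_def)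
    then show "r \<odot>\<^bsub>?L\<^esub> U \<in> ?T"
      using frac_smult[OF x Pcarr[OF m(1)] r] submodule_smult[OF Psub r m(1)] unfolding loc_part_def by blast
  qed (use A.loc_part_subgroup[OF J, where n = n] in \<open>auto simp: x_def e_def\<close>)

  have B_carrier: "?B \<subseteq> carrier ?L"
    using frac_in_loc[OF x] carr
    by (auto simp: blowup_part_def intro!: L.a_closed L.finsum_closed)
  have "ideal_smult R (ideal_pow R I n) ?L ?B \<subseteq> ?T"
  proof (rule L.ideal_smult_least[OF T])
    fix r U assume r: "r \<in> ideal_pow R I n" and "U \<in> ?B"
    then obtain s m q where U: "U = frac R M x (m 0) 0 \<oplus>\<^bsub>?L\<^esub> (\<Oplus>\<^bsub>?L\<^esub>i\<in>{1..s}. frac R M x (q i \<odot>\<^bsub>M\<^esub> m i) i)"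
      and m: "\<And>i. i \<le> s \<Longrightarrow> m i \<in> carrier M" and q: "\<And>i. i \<in> {1..s} \<Longrightarrow> q i \<in> ideal_pow R I (e * i)"
      unfolding blowup_part_def by blast
    let ?N = "{u \<in> carrier ?L. r \<odot>\<^bsub>?L\<^esub> u \<in> ?T}"
    have N: "submodule ?N R ?L"
      by (rule L.submodule_colon[OF T L.carrier_is_submodule carr[OF r]])
    have mem: "frac R M x u i \<in> ?N" if u: "u \<in> ?P (i * e)" for u i
    proof -
      have "r \<odot>\<^bsub>M\<^esub> u \<in> ?P (n + i * e)" by (rule ideal_pow_module_mult[OF I r u])
      then show ?thesis
        using frac_smult[OF x Pcarr[OF u] carr[OF r]] frac_in_loc[OF x Pcarr[OF u]]
        by (auto simp: loc_part_def)
    qed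
    have "frac R M x (m 0) 0 \<in> ?N" by (rule mem) (use m[of 0] in \<open>simp add: ideal_pow_module_0[OF I]\<close>)
    moreover have "frac R M x (q i \<odot>\<^bsub>M\<^esub> m i) i \<in> ?N" if i: "i \<in> {1..s}" for i
    proof (rule mem)
      show "q i \<odot>\<^bsub>M\<^esub> m i \<in> ?P (i * e)"
        unfolding ideal_pow_module_def using q[OF i] m[of i] i
        by (intro ideal_smult_mem) (auto simp: mult.commute)
    qed
    then have "(\<Oplus>\<^bsub>?L\<^esub>i\<in>{1..s}. frac R M x (q i \<odot>\<^bsub>M\<^esub> m i) i) \<in> ?N"
      by (rule L.submodule_finsum[OF N])
    ultimately have "U \<in> ?N" unfolding U by (rule L.submodule_add[OF N])
    then show "r \<odot>\<^bsub>?L\<^esub> U \<in> ?T" by simp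
  qed
  moreover have "?T \<subseteq> ideal_smult R (ideal_pow R I n) ?L ?B"
  proof
    let ?S = "ideal_smult R (ideal_pow R I n) ?L ?B"
    have S: "submodule ?S R ?L"
      by (rule L.ideal_smult_submodule) (use carr B_carrier in auto)
    fix U assume "U \<in> ?T"
    then obtain m k where m: "m \<in> ?P (n + k * e)" "U = frac R M x m k" by (auto simp: loc_part_def)
    let ?W = "{m \<in> carrier M. frac R M x m k \<in> ?S}"
    have W: "submodule ?W R M"
    proof (rule submoduleI)
      show "\<zero>\<^bsub>M\<^esub> \<in> ?W" using L.submodule_zero[OF S] by (simp add: frac_zero[OF x])
      show "\<ominus>\<^bsub>M\<^esub> u \<in> ?W" if "u \<in> ?W" for u
        using that L.submoduleE(3)[OF S] by (auto simp flip: frac_uminus[OF x])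
      show "u \<oplus>\<^bsub>M\<^esub> v \<in> ?W" if "u \<in> ?W" "v \<in> ?W" for u v
        using that L.submodule_add[OF S] by (auto simp flip: frac_add_same[OF x])
      show "r \<odot>\<^bsub>M\<^esub> u \<in> ?W" if "r \<in> carrier R" "u \<in> ?W" for r u
        using that L.submodule_smult[OF S] by (auto simp flip: frac_smult[OF x])
    qed auto
    have "ideal_pow R I (n + k * e) \<subseteq> {r \<in> carrier R. \<forall>v\<in>carrier M. r \<odot>\<^bsub>M\<^esub> v \<in> ?W}"
      unfolding R.ideal_pow_add[OF I]
    proof (rule ideal_prod_subset[OF ideal_transporter[OF W]])
      fix s p assume s: "s \<in> ideal_pow R I n" and p: "p \<in> ideal_pow R I (k * e)"
      have "s \<otimes> p \<odot>\<^bsub>M\<^esub> v \<in> ?W" if v: "v \<in> carrier M" for v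
      proof -
        have "s \<odot>\<^bsub>?L\<^esub> frac R M x (p \<odot>\<^bsub>M\<^esub> v) k \<in> ?S"
          by (rule L.ideal_smult_mem[OF s frac_in_blowup[OF I x p v]])
        then show ?thesis using v carr[OF s] carr[OF p] by (simp add: frac_smult[OF x] smult_assoc1)
      qed
      then show "s \<otimes> p \<in> {r \<in> carrier R. \<forall>v\<in>carrier M. r \<odot>\<^bsub>M\<^esub> v \<in> ?W}"
        using carr[OF s] carr[OF p] by blast
    qed simp
    then have "?P (n + k * e) \<subseteq> ?W"
      unfolding ideal_pow_module_def by (intro ideal_smult_least[OF W]) blast
    then show "U \<in> ?S" using m by blast
  qed
  ultimately show ?thesis unfolding x_def e_def by blast
qed

lemma cech_sub_cohomology_vanishes:
  assumes I: "ideal I R" and a: "\<And>j. j \<in> {1..t} \<Longrightarrow> a j \<in> ideal_pow R I (c j)"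
    and expand: "\<And>k m. m \<in> ideal_pow_module R I M (n + k * (\<Sum>j\<in>{1..t}. c j)) \<Longrightarrow>
      \<exists>y. (\<forall>i\<in>{1..t}. y i \<in> ideal_pow_module R I M (n + k * (\<Sum>j\<in>{1..t} - {i}. c j))) \<and>
        m = (\<Oplus>\<^bsub>M\<^esub>i\<in>{1..t}. (a i [^] k) \<odot>\<^bsub>M\<^esub> y i)"
  shows "carrier (cech_sub_cohomology R I M a c t n t) = {\<zero>\<^bsub>cech_sub_cohomology R I M a c t n t\<^esub>}"
proof -
  interpret A: cech_setting R M "ideal_pow_module R I M" a c t by (rule powers_cech_setting[OF I a])
  define S where "S = cech_sub_term R I M a c t n"
  have S: "S i = (A.C i)\<lparr>carrier := A.homogeneous_cochains n i\<rparr>" for i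
    unfolding S_def cech_sub_term_def A.homogeneous_cochains_def
    using blowup_eq_loc_part[OF I a A.index_subset] by (simp cong: PiE_cong)
  define B where "B = (case t of 0 \<Rightarrow> {\<zero>\<^bsub>A.C 0\<^esub>} | Suc s \<Rightarrow> A.d s ` A.homogeneous_cochains n s)"
  have B: "coboundaries S A.d t = B"
    unfolding coboundaries_def B_def S by (simp cong: nat.case_cong)
  have cocycles: "cocycles S A.d t = A.homogeneous_cochains n t"
    unfolding cocycles_def S
    by (simp add: A.cech_diff_eq A.cech_sel(2) A.beyond_top_index restrict_def)
  note sub = A.homogeneous_cochains_subgroup
  have coset: "B +>\<^bsub>A.C t\<^esub> z = B" if "z \<in> A.homogeneous_cochains n t" for z
    unfolding B_def by (rule A.top_coset[OF expand that sub order.refl])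
  have "carrier (cech_sub_cohomology R I M a c t n t) = {B +>\<^bsub>A.C t\<^esub> z | z. z \<in> A.homogeneous_cochains n t}"
    unfolding cech_sub_cohomology_def cohomology_def S_def[symmetric] B cocycles
    by (auto simp: quot_module_sel A_RCOSETS_def' a_r_coset_def' S)
  also have "\<dots> = {B}"
    using coset subgroup.one_closed[OF sub, of t n] by auto
  also have "B = \<zero>\<^bsub>cech_sub_cohomology R I M a c t n t\<^esub>"
    unfolding cech_sub_cohomology_def cohomology_def S_def[symmetric] B by (simp add: quot_module_sel)
  finally show ?thesis .
qed

end

section \<open>The Rees module\<close>

context module
begin

lemma finsum_smult_rdistr:
  assumes "finite A" "m \<in> carrier M" "f \<in> A \<rightarrow> carrier R"
  shows "(\<Oplus>i\<in>A. f i) \<odot>\<^bsub>M\<^esub> m = (\<Oplus>\<^bsub>M\<^esub>i\<in>A. f i \<odot>\<^bsub>M\<^esub> m)"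
  using assms
proof (induct A rule: finite_induct)
  case (insert i A)
  then show ?case by (simp add: Pi_def smult_l_distr)
qed simp

text \<open>Associativity of the action of the Rees ring is the case \<open>k = n\<close>. Truncating the outer sums
  at \<open>k \<le> n\<close> while \<open>n\<close> stays fixed makes an induction possible.\<close>

lemma convolution_assoc:
  fixes n :: nat
  assumes p: "\<And>i. p i \<in> carrier R" and q: "\<And>i. q i \<in> carrier R" and f: "\<And>i. f i \<in> carrier M"
  shows "k \<le> n \<Longrightarrow> (\<Oplus>\<^bsub>M\<^esub>j\<in>{..k}. (\<Oplus>i\<in>{..j}. p i \<otimes> q (j - i)) \<odot>\<^bsub>M\<^esub> f (n - j))
    = (\<Oplus>\<^bsub>M\<^esub>j\<in>{..k}. p j \<odot>\<^bsub>M\<^esub> (\<Oplus>\<^bsub>M\<^esub>i\<in>{..k - j}. q i \<odot>\<^bsub>M\<^esub> f (n - j - i)))"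
proof (induct k)
  case 0
  then show ?case using p q f by (simp add: smult_assoc1)
next
  case (Suc k)
  let ?m = "f (n - Suc k)"
  let ?g = "\<lambda>j. \<Oplus>\<^bsub>M\<^esub>i\<in>{..k - j}. q i \<odot>\<^bsub>M\<^esub> f (n - j - i)"
  have g: "?g j \<in> carrier M" for j using q f by (intro M.finsum_closed) auto
  have step: "(\<Oplus>\<^bsub>M\<^esub>i\<in>{..Suc k - j}. q i \<odot>\<^bsub>M\<^esub> f (n - j - i)) = q (Suc k - j) \<odot>\<^bsub>M\<^esub> ?m \<oplus>\<^bsub>M\<^esub> ?g j"
    if "j \<le> k" for j
  proof -
    have "Suc k - j = Suc (k - j)" "n - j - Suc (k - j) = n - Suc k" using that by auto
    then show ?thesis using q f by (simp add: M.finsum_Suc Pi_def)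
  qed
  have "(\<Oplus>\<^bsub>M\<^esub>j\<in>{..Suc k}. p j \<odot>\<^bsub>M\<^esub> (\<Oplus>\<^bsub>M\<^esub>i\<in>{..Suc k - j}. q i \<odot>\<^bsub>M\<^esub> f (n - j - i)))
      = p (Suc k) \<odot>\<^bsub>M\<^esub> (q 0 \<odot>\<^bsub>M\<^esub> ?m) \<oplus>\<^bsub>M\<^esub>
        (\<Oplus>\<^bsub>M\<^esub>j\<in>{..k}. p j \<odot>\<^bsub>M\<^esub> (\<Oplus>\<^bsub>M\<^esub>i\<in>{..Suc k - j}. q i \<odot>\<^bsub>M\<^esub> f (n - j - i)))"
    using p q f by (subst M.finsum_Suc) (auto intro!: M.finsum_closed)
  also have "(\<Oplus>\<^bsub>M\<^esub>j\<in>{..k}. p j \<odot>\<^bsub>M\<^esub> (\<Oplus>\<^bsub>M\<^esub>i\<in>{..Suc k - j}. q i \<odot>\<^bsub>M\<^esub> f (n - j - i)))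
      = (\<Oplus>\<^bsub>M\<^esub>j\<in>{..k}. p j \<odot>\<^bsub>M\<^esub> (q (Suc k - j) \<odot>\<^bsub>M\<^esub> ?m) \<oplus>\<^bsub>M\<^esub> p j \<odot>\<^bsub>M\<^esub> ?g j)"
    by (rule M.finsum_cong') (use step p q f g in \<open>auto simp: smult_r_distr\<close>)
  also have "\<dots> = (\<Oplus>\<^bsub>M\<^esub>j\<in>{..k}. p j \<odot>\<^bsub>M\<^esub> (q (Suc k - j) \<odot>\<^bsub>M\<^esub> ?m)) \<oplus>\<^bsub>M\<^esub> (\<Oplus>\<^bsub>M\<^esub>j\<in>{..k}. p j \<odot>\<^bsub>M\<^esub> ?g j)"
    by (rule M.finsum_addf) (use p q f g in auto)
  also have "(\<Oplus>\<^bsub>M\<^esub>j\<in>{..k}. p j \<odot>\<^bsub>M\<^esub> ?g j)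
      = (\<Oplus>\<^bsub>M\<^esub>j\<in>{..k}. (\<Oplus>i\<in>{..j}. p i \<otimes> q (j - i)) \<odot>\<^bsub>M\<^esub> f (n - j))"
    using Suc by simp
  finally have rhs: "(\<Oplus>\<^bsub>M\<^esub>j\<in>{..Suc k}. p j \<odot>\<^bsub>M\<^esub> (\<Oplus>\<^bsub>M\<^esub>i\<in>{..Suc k - j}. q i \<odot>\<^bsub>M\<^esub> f (n - j - i)))
      = p (Suc k) \<odot>\<^bsub>M\<^esub> (q 0 \<odot>\<^bsub>M\<^esub> ?m) \<oplus>\<^bsub>M\<^esub> ((\<Oplus>\<^bsub>M\<^esub>j\<in>{..k}. p j \<odot>\<^bsub>M\<^esub> (q (Suc k - j) \<odot>\<^bsub>M\<^esub> ?m)) \<oplus>\<^bsub>M\<^esub>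
        (\<Oplus>\<^bsub>M\<^esub>j\<in>{..k}. (\<Oplus>i\<in>{..j}. p i \<otimes> q (j - i)) \<odot>\<^bsub>M\<^esub> f (n - j)))" .
  have "(\<Oplus>i\<in>{..Suc k}. p i \<otimes> q (Suc k - i)) \<odot>\<^bsub>M\<^esub> ?m = (\<Oplus>\<^bsub>M\<^esub>i\<in>{..Suc k}. (p i \<otimes> q (Suc k - i)) \<odot>\<^bsub>M\<^esub> ?m)"
    by (rule finsum_smult_rdistr) (use p q f in auto)
  also have "\<dots> = (\<Oplus>\<^bsub>M\<^esub>i\<in>{..Suc k}. p i \<odot>\<^bsub>M\<^esub> (q (Suc k - i) \<odot>\<^bsub>M\<^esub> ?m))"
    by (rule M.finsum_cong') (use p q f in \<open>auto simp: smult_assoc1\<close>)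
  also have "\<dots> = p (Suc k) \<odot>\<^bsub>M\<^esub> (q 0 \<odot>\<^bsub>M\<^esub> ?m) \<oplus>\<^bsub>M\<^esub> (\<Oplus>\<^bsub>M\<^esub>i\<in>{..k}. p i \<odot>\<^bsub>M\<^esub> (q (Suc k - i) \<odot>\<^bsub>M\<^esub> ?m))"
    using p q f by (subst M.finsum_Suc) auto
  finally have last: "(\<Oplus>i\<in>{..Suc k}. p i \<otimes> q (Suc k - i)) \<odot>\<^bsub>M\<^esub> ?m
    = p (Suc k) \<odot>\<^bsub>M\<^esub> (q 0 \<odot>\<^bsub>M\<^esub> ?m) \<oplus>\<^bsub>M\<^esub> (\<Oplus>\<^bsub>M\<^esub>i\<in>{..k}. p i \<odot>\<^bsub>M\<^esub> (q (Suc k - i) \<odot>\<^bsub>M\<^esub> ?m))" .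
  have pq: "(\<Oplus>i\<in>{..j}. p i \<otimes> q (j - i)) \<in> carrier R" for j using p q by (intro R.finsum_closed) auto
  have "(\<Oplus>\<^bsub>M\<^esub>j\<in>{..Suc k}. (\<Oplus>i\<in>{..j}. p i \<otimes> q (j - i)) \<odot>\<^bsub>M\<^esub> f (n - j))
      = (\<Oplus>i\<in>{..Suc k}. p i \<otimes> q (Suc k - i)) \<odot>\<^bsub>M\<^esub> ?m \<oplus>\<^bsub>M\<^esub>
        (\<Oplus>\<^bsub>M\<^esub>j\<in>{..k}. (\<Oplus>i\<in>{..j}. p i \<otimes> q (j - i)) \<odot>\<^bsub>M\<^esub> f (n - j))"
    by (rule M.finsum_Suc) (use pq f in auto)
  then show ?case
    unfolding rhs last using p q f pq by (subst M.a_assoc[symmetric]) (auto intro!: M.finsum_closed)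
qed

context
  fixes I assumes I: "ideal I R"
begin

lemma rees_module_sel:
  "f \<in> carrier (rees_module R I M) \<longleftrightarrow> (\<forall>n. f n \<in> ideal_pow_module R I M n) \<and> finite {n. f n \<noteq> \<zero>\<^bsub>M\<^esub>}"
  "\<zero>\<^bsub>rees_module R I M\<^esub> = (\<lambda>n. \<zero>\<^bsub>M\<^esub>)"
  "f \<oplus>\<^bsub>rees_module R I M\<^esub> g = (\<lambda>n. f n \<oplus>\<^bsub>M\<^esub> g n)"
  "p \<odot>\<^bsub>rees_module R I M\<^esub> f = (\<lambda>n. \<Oplus>\<^bsub>M\<^esub>i\<in>{..n}. coeff (UP R) p i \<odot>\<^bsub>M\<^esub> f (n - i))"
  by (simp_all add: rees_module_def)

lemma rees_is_module: "module (rees_ring R I) (rees_module R I M)"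
proof -
  let ?P = "ideal_pow_module R I M" and ?A = "rees_ring R I" and ?M = "rees_module R I M"
  interpret P: UP_cring R "UP R" by unfold_locales
  interpret A: cring ?A by (rule R.rees_ring_cring[OF I])
  note carr = R.ideal_pow_carrier[OF I] and Pcarr = ideal_pow_module_carrier[OF I]
  note Psub = ideal_pow_module_submodule[OF I]
  note rees_sel = R.rees_ring_sel[OF I]
  have fM: "f n \<in> carrier M" if "f \<in> carrier ?M" for f n using that Pcarr by (auto simp: rees_module_sel)
  have pU: "p \<in> carrier (UP R)" if "p \<in> carrier ?A" for p using that by (simp add: rees_sel)
  have pR: "coeff (UP R) p n \<in> carrier R" if "p \<in> carrier ?A" for p n using P.coeff_closed[OF pU[OF that]] .
  show ?thesis
  proof (rule moduleI)
    show "cring ?A" by (rule A.cring_axioms)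
    show "abelian_group ?M"
    proof (rule abelian_groupI)
      show "\<zero>\<^bsub>?M\<^esub> \<in> carrier ?M" using submodule_zero[OF Psub] by (simp add: rees_module_sel)
      fix f assume f: "f \<in> carrier ?M"
      show "\<zero>\<^bsub>?M\<^esub> \<oplus>\<^bsub>?M\<^esub> f = f" using fM[OF f] by (simp add: rees_module_sel)
      have "(\<lambda>n. \<ominus>\<^bsub>M\<^esub> f n) \<in> carrier ?M"
      proof -
        have "{n. \<ominus>\<^bsub>M\<^esub> f n \<noteq> \<zero>\<^bsub>M\<^esub>} \<subseteq> {n. f n \<noteq> \<zero>\<^bsub>M\<^esub>}" by auto
        then show ?thesis
          using f submoduleE(3)[OF Psub] by (auto simp: rees_module_sel intro: finite_subset)
      qed
      moreover have "(\<lambda>n. \<ominus>\<^bsub>M\<^esub> f n) \<oplus>\<^bsub>?M\<^esub> f = \<zero>\<^bsub>?M\<^esub>"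
        using fM[OF f] by (simp add: rees_module_sel M.l_neg)
      ultimately show "\<exists>g\<in>carrier ?M. g \<oplus>\<^bsub>?M\<^esub> f = \<zero>\<^bsub>?M\<^esub>" by blast
      fix g assume g: "g \<in> carrier ?M"
      have "{n. f n \<oplus>\<^bsub>M\<^esub> g n \<noteq> \<zero>\<^bsub>M\<^esub>} \<subseteq> {n. f n \<noteq> \<zero>\<^bsub>M\<^esub>} \<union> {n. g n \<noteq> \<zero>\<^bsub>M\<^esub>}" by auto
      then have "finite {n. f n \<oplus>\<^bsub>M\<^esub> g n \<noteq> \<zero>\<^bsub>M\<^esub>}"
        using f g finite_subset by (fastforce simp: rees_module_sel)
      then show "f \<oplus>\<^bsub>?M\<^esub> g \<in> carrier ?M"
        using f g submodule_add[OF Psub] by (simp add: rees_module_sel)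
      show "f \<oplus>\<^bsub>?M\<^esub> g = g \<oplus>\<^bsub>?M\<^esub> f"
        using fM[OF f] fM[OF g] by (simp add: rees_module_sel(3) M.a_comm)
      fix h assume h: "h \<in> carrier ?M"
      show "f \<oplus>\<^bsub>?M\<^esub> g \<oplus>\<^bsub>?M\<^esub> h = f \<oplus>\<^bsub>?M\<^esub> (g \<oplus>\<^bsub>?M\<^esub> h)"
        using fM[OF f] fM[OF g] fM[OF h] by (simp add: rees_module_sel(3) M.a_assoc)
    qed
    fix f assume f: "f \<in> carrier ?M"
    show "\<one>\<^bsub>?A\<^esub> \<odot>\<^bsub>?M\<^esub> f = f"
    proof
      fix n
      have "(\<one>\<^bsub>?A\<^esub> \<odot>\<^bsub>?M\<^esub> f) n = (\<Oplus>\<^bsub>M\<^esub>i\<in>{..n}. if 0 = i then f (n - i) else \<zero>\<^bsub>M\<^esub>)"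
        unfolding rees_module_sel(4) by (rule M.finsum_cong') (use fM[OF f] in \<open>auto simp: rees_sel\<close>)
      also have "\<dots> = f (n - 0)" by (rule M.add.finprod_singleton) (use fM[OF f] in auto)
      finally show "(\<one>\<^bsub>?A\<^esub> \<odot>\<^bsub>?M\<^esub> f) n = f n" by simp
    qed
    fix p assume p: "p \<in> carrier ?A"
    note pf = smult_closed[OF pR[OF p] fM[OF f]]
    show "p \<odot>\<^bsub>?M\<^esub> f \<in> carrier ?M"
    proof -
      have "coeff (UP R) p i \<odot>\<^bsub>M\<^esub> f (n - i) \<in> ?P n" if "i \<le> n" for i n
        by (rule ideal_pow_module_mult'[OF I, of _ i _ "n - i"])
          (use p f that in \<open>auto simp: rees_sel rees_module_sel\<close>)
      then have mem: "(p \<odot>\<^bsub>?M\<^esub> f) n \<in> ?P n" for n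
        unfolding rees_module_sel(4) by (intro submodule_finsum[OF Psub]) auto
      obtain b where "bound \<zero> b p" using pU[OF p] by (auto simp: UP_def)
      then have b: "coeff (UP R) p i = \<zero>" if "i > b" for i using that pU[OF p] by (auto simp: UP_def)
      obtain b' where b': "{n. f n \<noteq> \<zero>\<^bsub>M\<^esub>} \<subseteq> {..b'}"
        using f finite_nat_iff_bounded_le by (auto simp: rees_module_sel)
      have zero: "(p \<odot>\<^bsub>?M\<^esub> f) n = \<zero>\<^bsub>M\<^esub>" if n: "n > b + b'" for n
      proof -
        have "coeff (UP R) p i \<odot>\<^bsub>M\<^esub> f (n - i) = \<zero>\<^bsub>M\<^esub>" if "i \<le> n" for i
        proof (cases "i > b")
          case True
          then show ?thesis using b fM[OF f] by simp
        next
          case False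
          then have "n - i > b'" using n by simp
          then have "f (n - i) = \<zero>\<^bsub>M\<^esub>" using b' by (meson atMost_iff mem_Collect_eq not_le subsetD)
          then show ?thesis using pR[OF p] by simp
        qed
        then show ?thesis unfolding rees_module_sel(4) by (intro M.add.finprod_one_eqI) auto
      qed
      have "{n. (p \<odot>\<^bsub>?M\<^esub> f) n \<noteq> \<zero>\<^bsub>M\<^esub>} \<subseteq> {..b + b'}"
      proof
        fix l assume "l \<in> {n. (p \<odot>\<^bsub>?M\<^esub> f) n \<noteq> \<zero>\<^bsub>M\<^esub>}"
        then show "l \<in> {..b + b'}" using zero[of l] by (cases "l > b + b'") simp_all
      qed
      then show ?thesis
 using mem finite_subset by (auto simp: rees_module_sel(1))
    qed
    show "p \<odot>\<^bsub>?M\<^esub> (f \<oplus>\<^bsub>?M\<^esub> g) = p \<odot>\<^bsub>?M\<^esub> f \<oplus>\<^bsub>?M\<^esub> p \<odot>\<^bsub>?M\<^esub> g" if g: "g \<in> carrier ?M" for g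
    proof
      fix n
      have "(p \<odot>\<^bsub>?M\<^esub> (f \<oplus>\<^bsub>?M\<^esub> g)) n = (\<Oplus>\<^bsub>M\<^esub>i\<in>{..n}. coeff (UP R) p i \<odot>\<^bsub>M\<^esub> f (n - i) \<oplus>\<^bsub>M\<^esub> coeff (UP R) p i \<odot>\<^bsub>M\<^esub> g (n - i))"
        unfolding rees_module_sel(3,4)
        by (rule M.finsum_cong') (use pR[OF p] fM[OF f] fM[OF g] in \<open>auto simp: smult_r_distr\<close>)
      also have "\<dots> = (p \<odot>\<^bsub>?M\<^esub> f \<oplus>\<^bsub>?M\<^esub> p \<odot>\<^bsub>?M\<^esub> g) n"
        unfolding rees_module_sel(3,4)
        by (rule M.finsum_addf) (use pR[OF p] fM[OF f] fM[OF g] in auto)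
      finally show "(p \<odot>\<^bsub>?M\<^esub> (f \<oplus>\<^bsub>?M\<^esub> g)) n = (p \<odot>\<^bsub>?M\<^esub> f \<oplus>\<^bsub>?M\<^esub> p \<odot>\<^bsub>?M\<^esub> g) n" .
    qed
    fix q assume q: "q \<in> carrier ?A"
    show "(p \<oplus>\<^bsub>?A\<^esub> q) \<odot>\<^bsub>?M\<^esub> f = p \<odot>\<^bsub>?M\<^esub> f \<oplus>\<^bsub>?M\<^esub> q \<odot>\<^bsub>?M\<^esub> f"
    proof
      fix n
      have "((p \<oplus>\<^bsub>?A\<^esub> q) \<odot>\<^bsub>?M\<^esub> f) n = (\<Oplus>\<^bsub>M\<^esub>i\<in>{..n}. coeff (UP R) p i \<odot>\<^bsub>M\<^esub> f (n - i) \<oplus>\<^bsub>M\<^esub> coeff (UP R) q i \<odot>\<^bsub>M\<^esub> f (n - i))"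
        unfolding rees_module_sel(4)
        by (rule M.finsum_cong') (use pR[OF p] pR[OF q] pU[OF p] pU[OF q] fM[OF f] in \<open>auto simp: smult_l_distr rees_sel(4)\<close>)
      also have "\<dots> = (p \<odot>\<^bsub>?M\<^esub> f \<oplus>\<^bsub>?M\<^esub> q \<odot>\<^bsub>?M\<^esub> f) n"
        unfolding rees_module_sel(3,4)
        by (rule M.finsum_addf) (use pR[OF p] pR[OF q] fM[OF f] in auto)
      finally show "((p \<oplus>\<^bsub>?A\<^esub> q) \<odot>\<^bsub>?M\<^esub> f) n = (p \<odot>\<^bsub>?M\<^esub> f \<oplus>\<^bsub>?M\<^esub> q \<odot>\<^bsub>?M\<^esub> f) n" .
    qed
    show "(p \<otimes>\<^bsub>?A\<^esub> q) \<odot>\<^bsub>?M\<^esub> f = p \<odot>\<^bsub>?M\<^esub> (q \<odot>\<^bsub>?M\<^esub> f)"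
    proof
      fix n
      have "((p \<otimes>\<^bsub>?A\<^esub> q) \<odot>\<^bsub>?M\<^esub> f) n = (\<Oplus>\<^bsub>M\<^esub>j\<in>{..n}. (\<Oplus>i\<in>{..j}. coeff (UP R) p i \<otimes> coeff (UP R) q (j - i)) \<odot>\<^bsub>M\<^esub> f (n - j))"
        unfolding rees_module_sel(4) using pU[OF p] pU[OF q] by (simp add: rees_sel(2))
      also have "\<dots> = (p \<odot>\<^bsub>?M\<^esub> (q \<odot>\<^bsub>?M\<^esub> f)) n"
        unfolding rees_module_sel(4)
        by (rule convolution_assoc[OF pR[OF p] pR[OF q] fM[OF f] order.refl])
      finally show "((p \<otimes>\<^bsub>?A\<^esub> q) \<odot>\<^bsub>?M\<^esub> f) n = (p \<odot>\<^bsub>?M\<^esub> (q \<odot>\<^bsub>?M\<^esub> f)) n" .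
    qed
  qed
qed

definition single :: "nat \<Rightarrow> 'c \<Rightarrow> nat \<Rightarrow> 'c" where
  "single n m = (\<lambda>l. if l = n then m else \<zero>\<^bsub>M\<^esub>)"

lemma rees_part_eq: "rees_part R I M n = single n ` ideal_pow_module R I M n"
proof
  note Psub = ideal_pow_module_submodule[OF I]
  show "rees_part R I M n \<subseteq> single n ` ideal_pow_module R I M n"
  proof
    fix f assume f: "f \<in> rees_part R I M n"
    then have "f = single n (f n)" by (auto simp: rees_part_def single_def)
    then show "f \<in> single n ` ideal_pow_module R I M n"
      using f by (auto simp: rees_part_def rees_module_sel)
  qed
  have "finite {l. single n m l \<noteq> \<zero>\<^bsub>M\<^esub>}" for m
    by (rule finite_subset[of _ "{n}"]) (auto simp: single_def)
  then show "single n ` ideal_pow_module R I M n \<subseteq> rees_part R I M n"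
    using submodule_zero[OF Psub] by (auto simp: rees_part_def rees_module_sel) (auto simp: single_def)
qed

lemma single_add:
  "m \<in> carrier M \<Longrightarrow> m' \<in> carrier M \<Longrightarrow>
    single n m \<oplus>\<^bsub>rees_module R I M\<^esub> single n m' = single n (m \<oplus>\<^bsub>M\<^esub> m')"
  by (auto simp: rees_module_sel single_def)

lemma single_zero: "\<zero>\<^bsub>rees_module R I M\<^esub> = single n \<zero>\<^bsub>M\<^esub>"
  by (auto simp: rees_module_sel single_def)

lemma single_in_rees: "m \<in> ideal_pow_module R I M n \<Longrightarrow> single n m \<in> carrier (rees_module R I M)"
  using rees_part_eq by (auto simp: rees_part_def)

lemma monom_smult_single:
  assumes b: "b \<in> carrier R" and m: "m \<in> carrier M"
  shows "monom (UP R) b e \<odot>\<^bsub>rees_module R I M\<^esub> single n m = single (e + n) (b \<odot>\<^bsub>M\<^esub> m)"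
proof
  interpret P: UP_cring R "UP R" by unfold_locales
  fix l
  have "(monom (UP R) b e \<odot>\<^bsub>rees_module R I M\<^esub> single n m) l
      = (\<Oplus>\<^bsub>M\<^esub>i\<in>{..l}. if e = i then (if l = e + n then b \<odot>\<^bsub>M\<^esub> m else \<zero>\<^bsub>M\<^esub>) else \<zero>\<^bsub>M\<^esub>)"
    unfolding rees_module_sel(4) by (rule M.finsum_cong') (use b m in \<open>auto simp: single_def\<close>)
  also have "\<dots> = single (e + n) (b \<odot>\<^bsub>M\<^esub> m) l"
  proof (cases "e \<le> l")
    case True
    have "(\<Oplus>\<^bsub>M\<^esub>i\<in>{..l}. if e = i then (if l = e + n then b \<odot>\<^bsub>M\<^esub> m else \<zero>\<^bsub>M\<^esub>) else \<zero>\<^bsub>M\<^esub>)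
        = (if l = e + n then b \<odot>\<^bsub>M\<^esub> m else \<zero>\<^bsub>M\<^esub>)"
      by (rule M.add.finprod_singleton[where f = "\<lambda>_. if l = e + n then b \<odot>\<^bsub>M\<^esub> m else \<zero>\<^bsub>M\<^esub>"])
        (use True b m in auto)
    then show ?thesis by (simp add: single_def)
  next
    case False
    then have "(\<Oplus>\<^bsub>M\<^esub>i\<in>{..l}. if e = i then (if l = e + n then b \<odot>\<^bsub>M\<^esub> m else \<zero>\<^bsub>M\<^esub>) else \<zero>\<^bsub>M\<^esub>) = \<zero>\<^bsub>M\<^esub>"
      by (intro M.add.finprod_one_eqI) auto
    then show ?thesis using False by (simp add: single_def)
  qed
  finally show "(monom (UP R) b e \<odot>\<^bsub>rees_module R I M\<^esub> single n m) l = single (e + n) (b \<odot>\<^bsub>M\<^esub> m) l" .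
qed

lemma monom_pow_rees:
  assumes "b \<in> carrier R"
  shows "monom (UP R) b e [^]\<^bsub>rees_ring R I\<^esub> (k::nat) = monom (UP R) (b [^] k) (k * e)"
proof (induct k)
  interpret P: UP_cring R "UP R" by unfold_locales
  case 0
  then show ?case by (simp add: R.rees_ring_sel[OF I] P.monom_one)
next
  interpret P: UP_cring R "UP R" by unfold_locales
  case (Suc k)
  have "monom (UP R) b e [^]\<^bsub>rees_ring R I\<^esub> Suc k = monom (UP R) (b [^] k) (k * e) \<otimes>\<^bsub>UP R\<^esub> monom (UP R) b e"
    unfolding Group.nat_pow_Suc Suc R.rees_ring_sel(2)[OF I] ..
  also have "\<dots> = monom (UP R) (b [^] k \<otimes> b) (k * e + e)"
    by (rule P.monom_mult[symmetric]) (use assms in auto)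
  also have "\<dots> = monom (UP R) (b [^] Suc k) (Suc k * e)"
    by (simp add: Group.nat_pow_Suc add.commute)
  finally show ?case .

qed

lemma single_finsum:
  assumes "finite A" "\<And>i. i \<in> A \<Longrightarrow> f i \<in> ideal_pow_module R I M n"
  shows "(\<Oplus>\<^bsub>rees_module R I M\<^esub>i\<in>A. single n (f i)) = single n (\<Oplus>\<^bsub>M\<^esub>i\<in>A. f i)"
  using assms
proof (induct A rule: finite_induct)
  interpret rees: module "rees_ring R I" "rees_module R I M" by (rule rees_is_module)
  case empty
  then show ?case using single_zero by simp
next
  interpret rees: module "rees_ring R I" "rees_module R I M" by (rule rees_is_module)
  case (insert i A)
  have "(\<lambda>i. single n (f i)) \<in> A \<rightarrow> carrier (rees_module R I M)" "single n (f i) \<in> carrier (rees_module R I M)"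
    using insert.prems single_in_rees by auto
  moreover have "f \<in> A \<rightarrow> carrier M" "f i \<in> carrier M"
    using insert.prems ideal_pow_module_carrier[OF I] by auto
  ultimately show ?case using insert by (simp add: single_add)
qed

lemma rees_cech_setting:
  assumes a: "\<And>j. j \<in> {1..t} \<Longrightarrow> a j \<in> ideal_pow R I (c j)"
  shows "cech_setting (rees_ring R I) (rees_module R I M) (rees_part R I M) (\<lambda>j. monom (UP R) (a j) (c j)) c t"
proof (intro cech_setting.intro cech_setting_axioms.intro rees_is_module)
  interpret rees: module "rees_ring R I" "rees_module R I M" by (rule rees_is_module)
  note Psub = ideal_pow_module_submodule[OF I] and Pcarr = ideal_pow_module_carrier[OF I]
  show "monom (UP R) (a j) (c j) \<in> carrier (rees_ring R I)" if "j \<in> {1..t}" for j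
    by (rule R.monom_in_rees[OF I a[OF that]])
  show "m \<in> carrier (rees_module R I M)" if "m \<in> rees_part R I M i" for m i
    using that by (simp add: rees_part_def)
  show "\<zero>\<^bsub>rees_module R I M\<^esub> \<in> rees_part R I M i" for i
    unfolding rees_part_eq single_zero[of i] using submodule_zero[OF Psub] by blast
  show "m \<oplus>\<^bsub>rees_module R I M\<^esub> m' \<in> rees_part R I M i"
    if "m \<in> rees_part R I M i" "m' \<in> rees_part R I M i" for m m' i
    using that submodule_add[OF Psub] Pcarr by (auto simp: rees_part_eq single_add)
  show "\<ominus>\<^bsub>rees_module R I M\<^esub> m \<in> rees_part R I M i" if m: "m \<in> rees_part R I M i" for m i
  proof -
    obtain u where u: "u \<in> ideal_pow_module R I M i" "m = single i u" using m by (auto simp: rees_part_eq)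
    have u': "\<ominus>\<^bsub>M\<^esub> u \<in> ideal_pow_module R I M i" using submoduleE(3)[OF Psub u(1)] .
    have "single i (\<ominus>\<^bsub>M\<^esub> u) \<oplus>\<^bsub>rees_module R I M\<^esub> m = \<zero>\<^bsub>rees_module R I M\<^esub>"
      unfolding u(2) single_zero[of i] using Pcarr[OF u(1)] by (simp add: single_add M.l_neg)
    then have "\<ominus>\<^bsub>rees_module R I M\<^esub> m = single i (\<ominus>\<^bsub>M\<^esub> u)"
      by (rule rees.minus_equality) (use u u' single_in_rees in auto)
    then show ?thesis using u' by (simp add: rees_part_eq)
  qed
  show "monom (UP R) (a j) (c j) \<odot>\<^bsub>rees_module R I M\<^esub> m \<in> rees_part R I M (i + c j)"
    if j: "j \<in> {1..t}" and m: "m \<in> rees_part R I M i" for j m i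
  proof -
    obtain u where u: "u \<in> ideal_pow_module R I M i" "m = single i u" using m by (auto simp: rees_part_eq)
    show ?thesis
      unfolding u(2) monom_smult_single[OF R.ideal_pow_carrier[OF I a[OF j]] Pcarr[OF u(1)]] rees_part_eq
      using ideal_pow_module_mult[OF I a[OF j] u(1)] by (simp add: add.commute)
  qed
qed

lemma local_cohomology_part_vanishes:
  assumes a: "\<And>j. j \<in> {1..t} \<Longrightarrow> a j \<in> ideal_pow R I (c j)"
    and expand: "\<And>k m. m \<in> ideal_pow_module R I M (n + k * (\<Sum>j\<in>{1..t}. c j)) \<Longrightarrow>
      \<exists>y. (\<forall>i\<in>{1..t}. y i \<in> ideal_pow_module R I M (n + k * (\<Sum>j\<in>{1..t} - {i}. c j))) \<and>
        m = (\<Oplus>\<^bsub>M\<^esub>i\<in>{1..t}. (a i [^] k) \<odot>\<^bsub>M\<^esub> y i)"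
  shows "local_cohomology_part (rees_ring R I) (rees_module R I M) (rees_part R I M)
      (\<lambda>j. monom (UP R) (a j) (c j)) c t t n
    = {\<zero>\<^bsub>local_cohomology (rees_ring R I) (rees_module R I M) (\<lambda>j. monom (UP R) (a j) (c j)) t t\<^esub>}"
proof -
  let ?x = "\<lambda>j. monom (UP R) (a j) (c j)"
  let ?J = "{1..t}"
  interpret A: cech_setting "rees_ring R I" "rees_module R I M" "rees_part R I M" ?x c t
    by (rule rees_cech_setting[OF a])
  note Pcarr = ideal_pow_module_carrier[OF I]
  have aR: "a j \<in> carrier R" if "j \<in> ?J" for j using R.ideal_pow_carrier[OF I a[OF that]] .
  have rees_expand: "\<exists>y. (\<forall>i\<in>?J. y i \<in> rees_part R I M (n + k * (\<Sum>j\<in>?J - {i}. c j))) \<and>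
      f = (\<Oplus>\<^bsub>rees_module R I M\<^esub>i\<in>?J. (?x i [^]\<^bsub>rees_ring R I\<^esub> k) \<odot>\<^bsub>rees_module R I M\<^esub> y i)"
    if f: "f \<in> rees_part R I M (n + k * (\<Sum>j\<in>?J. c j))" for k f
  proof -
    let ?N = "n + k * (\<Sum>j\<in>?J. c j)" and ?e = "\<lambda>i. n + k * (\<Sum>j\<in>?J - {i}. c j)"
    obtain m where m: "m \<in> ideal_pow_module R I M ?N" "f = single ?N m" using f by (auto simp: rees_part_eq)
    obtain y where y: "\<And>i. i \<in> ?J \<Longrightarrow> y i \<in> ideal_pow_module R I M (?e i)"
      and my: "m = (\<Oplus>\<^bsub>M\<^esub>i\<in>?J. (a i [^] k) \<odot>\<^bsub>M\<^esub> y i)"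
      using expand[OF m(1)] by blast
    let ?y = "\<lambda>i. single (?e i) (y i)"
    have deg: "k * c i + ?e i = ?N" if "i \<in> ?J" for i
      using that by (subst sum.remove[of ?J i]) (auto simp: algebra_simps)
    have ay: "(a i [^] k) \<odot>\<^bsub>M\<^esub> y i \<in> ideal_pow_module R I M ?N" if i: "i \<in> ?J" for i
      using ideal_pow_module_mult[OF I R.ideal_pow_nat_pow[OF I a[OF i], of k] y[OF i]] unfolding deg[OF i] .

    have "(\<Oplus>\<^bsub>rees_module R I M\<^esub>i\<in>?J. (?x i [^]\<^bsub>rees_ring R I\<^esub> k) \<odot>\<^bsub>rees_module R I M\<^esub> ?y i)
        = (\<Oplus>\<^bsub>rees_module R I M\<^esub>i\<in>?J. single ?N ((a i [^] k) \<odot>\<^bsub>M\<^esub> y i))"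
    proof (rule A.finsum_cong')
      show "(\<lambda>i. single ?N ((a i [^] k) \<odot>\<^bsub>M\<^esub> y i)) \<in> ?J \<rightarrow> carrier (rees_module R I M)"
        using ay single_in_rees by blast
      fix i assume i: "i \<in> ?J"
      show "(?x i [^]\<^bsub>rees_ring R I\<^esub> k) \<odot>\<^bsub>rees_module R I M\<^esub> ?y i = single ?N ((a i [^] k) \<odot>\<^bsub>M\<^esub> y i)"
        unfolding monom_pow_rees[OF aR[OF i]] monom_smult_single[OF R.nat_pow_closed[OF aR[OF i]] Pcarr[OF y[OF i]]]
        unfolding deg[OF i] ..
    qed simp
    also have "\<dots> = f" unfolding m(2) my by (rule single_finsum) (use ay in auto)
    finally have "f = (\<Oplus>\<^bsub>rees_module R I M\<^esub>i\<in>?J. (?x i [^]\<^bsub>rees_ring R I\<^esub> k) \<odot>\<^bsub>rees_module R I M\<^esub> ?y i)" ..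
    moreover have "\<forall>i\<in>?J. ?y i \<in> rees_part R I M (?e i)" using y by (auto simp: rees_part_eq)
    ultimately show ?thesis by (intro exI[of _ ?y] conjI)

  qed
  let ?B = "coboundaries A.C A.d t"
  have B: "?B = (case t of 0 \<Rightarrow> {\<zero>\<^bsub>A.C 0\<^esub>} | Suc s \<Rightarrow> A.d s ` carrier (A.C s))"
    by (simp add: coboundaries_def)
  have C: "subgroup (carrier (A.C i)) (add_monoid (A.C i))" for i
    using group.subgroup_self[OF abelian_group.a_group[OF A.cech_term_abelian_group]] by simp
  have H_le: "A.homogeneous_cochains n i \<subseteq> carrier (A.C i)" for i
    using subgroup.subset[OF A.homogeneous_cochains_subgroup] by simp
  have coset: "?B +>\<^bsub>A.C t\<^esub> z = ?B" if "z \<in> A.homogeneous_cochains n t" for z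
    unfolding B by (rule A.top_coset[OF rees_expand that C H_le])
  have H: "z \<in> cocycles A.C A.d t \<and>
      (\<forall>J\<in>cech_index t t. z J \<in> loc_part (rees_ring R I) (rees_module R I M) (rees_part R I M) (A.xs J) (\<Sum>j\<in>J. c j) n)
    \<longleftrightarrow> z \<in> A.homogeneous_cochains n t" for z
  proof
    assume "z \<in> A.homogeneous_cochains n t"
    then show "z \<in> cocycles A.C A.d t \<and> (\<forall>J\<in>cech_index t t.
        z J \<in> loc_part (rees_ring R I) (rees_module R I M) (rees_part R I M) (A.xs J) (\<Sum>j\<in>J. c j) n)"
      using H_le[of t] unfolding A.cocycles_top A.homogeneous_cochains_def by (auto dest: PiE_mem)
  qed (simp add: A.cocycles_top A.homogeneous_cochains_def A.cech_sel PiE_iff)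

  have "local_cohomology_part (rees_ring R I) (rees_module R I M) (rees_part R I M) ?x c t t n
      = {?B +>\<^bsub>A.C t\<^esub> z | z. z \<in> A.homogeneous_cochains n t}"
    unfolding local_cohomology_part_def H ..
  also have "\<dots> = {?B}"
    using coset subgroup.one_closed[OF A.homogeneous_cochains_subgroup, of t n] by auto
  also have "?B = \<zero>\<^bsub>local_cohomology (rees_ring R I) (rees_module R I M) ?x t t\<^esub>"
    by (simp add: local_cohomology_def cohomology_def quot_module_sel)
  finally show ?thesis .
qed

end

end

theorem theorem8p3:
  fixes A :: "('a, 'm) ring_scheme"
    and M :: "('a, 'b, 'k) module_scheme"
    and \<mm> \<qq> :: "'a set"
    and a :: "nat \<Rightarrow> 'a"
    and c :: "nat \<Rightarrow> nat"
    and t :: nat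
  assumes "noetherian_ring A" and "local_ring A \<mm>"
    and "ideal \<qq> A" and "\<qq> \<noteq> carrier A"
    and "module A M" and "finitely_generated A M"
    and "system_of_parameters A \<mm> M a t"
    and "\<forall>i\<in>{1..t}. a i \<in> ideal_pow A \<qq> (c i)"
    and "\<forall>i\<in>{1..t}. \<forall>\<PP> \<in>
           Ass (form_ring A \<qq>)
             (form_module A \<qq>
               (quot_module M (ideal_smult A (genideal A (a ` {1..<i})) M (carrier M))))
           - V_set (form_ring A \<qq>) (form_ring_plus A \<qq>).
         form_elem A \<qq> (c i) (a i) \<notin> \<PP>"
  shows "\<exists>n\<^sub>0. \<forall>n\<ge>n\<^sub>0.
      carrier (cech_sub_cohomology A \<qq> M a c t n t) = {\<zero>\<^bsub>cech_sub_cohomology A \<qq> M a c t n t\<^esub>} \<and>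
      local_cohomology_part (rees_ring A \<qq>) (rees_module A \<qq> M) (rees_part A \<qq> M)
          (\<lambda>j. monom (UP A) (a j) (c j)) c t t n
        = {\<zero>\<^bsub>local_cohomology (rees_ring A \<qq>) (rees_module A \<qq> M)
              (\<lambda>j. monom (UP A) (a j) (c j)) t t\<^esub>}"
proof -
  interpret module A M by fact
  let ?P = "ideal_pow_module A \<qq> M"
  let ?X = "a ` {1..t}"
  let ?U = "ideal_smult A (genideal A ?X) M (carrier M)"
  have noeth: "noetherian_module A M"
    by (rule finitely_generated_noetherian[OF assms(1,6)])
  have a: "a i \<in> ideal_pow A \<qq> (c i)" if "i \<in> {1..t}" for i using assms(8) that by blast
  have "\<exists>n1. \<forall>n\<ge>n1. \<forall>z\<in>?P n. z \<in> ?U \<longrightarrow>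
      (\<exists>y. (\<forall>j\<in>{1..t}. y j \<in> ?P (n - c j)) \<and> z = (\<Oplus>\<^bsub>M\<^esub>j\<in>{1..t}. a j \<odot>\<^bsub>M\<^esub> y j))"
    by (rule intersection_expansion[OF assms(1) noeth assms(3) a _ order.refl]) (use assms(9) in blast)+
  then obtain n1 where n1: "\<And>n z. n \<ge> n1 \<Longrightarrow> z \<in> ?P n \<Longrightarrow> z \<in> ?U \<Longrightarrow>
      \<exists>y. (\<forall>j\<in>{1..t}. y j \<in> ?P (n - c j)) \<and> z = (\<Oplus>\<^bsub>M\<^esub>j\<in>{1..t}. a j \<odot>\<^bsub>M\<^esub> y j)" by blast
  have X: "?X \<subseteq> carrier A" using a R.ideal_pow_carrier[OF assms(3)] by blast
  have U: "submodule ?U A M"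
    using ideal.Icarr[OF R.genideal_ideal[OF X]] by (intro ideal_smult_submodule) auto
  interpret Q: module A "quot_module M ?U" by (rule quot_is_module[OF U])
  have "finite_length A (quot_module M ?U)" using assms(7) by (simp add: system_of_parameters_def)
  then obtain n2 where n2: "\<And>n. n \<ge> n2 \<Longrightarrow> ideal_pow_module A \<qq> (quot_module M ?U) n = {\<zero>\<^bsub>quot_module M ?U\<^esub>}"
    using Q.finite_length_powers_vanish[OF assms(1-4) quot_noetherian[OF U noeth]] by blast
  have P_U: "z \<in> ?U" if n: "n \<ge> n2" and z: "z \<in> ?P n" for n z
  proof -
    have "?U +>\<^bsub>M\<^esub> z \<in> ideal_pow_module A \<qq> (quot_module M ?U) n"
      unfolding quot_ideal_pow_module[OF U assms(3)] using z by blast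
    then have "?U +>\<^bsub>M\<^esub> z = ?U" using n2[OF n] by (simp add: quot_module_sel)
    then show ?thesis using coset_eq_submodule_iff[OF U ideal_pow_module_carrier[OF assms(3) z]] by simp
  qed
  have base: "\<exists>y. (\<forall>j\<in>{1..t}. y j \<in> ?P (n - c j)) \<and> z = (\<Oplus>\<^bsub>M\<^esub>j\<in>{1..t}. a j \<odot>\<^bsub>M\<^esub> y j)"
    if "n \<ge> max n1 n2" "z \<in> ?P n" for n z
    using n1[of n z] P_U[of n z] that by simp
  show ?thesis
  proof (intro exI[of _ "max n1 n2"] allI impI conjI)
    fix n assume n: "n \<ge> max n1 n2"
    have expand: "\<exists>y. (\<forall>i\<in>{1..t}. y i \<in> ?P (n + k * (\<Sum>j\<in>{1..t} - {i}. c j))) \<and>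
        m = (\<Oplus>\<^bsub>M\<^esub>i\<in>{1..t}. (a i [^]\<^bsub>A\<^esub> k) \<odot>\<^bsub>M\<^esub> y i)"
      if "m \<in> ?P (n + k * (\<Sum>j\<in>{1..t}. c j))" for k m
      by (rule power_expansion[OF assms(3) _ a base n that]) auto
    show "carrier (cech_sub_cohomology A \<qq> M a c t n t) = {\<zero>\<^bsub>cech_sub_cohomology A \<qq> M a c t n t\<^esub>}"
      by (rule cech_sub_cohomology_vanishes[OF assms(3) a expand])
    show "local_cohomology_part (rees_ring A \<qq>) (rees_module A \<qq> M) (rees_part A \<qq> M)
          (\<lambda>j. monom (UP A) (a j) (c j)) c t t n
        = {\<zero>\<^bsub>local_cohomology (rees_ring A \<qq>) (rees_module A \<qq> M)
              (\<lambda>j. monom (UP A) (a j) (c j)) t t\<^esub>}"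
      by (rule local_cohomology_part_vanishes[OF assms(3) a expand])
  qed
qed

end
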